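(* Let $c\in\mathbb{R}$ and let $(M^2,g)$ be a biconservative surface in a space form $N^3(c)$, with induced metric $g$, Gaussian curvature $K$ and mean curvature function $f$. Suppose that $f(p)>0$ and $(\nabla f)(p)\neq 0$ at every point $p\in M$. Then there is an open dense subset $W\subset M$ such that every point of $W$ has an open neighborhood $U\subset W$ and a smooth function $r:U\to\mathbb{R}$ for which $\left(U,(c-K)^rg\right)$ is a Ricci surface in $N^3(c)$, where $r$ satisfies on $U$ the equation $$K+\Delta\left(\frac{1}{4}\log(c-K_r)+\frac{r}{2}\log(c-K)\right)=0,$$ and the Gaussian curvature $K_r$ of $(c-K)^rg$ is given by $$K_r=(c-K)^{-r}\left(\frac{3-4r}{3}K+\frac{1}{2}\log(c-K)\,\Delta r+(c-K)^{-1}g(\nabla r,\nabla K)\right).$$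
   Context: All surfaces are assumed to be smooth, connected and oriented. $N^3(c)$ is the 3-dimensional simply connected complete Riemannian manifold of constant sectional curvature $c$. For a surface $M^2$ isometrically immersed in $N^3(c)$, $A$ denotes its shape operator with respect to the chosen unit normal and $f=\operatorname{trace}A$ is the mean curvature function (no factor $1/2$). The surface is biconservative if and only if $A(\nabla f)=-\frac{f}{2}\nabla f$ on $M$ (in general, a submanifold is biconservative if the tangent part of the bitension field of its immersion vanishes; for surfaces in $N^3(c)$ this is equivalent to the stated equation). For a biconservative surface with $f>0$ and $\nabla f\ne0$ everywhere one has $K=-\frac{3f^2}{4}+c$, so $c-K>0$. $\nabla$ and $\Delta$ are taken with respect to $g$, with the sign convention $\Delta=-\operatorname{trace}\nabla^2=-\operatorname{div}\nabla$ on functions. A Riemannian surface $(S^2,\tilde g)$ with Gaussian curvature $\tilde K$ is a Ricci surface in $N^3(c)$ if $c-\tilde K>0$ on $S$ and the metric $(c-\tilde K)^{1/2}\tilde g$ is flat. *)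

theory Defs
  imports "HOL-Analysis.Analysis"
begin

text \<open>
  Manifolds are given by atlases. A chart is a pair \<open>(D, x)\<close> of an open set of points and a
  coordinate map, and an atlas need not be maximal. The carrier \<open>S\<close> of a manifold is an open set of
  a topological type and the charts are used on \<open>D \<inter> S\<close>, so an open subset of a manifold is a
  manifold with the same atlas.

  Tensor fields are given classically, by their components in each chart, subject to the
  transformation law. Only the components at points of \<open>D \<inter> S\<close> are relevant.
\<close>

type_synonym ('a, 'n) chart = "'a set \<times> ('a \<Rightarrow> real^'n)"
type_synonym ('a, 'n) vfield = "('a, 'n) chart \<Rightarrow> 'a \<Rightarrow> real^'n"
type_synonym ('a, 'n) metric = "('a, 'n) chart \<Rightarrow> 'a \<Rightarrow> real^'n^'n"


section \<open>Calculus on open sets of Euclidean space\<close>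

primrec Ck_on :: "nat \<Rightarrow> 'a::real_normed_vector set \<Rightarrow> ('a \<Rightarrow> 'b::real_normed_vector) \<Rightarrow> bool" where
  "Ck_on 0 X F \<longleftrightarrow> continuous_on X F"
| "Ck_on (Suc k) X F \<longleftrightarrow> (\<forall>u\<in>X. F differentiable (at u)) \<and>
     (\<forall>v. Ck_on k X (\<lambda>u. frechet_derivative F (at u) v))"

definition smooth_on :: "'a::real_normed_vector set \<Rightarrow> ('a \<Rightarrow> 'b::real_normed_vector) \<Rightarrow> bool" where
  "smooth_on X F \<longleftrightarrow> (\<forall>k. Ck_on k X F)"

definition pd :: "'n \<Rightarrow> (real^'n \<Rightarrow> 'b::real_normed_vector) \<Rightarrow> real^'n \<Rightarrow> 'b" where
  "pd i F u = frechet_derivative F (at u) (axis i 1)"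


section \<open>Riemannian geometry in coordinates\<close>

text \<open>Here \<open>G u\<close> is the matrix of the metric at the coordinate point \<open>u\<close>.\<close>

text \<open>\<open>christoffel G u k i j\<close> is \<open>\<Gamma>\<^sup>k\<^sub>i\<^sub>j\<close>.\<close>

definition christoffel :: "(real^'n \<Rightarrow> real^'n^'n) \<Rightarrow> real^'n \<Rightarrow> 'n \<Rightarrow> 'n \<Rightarrow> 'n \<Rightarrow> real" where
  "christoffel G u k i j = (1/2) * (\<Sum>l\<in>UNIV. matrix_inv (G u) $ k $ l *
     (pd i (\<lambda>v. G v $ l $ j) u + pd j (\<lambda>v. G v $ l $ i) u - pd l (\<lambda>v. G v $ i $ j) u))"

text \<open>\<open>riemann_coeff G u l k i j\<close> is the coefficient of \<open>\<partial>\<^sub>l\<close> in \<open>R(\<partial>\<^sub>i, \<partial>\<^sub>j) \<partial>\<^sub>k\<close>, where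
  \<open>R(X, Y) = \<nabla>\<^sub>X \<nabla>\<^sub>Y - \<nabla>\<^sub>Y \<nabla>\<^sub>X - \<nabla>\<^bsub>[X, Y]\<^esub>\<close>.\<close>

definition riemann_coeff :: "(real^'n \<Rightarrow> real^'n^'n) \<Rightarrow> real^'n \<Rightarrow> 'n \<Rightarrow> 'n \<Rightarrow> 'n \<Rightarrow> 'n \<Rightarrow> real" where
  "riemann_coeff G u l k i j =
     pd i (\<lambda>v. christoffel G v l j k) u - pd j (\<lambda>v. christoffel G v l i k) u
     + (\<Sum>m\<in>UNIV. christoffel G u l i m * christoffel G u m j k
                 - christoffel G u l j m * christoffel G u m i k)"

definition riemann :: "(real^'n \<Rightarrow> real^'n^'n) \<Rightarrow> real^'n \<Rightarrow> real^'n \<Rightarrow> real^'n \<Rightarrow> real^'n \<Rightarrow> real^'n" where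
  "riemann G u X Y Z = (\<chi> l. \<Sum>i\<in>UNIV. \<Sum>j\<in>UNIV. \<Sum>k\<in>UNIV.
     riemann_coeff G u l k i j * X $ i * Y $ j * Z $ k)"

definition ginner :: "real^'n^'n \<Rightarrow> real^'n \<Rightarrow> real^'n \<Rightarrow> real" where
  "ginner Q X Y = X \<bullet> (Q *v Y)"

definition sectional :: "(real^'n \<Rightarrow> real^'n^'n) \<Rightarrow> real^'n \<Rightarrow> real^'n \<Rightarrow> real^'n \<Rightarrow> real" where
  "sectional G u X Y = ginner (G u) (riemann G u X Y Y) X /
     (ginner (G u) X X * ginner (G u) Y Y - (ginner (G u) X Y)\<^sup>2)"


section \<open>Manifolds and Riemannian metrics\<close>

definition loc :: "('a, 'n) chart \<Rightarrow> ('a \<Rightarrow> 'b) \<Rightarrow> real^'n \<Rightarrow> 'b" where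
  "loc ch F u = F (inv_into (fst ch) (snd ch) u)"

definition transition_jacobian :: "('a, 'n::finite) chart \<Rightarrow> ('a, 'n) chart \<Rightarrow> 'a \<Rightarrow> real^'n^'n" where
  "transition_jacobian ch ch' p = jacobian (loc ch (snd ch')) (at (snd ch p))"

definition smooth_manifold ::
  "'a::{t2_space,second_countable_topology} set \<Rightarrow> ('a, 'n::finite) chart set \<Rightarrow> bool" where
  "smooth_manifold S A \<longleftrightarrow> open S \<and> S \<subseteq> (\<Union>ch\<in>A. fst ch) \<and>
     (\<forall>(D, x)\<in>A. open D \<and> open (x ` D) \<and> homeomorphism D (x ` D) x (inv_into D x)) \<and>
     (\<forall>ch\<in>A. \<forall>ch'\<in>A. smooth_on (snd ch ` (fst ch \<inter> fst ch' \<inter> S)) (loc ch (snd ch')))"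

definition oriented_atlas :: "'a set \<Rightarrow> ('a, 'n::finite) chart set \<Rightarrow> bool" where
  "oriented_atlas S A \<longleftrightarrow> (\<forall>ch\<in>A. \<forall>ch'\<in>A. \<forall>p\<in>fst ch \<inter> fst ch' \<inter> S.
     det (transition_jacobian ch ch' p) > 0)"

definition surface :: "'a::{t2_space,second_countable_topology} set \<Rightarrow> ('a, 2) chart set \<Rightarrow> bool" where
  "surface S A \<longleftrightarrow> smooth_manifold S A \<and> oriented_atlas S A \<and> connected S \<and> S \<noteq> {}"

definition smooth_fun :: "'a set \<Rightarrow> ('a, 'n::finite) chart set \<Rightarrow> ('a \<Rightarrow> real) \<Rightarrow> bool" where
  "smooth_fun S A F \<longleftrightarrow> (\<forall>ch\<in>A. smooth_on (snd ch ` (fst ch \<inter> S)) (loc ch F))"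

definition riemannian_metric :: "'a set \<Rightarrow> ('a, 'n::finite) chart set \<Rightarrow> ('a, 'n) metric \<Rightarrow> bool" where
  "riemannian_metric S A g \<longleftrightarrow>
     (\<forall>ch\<in>A. smooth_on (snd ch ` (fst ch \<inter> S)) (loc ch (g ch))) \<and>
     (\<forall>ch\<in>A. \<forall>p\<in>fst ch \<inter> S. transpose (g ch p) = g ch p \<and>
        (\<forall>X. X \<noteq> 0 \<longrightarrow> ginner (g ch p) X X > 0)) \<and>
     (\<forall>ch\<in>A. \<forall>ch'\<in>A. \<forall>p\<in>fst ch \<inter> fst ch' \<inter> S.
        g ch p = transpose (transition_jacobian ch ch' p) ** g ch' p ** transition_jacobian ch ch' p)"

definition riemannian_surface ::
  "'a::{t2_space,second_countable_topology} set \<Rightarrow> ('a, 2) chart set \<Rightarrow> ('a, 2) metric \<Rightarrow> bool" where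
  "riemannian_surface S A g \<longleftrightarrow> surface S A \<and> riemannian_metric S A g"

text \<open>Intrinsic scalars are computed at a point \<open>p\<close> in some chart around \<open>p\<close>; their values do not
  depend on the choice of the chart.\<close>

definition chart_at :: "('a, 'n) chart set \<Rightarrow> 'a \<Rightarrow> ('a, 'n) chart" where
  "chart_at A p = (SOME ch. ch \<in> A \<and> p \<in> fst ch)"

definition gauss_curvature :: "('a, 2) chart set \<Rightarrow> ('a, 2) metric \<Rightarrow> 'a \<Rightarrow> real" where
  "gauss_curvature A g p = (let ch = chart_at A p in
     sectional (loc ch (g ch)) (snd ch p) (axis 1 1) (axis 2 1))"

definition gradient :: "('a, 'n::finite) metric \<Rightarrow> ('a \<Rightarrow> real) \<Rightarrow> ('a, 'n) vfield" where
  "gradient g F ch p =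
     matrix_inv (g ch p) *v (\<chi> j. pd j (loc ch F) (snd ch p))"

definition inner_field ::
  "('a, 'n::finite) chart set \<Rightarrow> ('a, 'n) metric \<Rightarrow> ('a, 'n) vfield \<Rightarrow> ('a, 'n) vfield \<Rightarrow> 'a \<Rightarrow> real" where
  "inner_field A g X Y p = (let ch = chart_at A p in ginner (g ch p) (X ch p) (Y ch p))"

text \<open>The Laplacian with the sign convention \<open>\<Delta> = - trace \<nabla>\<^sup>2\<close>.\<close>

definition laplacian :: "('a, 'n::finite) chart set \<Rightarrow> ('a, 'n) metric \<Rightarrow> ('a \<Rightarrow> real) \<Rightarrow> 'a \<Rightarrow> real" where
  "laplacian A g F p = (let ch = chart_at A p; G = loc ch (g ch); u = snd ch p in
     - (\<Sum>i\<in>UNIV. \<Sum>j\<in>UNIV. matrix_inv (G u) $ i $ j *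
          (pd i (pd j (loc ch F)) u - (\<Sum>k\<in>UNIV. christoffel G u k i j * pd k (loc ch F) u))))"

definition flat_surface :: "'a set \<Rightarrow> ('a, 2) chart set \<Rightarrow> ('a, 2) metric \<Rightarrow> bool" where
  "flat_surface S A g \<longleftrightarrow> (\<forall>p\<in>S. gauss_curvature A g p = 0)"

definition scale_metric :: "('a \<Rightarrow> real) \<Rightarrow> ('a, 'n::finite) metric \<Rightarrow> ('a, 'n) metric" where
  "scale_metric \<rho> g = (\<lambda>ch p. \<rho> p *\<^sub>R g ch p)"

definition ricci_surface ::
  "real \<Rightarrow> 'a::{t2_space,second_countable_topology} set \<Rightarrow> ('a, 2) chart set \<Rightarrow> ('a, 2) metric \<Rightarrow> bool" where
  "ricci_surface c S A g \<longleftrightarrow> riemannian_surface S A g \<and>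
     (\<forall>p\<in>S. c - gauss_curvature A g p > 0) \<and>
     flat_surface S A (scale_metric (\<lambda>p. (c - gauss_curvature A g p) powr (1/2)) g)"


section \<open>Space forms\<close>

definition geodesic ::
  "'b::topological_space set \<Rightarrow> ('b, 'n::finite) chart set \<Rightarrow> ('b, 'n) metric \<Rightarrow> (real \<Rightarrow> 'b) \<Rightarrow> bool" where
  "geodesic N B h \<gamma> \<longleftrightarrow> continuous_on UNIV \<gamma> \<and> range \<gamma> \<subseteq> N \<and>
     (\<forall>ch\<in>B. \<exists>v a. \<forall>t. \<gamma> t \<in> fst ch \<longrightarrow>
        ((snd ch \<circ> \<gamma>) has_vector_derivative v t) (at t) \<and>
        (v has_vector_derivative a t) (at t) \<and>
        (\<forall>k. a t $ k + (\<Sum>i\<in>UNIV. \<Sum>j\<in>UNIV.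
           christoffel (loc ch (h ch)) (snd ch (\<gamma> t)) k i j * v t $ i * v t $ j) = 0))"

text \<open>Completeness is geodesic completeness: each tangent vector is the initial velocity of a
  geodesic defined on the whole real line.\<close>

definition complete_riemannian ::
  "'b::topological_space set \<Rightarrow> ('b, 'n::finite) chart set \<Rightarrow> ('b, 'n) metric \<Rightarrow> bool" where
  "complete_riemannian N B h \<longleftrightarrow> (\<forall>ch\<in>B. \<forall>p\<in>fst ch \<inter> N. \<forall>v.
     \<exists>\<gamma>. geodesic N B h \<gamma> \<and> \<gamma> 0 = p \<and> ((snd ch \<circ> \<gamma>) has_vector_derivative v) (at 0))"

definition constant_sectional_curvature ::
  "'b set \<Rightarrow> ('b, 'n::finite) chart set \<Rightarrow> ('b, 'n) metric \<Rightarrow> real \<Rightarrow> bool" where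
  "constant_sectional_curvature N B h c \<longleftrightarrow> (\<forall>ch\<in>B. \<forall>p\<in>fst ch \<inter> N. \<forall>X Y.
     X \<noteq> Y \<and> independent {X, Y} \<longrightarrow> sectional (loc ch (h ch)) (snd ch p) X Y = c)"

text \<open>\<open>N\<^sup>3(c)\<close> is only determined up to isometry; this predicate says that \<open>(N, h)\<close> is such a manifold.\<close>

definition space_form3 ::
  "'b::{t2_space,second_countable_topology} set \<Rightarrow> ('b, 3) chart set \<Rightarrow> ('b, 3) metric \<Rightarrow> real \<Rightarrow> bool" where
  "space_form3 N B h c \<longleftrightarrow> smooth_manifold N B \<and> riemannian_metric N B h \<and>
     simply_connected N \<and> complete_riemannian N B h \<and> constant_sectional_curvature N B h c"


section \<open>Isometrically immersed surfaces\<close>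

definition smooth_map ::
  "'a::topological_space set \<Rightarrow> ('a, 'm::finite) chart set \<Rightarrow>
   'b::topological_space set \<Rightarrow> ('b, 'n::finite) chart set \<Rightarrow> ('a \<Rightarrow> 'b) \<Rightarrow> bool" where
  "smooth_map S A N B \<phi> \<longleftrightarrow> continuous_on S \<phi> \<and> \<phi> ` S \<subseteq> N \<and>
     (\<forall>ch\<in>A. \<forall>e\<in>B. smooth_on (snd ch ` {p \<in> fst ch \<inter> S. \<phi> p \<in> fst e}) (loc ch (snd e \<circ> \<phi>)))"

text \<open>Components of \<open>d\<phi>(\<partial>\<^sub>i)\<close> at \<open>p\<close> with respect to the chart \<open>e\<close> of the target.\<close>

definition push :: "('a, 'm::finite) chart \<Rightarrow> ('b, 'n::finite) chart \<Rightarrow> ('a \<Rightarrow> 'b) \<Rightarrow> 'm \<Rightarrow> 'a \<Rightarrow> real^'n" where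
  "push ch e \<phi> i p = pd i (loc ch (snd e \<circ> \<phi>)) (snd ch p)"

text \<open>Since \<open>g\<close> is positive definite, \<open>g = \<phi>\<^sup>* h\<close> forces \<open>\<phi>\<close> to be an immersion.\<close>

definition isometric_immersion ::
  "'a::topological_space set \<Rightarrow> ('a, 'm::finite) chart set \<Rightarrow> ('a, 'm) metric \<Rightarrow>
   'b::topological_space set \<Rightarrow> ('b, 'n::finite) chart set \<Rightarrow> ('b, 'n) metric \<Rightarrow> ('a \<Rightarrow> 'b) \<Rightarrow> bool" where
  "isometric_immersion S A g N B h \<phi> \<longleftrightarrow> smooth_map S A N B \<phi> \<and>
     (\<forall>ch\<in>A. \<forall>e\<in>B. \<forall>p\<in>fst ch \<inter> S. \<phi> p \<in> fst e \<longrightarrow>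
        (\<forall>i j. g ch p $ i $ j = ginner (h e (\<phi> p)) (push ch e \<phi> i p) (push ch e \<phi> j p)))"

text \<open>A vector field along \<open>\<phi>\<close> is given by its components \<open>\<eta> e p\<close> at \<open>p\<close> in the charts \<open>e\<close> of the
  target around \<open>\<phi> p\<close>.\<close>

definition unit_normal_field ::
  "'a::topological_space set \<Rightarrow> ('a, 2) chart set \<Rightarrow> ('b::topological_space, 3) chart set \<Rightarrow> ('b, 3) metric \<Rightarrow>
   ('a \<Rightarrow> 'b) \<Rightarrow> (('b, 3) chart \<Rightarrow> 'a \<Rightarrow> real^3) \<Rightarrow> bool" where
  "unit_normal_field S A B h \<phi> \<eta> \<longleftrightarrow>
     (\<forall>ch\<in>A. \<forall>e\<in>B. smooth_on (snd ch ` {p \<in> fst ch \<inter> S. \<phi> p \<in> fst e}) (loc ch (\<eta> e))) \<and>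
     (\<forall>e\<in>B. \<forall>e'\<in>B. \<forall>p\<in>S. \<phi> p \<in> fst e \<inter> fst e' \<longrightarrow>
        \<eta> e' p = transition_jacobian e e' (\<phi> p) *v \<eta> e p) \<and>
     (\<forall>e\<in>B. \<forall>p\<in>S. \<phi> p \<in> fst e \<longrightarrow> ginner (h e (\<phi> p)) (\<eta> e p) (\<eta> e p) = 1) \<and>
     (\<forall>ch\<in>A. \<forall>e\<in>B. \<forall>p\<in>fst ch \<inter> S. \<phi> p \<in> fst e \<longrightarrow>
        (\<forall>i. ginner (h e (\<phi> p)) (\<eta> e p) (push ch e \<phi> i p) = 0))"

text \<open>The components in \<open>e\<close> of the covariant derivative of a field \<open>\<eta>\<close> along \<open>\<phi>\<close> in the
  direction \<open>\<partial>\<^sub>i\<close>, for the Levi-Civita connection of the target.\<close>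

definition cov_deriv_along ::
  "('b, 'n::finite) metric \<Rightarrow> ('a \<Rightarrow> 'b) \<Rightarrow> ('a, 'm::finite) chart \<Rightarrow> ('b, 'n) chart \<Rightarrow>
   (('b, 'n) chart \<Rightarrow> 'a \<Rightarrow> real^'n) \<Rightarrow> 'm \<Rightarrow> 'a \<Rightarrow> real^'n" where
  "cov_deriv_along h \<phi> ch e \<eta> i p = pd i (loc ch (\<eta> e)) (snd ch p) +
     (\<chi> a. \<Sum>b\<in>UNIV. \<Sum>d\<in>UNIV. christoffel (loc e (h e)) (snd e (\<phi> p)) a b d *
        push ch e \<phi> i p $ b * \<eta> e p $ d)"

text \<open>The matrix in the chart \<open>ch\<close> of the shape operator \<open>A(X) = - (\<nabla>\<^sub>X \<eta>)\<^sup>\<top>\<close>, i.e. of the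
  endomorphism with \<open>g(A(X), Y) = - h(\<nabla>\<^sub>X \<eta>, d\<phi>(Y))\<close>. It acts on columns of components, and
  does not depend on the chart of the target around \<open>\<phi> p\<close>.\<close>

definition shape_operator ::
  "('b, 'n::finite) chart set \<Rightarrow> ('a, 'm::finite) metric \<Rightarrow> ('b, 'n) metric \<Rightarrow> ('a \<Rightarrow> 'b) \<Rightarrow>
   (('b, 'n) chart \<Rightarrow> 'a \<Rightarrow> real^'n) \<Rightarrow> ('a, 'm) chart \<Rightarrow> 'a \<Rightarrow> real^'m^'m" where
  "shape_operator B g h \<phi> \<eta> ch p = (let e = chart_at B (\<phi> p) in
     matrix_inv (g ch p) **
       (\<chi> j i. - ginner (h e (\<phi> p)) (cov_deriv_along h \<phi> ch e \<eta> i p) (push ch e \<phi> j p)))"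

text \<open>The trace of the shape operator, without the factor \<open>1/2\<close>.\<close>

definition mean_curvature ::
  "('a, 'm::finite) chart set \<Rightarrow> ('b, 'n::finite) chart set \<Rightarrow> ('a, 'm) metric \<Rightarrow> ('b, 'n) metric \<Rightarrow>
   ('a \<Rightarrow> 'b) \<Rightarrow> (('b, 'n) chart \<Rightarrow> 'a \<Rightarrow> real^'n) \<Rightarrow> 'a \<Rightarrow> real" where
  "mean_curvature A B g h \<phi> \<eta> p = trace (shape_operator B g h \<phi> \<eta> (chart_at A p) p)"

text \<open>A surface in \<open>N\<^sup>3(c)\<close> is biconservative, i.e. the bitension field of its immersion has
  vanishing tangent part, if and only if \<open>A(\<nabla>f) = - (f/2) \<nabla>f\<close>. This is used as the definition.\<close>

definition biconservative ::
  "'a set \<Rightarrow> ('a, 2) chart set \<Rightarrow> ('b, 3) chart set \<Rightarrow> ('a, 2) metric \<Rightarrow> ('b, 3) metric \<Rightarrow>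
   ('a \<Rightarrow> 'b) \<Rightarrow> (('b, 3) chart \<Rightarrow> 'a \<Rightarrow> real^3) \<Rightarrow> bool" where
  "biconservative S A B g h \<phi> \<eta> \<longleftrightarrow> (let f = mean_curvature A B g h \<phi> \<eta> in
     \<forall>ch\<in>A. \<forall>p\<in>fst ch \<inter> S.
       shape_operator B g h \<phi> \<eta> ch p *v gradient g f ch p = - (f p / 2) *\<^sub>R gradient g f ch p)"

end

theory Submission
  imports Defs
begin

text \<open>
  Let \<open>n = df / |df|\<close> and let \<open>t\<close> be the rotated coframe element, so that the metric is \<open>n\<^sup>2 + t\<^sup>2\<close>. The shape
  operator is diagonal in the dual frame with eigenvalues \<open>- f/2\<close> and \<open>3f/2\<close>, and the Codazzi equations become
  \<open>dn = 0\<close> and \<open>f dt = - (3/4) df \<and> t\<close>. Hence \<open>\<omega> = f\<^bsup>3/4\<^esup> n\<close> and \<open>\<sigma> = f\<^bsup>3/4\<^esup> t\<close> are closed: the metric \<open>f\<^bsup>3/2\<^esup> g\<close> is flat, and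
  a local primitive \<open>\<xi>\<close> of \<open>\<omega>\<close> is harmonic with \<open>|\<nabla>\<xi>|\<^sup>2 = f\<^bsup>3/2\<^esup>\<close>. The Gauss equation reads
  \<open>\<Delta> (3/4 ln f) = - (c - 3f\<^sup>2/4)\<close>, and flatness of \<open>f\<^bsup>3/2\<^esup> g\<close> identifies the right-hand side as \<open>- K\<close>.

  If \<open>m\<close> solves \<open>m'' = e\<^bsup>-2m\<^esup> - c e\<^bsup>2m\<^esup>\<close>, then \<open>e\<^bsup>2m(\<xi>)\<^esup> f\<^bsup>3/2\<^esup> g\<close> has curvature \<open>K\<^sub>r = c - e\<^bsup>-4m(\<xi>)\<^esup>\<close>, so that multiplying it
  by \<open>(c - K\<^sub>r)\<^bsup>1/2\<^esup> = e\<^bsup>-2m(\<xi>)\<^esup>\<close> gives back the flat metric. The exponent \<open>r\<close> is determined by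
  \<open>(c - K)\<^sup>r = e\<^bsup>2m(\<xi>)\<^esup> f\<^bsup>3/2\<^esup>\<close>, which is possible where \<open>c - K = 3f\<^sup>2/4\<close> is different from \<open>1\<close>; this set is dense because
  \<open>\<nabla>f\<close> has no zeros.
\<close>


section \<open>Smooth functions on open sets\<close>

text \<open>The power 3/4 is an integrating factor: f dt = -(3/4) df \<and> t says that f^(3/4) t is
  closed, and f^(3/4) n stays closed because df is parallel to n. For a metric e^(2m) f^(3/2) g the
  Ricci condition holds as soon as c - K_r = e^(-4m), a semilinear equation for m in the flat
  Laplacian. Since \<xi> is an affine coordinate of the flat metric, the ansatz m = m(\<xi>) turns
  it into the ordinary equation of the overview, which can be solved near 0 for every real c. The
  primitive and the solution are both local, which is why the neighbourhoods are small coordinate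
  balls. The equation for r then follows by cancellation: in 1/4 ln(c - K_r) + r/2 ln(c - K) the
  terms -m and +m drop out and 3/4 ln f is left, whose Laplacian is already known. The other half of
  the work is invariance. The shape operator and the mean curvature are read off in charts picked by
  choice, possibly different ones at neighbouring points, so f is not smooth by definition; whatever
  is computed in one pair of charts has to be shown independent of that pair.\<close>

lemma has_derivative_frechet_eq:
  assumes "(F has_derivative F') (at u)"
  shows "frechet_derivative F (at u) v = F' v"
  using frechet_derivative_at[OF assms] by simp

lemma differentiable_has_derivative:
  "F differentiable (at u) \<Longrightarrow> (F has_derivative frechet_derivative F (at u)) (at u)"
  using frechet_derivative_works by blast

text \<open>\<open>frechet_derivative\<close> is a choice from the predicate
  \<open>has_derivative\<close>, and the two predicates agree at \<open>u\<close>; so equality holds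
  even where the functions are not differentiable.\<close>

lemma frechet_derivative_cong_open:
  assumes "open X" "u \<in> X" "\<And>w. w \<in> X \<Longrightarrow> F w = G w"
  shows "frechet_derivative F (at u) = frechet_derivative G (at u)"
proof -
  have "(F has_derivative F') (at u) \<longleftrightarrow> (G has_derivative F') (at u)" for F'
    using assms has_derivative_transform_within_open[of F F' u UNIV X G]
      has_derivative_transform_within_open[of G F' u UNIV X F] by auto
  then show ?thesis unfolding frechet_derivative_def by simp
qed

lemma differentiable_cong_open:
  assumes "open X" "u \<in> X" "\<And>w. w \<in> X \<Longrightarrow> F w = G w" "F differentiable (at u)"
  shows "G differentiable (at u)"
  using assms has_derivative_transform_within_open[of F _ u UNIV X G] unfolding differentiable_def by blast

lemma Ck_on_cong:
  assumes "open X" "\<And>u. u \<in> X \<Longrightarrow> F u = G u" "Ck_on k X F"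
  shows "Ck_on k X G"
  using assms(2,3)
proof (induction k arbitrary: F G)
  case 0
  then show ?case using continuous_on_cong by force
next
  case (Suc k)
  have "G differentiable (at u)" if "u \<in> X" for u
    using Suc.prems that differentiable_cong_open[OF assms(1) that, of F G] by auto
  moreover have "Ck_on k X (\<lambda>u. frechet_derivative G (at u) v)" for v
    using Suc.prems Suc.IH[of "\<lambda>u. frechet_derivative F (at u) v" "\<lambda>u. frechet_derivative G (at u) v"]
      frechet_derivative_cong_open[OF assms(1), of _ F G] by auto
  ultimately show ?case by simp
qed

lemma Ck_on_subset: "Ck_on k X F \<Longrightarrow> Y \<subseteq> X \<Longrightarrow> Ck_on k Y F"
proof (induction k arbitrary: F)
  case 0
  then show ?case by (auto intro: continuous_on_subset)
qed auto

text \<open>The successor case of \<open>Ck_on\<close> speaks of the derivatives and does not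
  contain the lower level; at the bottom it is the continuity of differentiable functions.\<close>

lemma Ck_on_SucD: "Ck_on (Suc k) X F \<Longrightarrow> Ck_on k X F"
proof (induction k arbitrary: F)
  case 0
  then show ?case
    by (auto intro!: continuous_at_imp_continuous_on differentiable_imp_continuous_within)
qed auto

text \<open>The closure properties go through this rule: a derivative is exhibited in closed form,
  and in each fixed direction it has to be regular to one order less.\<close>

lemma Ck_on_SucI:
  assumes "open X" "\<And>u. u \<in> X \<Longrightarrow> (F has_derivative F' u) (at u)" "\<And>v. Ck_on k X (\<lambda>u. F' u v)"
  shows "Ck_on (Suc k) X F"
proof -
  have "Ck_on k X (\<lambda>u. frechet_derivative F (at u) v)" for v
    using has_derivative_frechet_eq[OF assms(2)] by (intro Ck_on_cong[OF assms(1) _ assms(3)]) simp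
  then show ?thesis using assms(2) by (auto simp: differentiable_def)
qed

lemma Ck_on_const: "Ck_on k X (\<lambda>u. a)"
proof (induction k arbitrary: a)
  case (Suc k)
  have "frechet_derivative (\<lambda>u. a) (at u) v = 0" for u v :: 'a
    by (rule has_derivative_frechet_eq[OF has_derivative_const])
  then show ?case using Suc by auto
qed (simp)

lemma Ck_on_bounded_linear:
  assumes "bounded_linear L" "open X" "Ck_on k X F"
  shows "Ck_on k X (\<lambda>u. L (F u))"
  using assms(3)
proof (induction k arbitrary: F)
  case 0
  then show ?case using bounded_linear.continuous_on[OF assms(1)] by auto
next
  case (Suc k)
  show ?case
  proof (rule Ck_on_SucI[OF assms(2)])
    show "((\<lambda>u. L (F u)) has_derivative (\<lambda>v. L (frechet_derivative F (at u) v))) (at u)" if "u \<in> X" for u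
      using Suc.prems that by (auto intro!: bounded_linear.has_derivative[OF assms(1)] differentiable_has_derivative)
  qed (use Suc in auto)
qed

lemma Ck_on_add:
  assumes "open X" "Ck_on k X F" "Ck_on k X G"
  shows "Ck_on k X (\<lambda>u. F u + G u)"
  using assms(2,3)
proof (induction k arbitrary: F G)
  case 0
  then show ?case by (auto intro: continuous_intros)
next
  case (Suc k)
  show ?case
  proof (rule Ck_on_SucI[OF assms(1)])
    show "((\<lambda>u. F u + G u) has_derivative
      (\<lambda>v. frechet_derivative F (at u) v + frechet_derivative G (at u) v)) (at u)" if "u \<in> X" for u
      using Suc.prems that by (auto intro!: has_derivative_add differentiable_has_derivative)
  qed (use Suc in auto)
qed

text \<open>One induction for all products, scalar and vector valued. The product rule contains
  \<open>F\<close> and \<open>G\<close> undifferentiated, hence the descent by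
  \<open>Ck_on_SucD\<close>.\<close>

lemma Ck_on_bilinear:
  assumes "bounded_bilinear B" "open X" "Ck_on k X F" "Ck_on k X G"
  shows "Ck_on k X (\<lambda>u. B (F u) (G u))"
  using assms(3,4)
proof (induction k arbitrary: F G)
  case 0
  then show ?case using bounded_bilinear.continuous_on[OF assms(1)] by auto
next
  case (Suc k)
  show ?case
  proof (rule Ck_on_SucI[OF assms(2)])
    show "((\<lambda>u. B (F u) (G u)) has_derivative
      (\<lambda>v. B (F u) (frechet_derivative G (at u) v) + B (frechet_derivative F (at u) v) (G u))) (at u)"
      if "u \<in> X" for u
      using Suc.prems that by (auto intro!: bounded_bilinear.FDERIV[OF assms(1)] differentiable_has_derivative)
  qed (use Suc Ck_on_SucD[OF Suc.prems(1)] Ck_on_SucD[OF Suc.prems(2)] in \<open>auto intro!: Ck_on_add assms(2)\<close>)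
qed

lemma Ck_on_sum:
  assumes "open X" "\<And>i. i \<in> I \<Longrightarrow> Ck_on k X (F i)"
  shows "Ck_on k X (\<lambda>u. \<Sum>i\<in>I. F i u)"
  using assms(2) 
  by (induction I rule: infinite_finite_induct) (auto intro: Ck_on_const Ck_on_add[OF assms(1)])

text \<open>In the chain rule the derivative of \<open>G\<close> is applied to a direction that
  varies with \<open>u\<close>, whereas \<open>Ck_on\<close> controls fixed directions only.
  Expanding that direction in a basis separates the two; for this the values of \<open>F\<close> lie
  in a Euclidean space.\<close>

lemma Ck_on_compose:
  fixes F :: "'a::real_normed_vector \<Rightarrow> 'b::euclidean_space"
  assumes "open X" "open Y" "Ck_on k X F" "Ck_on k Y G" "F ` X \<subseteq> Y"
  shows "Ck_on k X (\<lambda>u. G (F u))"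
  using assms(3,4)
proof (induction k arbitrary: G)
  case 0
  then show ?case using continuous_on_compose2[OF _ _ assms(5), of G] by simp
next
  case (Suc k)
  have *: "(G has_derivative frechet_derivative G (at (F u))) (at (F u))" if "u \<in> X" for u
    by (rule differentiable_has_derivative) (use Suc.prems that assms(5) in auto)
  show ?case
  proof (rule Ck_on_SucI[OF assms(1)])
    fix u assume u: "u \<in> X"
    interpret D: linear "frechet_derivative G (at (F u))"
      by (rule has_derivative_linear[OF *[OF u]])
    have "((\<lambda>u. G (F u)) has_derivative
      (\<lambda>v. frechet_derivative G (at (F u)) (frechet_derivative F (at u) v))) (at u)"
      by (rule has_derivative_compose[of F _ u UNIV G, OF differentiable_has_derivative *[OF u]])
        (use Suc.prems u in auto)
    moreover have rep: "frechet_derivative G (at (F u)) w =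
      (\<Sum>b\<in>Basis. (w \<bullet> b) *\<^sub>R frechet_derivative G (at (F u)) b)" for w
      by (subst (1) euclidean_representation[of w, symmetric]) (simp only: D.sum D.scaleR)
    ultimately show "((\<lambda>u. G (F u)) has_derivative
      (\<lambda>v. (\<Sum>b\<in>Basis. (frechet_derivative F (at u) v \<bullet> b) *\<^sub>R frechet_derivative G (at (F u)) b))) (at u)"
      by (subst rep[symmetric])
  next
    fix v
    show "Ck_on k X (\<lambda>u. (\<Sum>b\<in>Basis. (frechet_derivative F (at u) v \<bullet> b) *\<^sub>R frechet_derivative G (at (F u)) b))"
      by (intro Ck_on_sum Ck_on_bilinear[OF bounded_bilinear_scaleR] assms(1)
        Ck_on_bounded_linear[OF bounded_linear_inner_left] Suc.IH Ck_on_SucD[OF Suc.prems(1)])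
        (use Suc.prems in auto)
  qed
qed

lemma smooth_onI:
  assumes "open X" "\<And>u. u \<in> X \<Longrightarrow> (F has_derivative F' u) (at u)" "\<And>v. smooth_on X (\<lambda>u. F' u v)"
  shows "smooth_on X F"
proof -
  have "Ck_on k X F" for k
    by (rule Ck_on_SucD, rule Ck_on_SucI[of _ _ F']) (use assms in \<open>auto simp: smooth_on_def\<close>)
  then show ?thesis unfolding smooth_on_def by simp
qed

lemma smooth_on_cong: "open X \<Longrightarrow> (\<And>u. u \<in> X \<Longrightarrow> F u = G u) \<Longrightarrow> smooth_on X F \<Longrightarrow> smooth_on X G"
  unfolding smooth_on_def using Ck_on_cong by blast

lemma smooth_on_subset: "smooth_on X F \<Longrightarrow> Y \<subseteq> X \<Longrightarrow> smooth_on Y F"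
  unfolding smooth_on_def using Ck_on_subset by blast

lemma smooth_on_differentiable: "smooth_on X F \<Longrightarrow> u \<in> X \<Longrightarrow> F differentiable (at u)"
  unfolding smooth_on_def using Ck_on.simps(2) by blast

lemma smooth_on_has_derivative:
  "smooth_on X F \<Longrightarrow> u \<in> X \<Longrightarrow> (F has_derivative frechet_derivative F (at u)) (at u)"
  using smooth_on_differentiable differentiable_has_derivative by blast

lemma smooth_on_continuous: "smooth_on X F \<Longrightarrow> continuous_on X F"
  unfolding smooth_on_def using Ck_on.simps(1) by blast

lemma smooth_on_frechet: "smooth_on X F \<Longrightarrow> smooth_on X (\<lambda>u. frechet_derivative F (at u) v)"
  unfolding smooth_on_def using Ck_on.simps(2) by blast

text \<open>Serves to pass from patches to a whole chart: the mean curvature is first known to be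
  smooth only where a single ambient chart can be used.\<close>

lemma smooth_on_locally:
  assumes "\<And>u. u \<in> X \<Longrightarrow> \<exists>Y. open Y \<and> u \<in> Y \<and> smooth_on Y F"
  shows "smooth_on X F"
proof -
  have "Ck_on k X F" if "\<And>u. u \<in> X \<Longrightarrow> \<exists>Y. open Y \<and> u \<in> Y \<and> Ck_on k Y F" for k
    using that
  proof (induction k arbitrary: F)
    case 0
    then show ?case
      by (metis Ck_on.simps(1) continuous_at_imp_continuous_on continuous_on_eq_continuous_at)
  next
    case (Suc k)
    have "F differentiable at u" if "u \<in> X" for u using Suc.prems[OF that] by auto
    moreover have "Ck_on k X (\<lambda>u. frechet_derivative F (at u) v)" for v
      by (rule Suc.IH) (use Suc.prems in fastforce)
    ultimately show ?case by simp
  qed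
  then show ?thesis using assms unfolding smooth_on_def by blast
qed

lemma smooth_on_const: "smooth_on X (\<lambda>u. a)"
  unfolding smooth_on_def using Ck_on_const by blast

lemma smooth_on_id: "open X \<Longrightarrow> smooth_on X (\<lambda>u. u)"
  by (rule smooth_onI[of _ _ "\<lambda>u v. v"]) (auto intro: smooth_on_const)

lemma smooth_on_bounded_linear:
  "bounded_linear L \<Longrightarrow> open X \<Longrightarrow> smooth_on X F \<Longrightarrow> smooth_on X (\<lambda>u. L (F u))"
  unfolding smooth_on_def using Ck_on_bounded_linear by blast

lemma smooth_on_bilinear:
  "bounded_bilinear B \<Longrightarrow> open X \<Longrightarrow> smooth_on X F \<Longrightarrow> smooth_on X G \<Longrightarrow> smooth_on X (\<lambda>u. B (F u) (G u))"
  unfolding smooth_on_def using Ck_on_bilinear by blast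

lemma smooth_on_add: "open X \<Longrightarrow> smooth_on X F \<Longrightarrow> smooth_on X G \<Longrightarrow> smooth_on X (\<lambda>u. F u + G u)"
  unfolding smooth_on_def using Ck_on_add by blast

lemma smooth_on_minus: "open X \<Longrightarrow> smooth_on X F \<Longrightarrow> smooth_on X (\<lambda>u. - F u)"
  by (rule smooth_on_bounded_linear[OF bounded_linear_minus[OF bounded_linear_ident]])

lemma smooth_on_diff: "open X \<Longrightarrow> smooth_on X F \<Longrightarrow> smooth_on X G \<Longrightarrow> smooth_on X (\<lambda>u. F u - G u)"
  using smooth_on_add[of X F "\<lambda>u. - G u"] smooth_on_minus[of X G] by simp

lemma smooth_on_mult:
  fixes F G :: "'a::real_normed_vector \<Rightarrow> real"
  shows "open X \<Longrightarrow> smooth_on X F \<Longrightarrow> smooth_on X G \<Longrightarrow> smooth_on X (\<lambda>u. F u * G u)"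
  by (rule smooth_on_bilinear[OF bounded_bilinear_mult])

lemma smooth_on_scaleR:
  "open X \<Longrightarrow> smooth_on X F \<Longrightarrow> smooth_on X G \<Longrightarrow> smooth_on X (\<lambda>u. F u *\<^sub>R G u)"
  by (rule smooth_on_bilinear[OF bounded_bilinear_scaleR])

lemma smooth_on_sum:
  "open X \<Longrightarrow> (\<And>i. i \<in> I \<Longrightarrow> smooth_on X (F i)) \<Longrightarrow> smooth_on X (\<lambda>u. \<Sum>i\<in>I. F i u)"
  unfolding smooth_on_def by (auto intro: Ck_on_sum)

lemma smooth_on_compose:
  fixes F :: "'a::real_normed_vector \<Rightarrow> 'b::euclidean_space"
  assumes "open X" "open Y" "smooth_on X F" "smooth_on Y G" "F ` X \<subseteq> Y"
  shows "smooth_on X (\<lambda>u. G (F u))"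
proof -
  have "Ck_on k X (\<lambda>u. G (F u))" for k
    by (rule Ck_on_compose[OF assms(1,2) _ _ assms(5), where G = G])
      (use assms(3,4) in \<open>auto simp: smooth_on_def\<close>)
  then show ?thesis unfolding smooth_on_def by simp
qed

lemma smooth_on_vec_nth: "open X \<Longrightarrow> smooth_on X F \<Longrightarrow> smooth_on X (\<lambda>u. F u $ i)"
  by (rule smooth_on_bounded_linear[OF bounded_linear_vec_nth])

lemma smooth_on_vec_lambda:
  fixes F :: "'n::finite \<Rightarrow> 'a::real_normed_vector \<Rightarrow> 'b::real_normed_vector"
  assumes "open X" "\<And>i. smooth_on X (F i)"
  shows "smooth_on X (\<lambda>u. \<chi> i. F i u)"
proof -
  have "bounded_linear (\<lambda>x::'b. axis i x :: 'b^'n)" for i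
    by (rule bounded_linear_intro[of _ 1])
      (auto simp: axis_def vec_eq_iff norm_vec_def L2_set_def if_distrib[of norm] if_distrib[of "\<lambda>x. x^2"] cong: if_cong)
  then have "smooth_on X (\<lambda>u. \<Sum>i\<in>UNIV. axis i (F i u) :: 'b^'n)"
    using assms smooth_on_bounded_linear by (intro smooth_on_sum) blast+
  moreover have "(\<Sum>i\<in>UNIV. axis i (F i u) :: 'b^'n) = (\<chi> i. F i u)" for u
    by (simp add: vec_eq_iff axis_def if_distrib cong: if_cong)
  ultimately show ?thesis by simp
qed

lemma smooth_on_vec_iff:
  fixes F :: "'a::real_normed_vector \<Rightarrow> 'b::real_normed_vector^'n::finite"
  assumes "open X"
  shows "smooth_on X F \<longleftrightarrow> (\<forall>i. smooth_on X (\<lambda>u. F u $ i))"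
  using smooth_on_vec_nth[OF assms, of F] smooth_on_vec_lambda[OF assms, of "\<lambda>i u. F u $ i"]
  by (auto simp: vec_nth_inverse)

text \<open>When the derivative is an expression in the function itself, as for \<open>exp\<close>,
  \<open>inverse\<close> or the solution of an autonomous equation, this rule and induction on
  \<open>k\<close> give smoothness.\<close>

lemma Ck_on_real:
  assumes "open Y" "\<And>y. y \<in> Y \<Longrightarrow> (G has_real_derivative G' y) (at y)" "Ck_on k Y G'"
  shows "Ck_on (Suc k) Y G"
proof (rule Ck_on_SucI[OF assms(1), of _ "\<lambda>y v. G' y * v"])
  show "(G has_derivative (*) (G' y)) (at y)" if "y \<in> Y" for y
    using assms(2)[OF that] by (simp add: has_field_derivative_def)
  show "Ck_on k Y (\<lambda>y. G' y * v)" for v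
    by (intro Ck_on_bounded_linear[OF bounded_linear_mult_left] assms)
qed

lemma smooth_on_exp_real: "smooth_on UNIV (exp :: real \<Rightarrow> real)"
proof -
  have "Ck_on k UNIV (exp :: real \<Rightarrow> real)" for k
  proof (induction k)
    case 0 show ?case by (auto intro: continuous_intros)
  next
    case (Suc k) then show ?case by (intro Ck_on_real[OF open_UNIV DERIV_exp])
  qed
  then show ?thesis unfolding smooth_on_def by simp
qed

lemma smooth_on_inverse_real: "smooth_on {0<..} (inverse :: real \<Rightarrow> real)"
proof -
  have "Ck_on k {0<..} (inverse :: real \<Rightarrow> real)" for k
  proof (induction k)
    case 0 show ?case by (auto intro!: continuous_intros)
  next
    case (Suc k)
    have "Ck_on k {0<..} (\<lambda>y::real. - (inverse y * inverse y))"
      by (intro Ck_on_bounded_linear[OF bounded_linear_minus[OF bounded_linear_ident]]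
        Ck_on_bilinear[OF bounded_bilinear_mult] Suc) auto
    then show ?case
      by (intro Ck_on_real) (auto intro!: derivative_eq_intros)
  qed
  then show ?thesis unfolding smooth_on_def by simp
qed

lemma smooth_on_real:
  assumes "open Y" "\<And>y. y \<in> Y \<Longrightarrow> (G has_real_derivative G' y) (at y)" "smooth_on Y G'"
  shows "smooth_on Y G"
  using assms(3) Ck_on_SucD[OF Ck_on_real[OF assms(1,2)]] unfolding smooth_on_def by blast

lemma smooth_on_ln_real: "smooth_on {0<..} (ln :: real \<Rightarrow> real)"
  by (rule smooth_on_real[OF _ _ smooth_on_inverse_real])
    (auto intro!: derivative_eq_intros simp: divide_inverse)

lemma smooth_on_exp:
  fixes F :: "'a::real_normed_vector \<Rightarrow> real"
  shows "open X \<Longrightarrow> smooth_on X F \<Longrightarrow> smooth_on X (\<lambda>u. exp (F u))"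
  by (rule smooth_on_compose[OF _ open_UNIV _ smooth_on_exp_real]) auto

lemma smooth_on_inverse_pos:
  fixes F :: "'a::real_normed_vector \<Rightarrow> real"
  shows "open X \<Longrightarrow> smooth_on X F \<Longrightarrow> (\<And>u. u \<in> X \<Longrightarrow> F u > 0) \<Longrightarrow> smooth_on X (\<lambda>u. inverse (F u))"
  by (rule smooth_on_compose[OF _ _ _ smooth_on_inverse_real]) auto

text \<open>Writing 1/F as F times the inverse of F F leaves a positive denominator, so the sign of
  \<open>F\<close> is free.\<close>

lemma smooth_on_inverse:
  fixes F :: "'a::real_normed_vector \<Rightarrow> real"
  assumes "open X" "smooth_on X F" "\<And>u. u \<in> X \<Longrightarrow> F u \<noteq> 0"
  shows "smooth_on X (\<lambda>u. inverse (F u))"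
proof -
  have "smooth_on X (\<lambda>u. F u * inverse (F u * F u))"
    using assms by (intro smooth_on_mult smooth_on_inverse_pos) (auto simp: zero_less_mult_iff not_less less_le)
  then show ?thesis by (rule smooth_on_cong[OF assms(1), rotated]) (use assms(3) in auto)
qed

lemma smooth_on_divide:
  fixes F G :: "'a::real_normed_vector \<Rightarrow> real"
  shows "open X \<Longrightarrow> smooth_on X F \<Longrightarrow> smooth_on X G \<Longrightarrow> (\<And>u. u \<in> X \<Longrightarrow> G u \<noteq> 0) \<Longrightarrow> smooth_on X (\<lambda>u. F u / G u)"
  unfolding divide_inverse by (intro smooth_on_mult smooth_on_inverse) auto

lemma smooth_on_ln:
  fixes F :: "'a::real_normed_vector \<Rightarrow> real"
  shows "open X \<Longrightarrow> smooth_on X F \<Longrightarrow> (\<And>u. u \<in> X \<Longrightarrow> F u > 0) \<Longrightarrow> smooth_on X (\<lambda>u. ln (F u))"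
  by (rule smooth_on_compose[OF _ _ _ smooth_on_ln_real]) auto

lemma smooth_on_powr:
  fixes F G :: "'a::real_normed_vector \<Rightarrow> real"
  assumes "open X" "smooth_on X F" "smooth_on X G" "\<And>u. u \<in> X \<Longrightarrow> F u > 0"
  shows "smooth_on X (\<lambda>u. F u powr G u)"
proof -
  have "smooth_on X (\<lambda>u. exp (G u * ln (F u)))"
    using assms by (intro smooth_on_exp smooth_on_mult smooth_on_ln) auto
  then show ?thesis by (rule smooth_on_cong[OF assms(1), rotated]) (use assms(4) in \<open>force simp: powr_def\<close>)
qed

lemma smooth_on_sqrt:
  fixes F :: "'a::real_normed_vector \<Rightarrow> real"
  assumes "open X" "smooth_on X F" "\<And>u. u \<in> X \<Longrightarrow> F u > 0"
  shows "smooth_on X (\<lambda>u. sqrt (F u))"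
proof -
  have "smooth_on X (\<lambda>u. F u powr (1/2))"
    using assms by (intro smooth_on_powr smooth_on_const) auto
  then show ?thesis by (rule smooth_on_cong[OF assms(1), rotated]) (use assms(3) in \<open>force simp: powr_half_sqrt\<close>)
qed

lemma smooth_on_pd: "smooth_on X F \<Longrightarrow> smooth_on X (pd i F)"
  unfolding pd_def using smooth_on_frechet by blast

text \<open>The mean value theorem is used twice: in direction \<open>v\<close> on the increment of
  \<open>F\<close> along \<open>w\<close>, and then in direction \<open>w\<close> on the derivative
  of \<open>F\<close> along \<open>v\<close>.\<close>

lemma second_difference_mvt:
  fixes F :: "'a::real_normed_vector \<Rightarrow> real"
  assumes X: "open X" and F: "smooth_on X F" and h: "h > 0"
    and sub: "\<And>s t. 0 \<le> s \<Longrightarrow> s \<le> h \<Longrightarrow> 0 \<le> t \<Longrightarrow> t \<le> h \<Longrightarrow> u + s *\<^sub>R v + t *\<^sub>R w \<in> X"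
  shows "\<exists>s t. 0 < s \<and> s < h \<and> 0 < t \<and> t < h \<and>
    F (u + h *\<^sub>R v + h *\<^sub>R w) - F (u + h *\<^sub>R v) - F (u + h *\<^sub>R w) + F u =
    h * h * frechet_derivative (\<lambda>x. frechet_derivative F (at x) v) (at (u + s *\<^sub>R v + t *\<^sub>R w)) w"
proof -
  have line: "((\<lambda>s. G (p + s *\<^sub>R q)) has_real_derivative frechet_derivative G (at (p + s *\<^sub>R q)) q) (at s)"
    if "smooth_on X G" "p + s *\<^sub>R q \<in> X" for G :: "'a \<Rightarrow> real" and p q s
  proof -
    have G: "(G has_derivative frechet_derivative G (at (p + s *\<^sub>R q))) (at (p + s *\<^sub>R q))"
      using smooth_on_has_derivative that by blast
    have "((\<lambda>s. G (p + s *\<^sub>R q)) has_derivative (\<lambda>x. frechet_derivative G (at (p + s *\<^sub>R q)) (x *\<^sub>R q))) (at s)"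
      by (rule has_derivative_compose[of "\<lambda>s. p + s *\<^sub>R q" "\<lambda>x. x *\<^sub>R q" s UNIV G, OF _ G])
        (auto intro!: derivative_eq_intros)
    moreover have "(\<lambda>x. frechet_derivative G (at (p + s *\<^sub>R q)) (x *\<^sub>R q)) =
        (*) (frechet_derivative G (at (p + s *\<^sub>R q)) q)"
      by (rule ext) (simp add: linear.scaleR[OF has_derivative_linear[OF G]] mult.commute)
    ultimately show ?thesis
      by (simp add: has_field_derivative_def)
  qed
  let ?D = "\<lambda>x. frechet_derivative F (at x) v"
  have D: "smooth_on X ?D" using F smooth_on_frechet by blast
  have "\<exists>s. 0 < s \<and> s < h \<and> (F ((u + h *\<^sub>R w) + h *\<^sub>R v) - F (u + h *\<^sub>R v))
      - (F ((u + h *\<^sub>R w) + 0 *\<^sub>R v) - F (u + 0 *\<^sub>R v)) = (h - 0) * (?D ((u + h *\<^sub>R w) + s *\<^sub>R v) - ?D (u + s *\<^sub>R v))"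
  proof (rule MVT2[OF h])
    fix s assume "0 \<le> s" "s \<le> h"
    then show "((\<lambda>s. F ((u + h *\<^sub>R w) + s *\<^sub>R v) - F (u + s *\<^sub>R v)) has_real_derivative
        (?D ((u + h *\<^sub>R w) + s *\<^sub>R v) - ?D (u + s *\<^sub>R v))) (at s)"
      using sub[of s h] sub[of s 0] h
      by (intro DERIV_diff line F) (simp_all add: add.commute add.left_commute)
  qed
  then obtain s where s: "0 < s" "s < h" "F (u + h *\<^sub>R v + h *\<^sub>R w) - F (u + h *\<^sub>R v) - F (u + h *\<^sub>R w) + F u
    = h * (?D (u + s *\<^sub>R v + h *\<^sub>R w) - ?D (u + s *\<^sub>R v))"
    by (auto simp: add.commute add.left_commute diff_diff_eq add_diff_eq diff_add_eq)
  have "\<exists>t. 0 < t \<and> t < h \<and> ?D ((u + s *\<^sub>R v) + h *\<^sub>R w) - ?D ((u + s *\<^sub>R v) + 0 *\<^sub>R w)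
    = (h - 0) * frechet_derivative ?D (at ((u + s *\<^sub>R v) + t *\<^sub>R w)) w"
    by (rule MVT2[OF h], rule line[OF D]) (use s sub in auto)
  then show ?thesis using s by auto
qed

text \<open>The second difference over a parallelogram is symmetric in its sides \<open>v\<close>
  and \<open>w\<close>, and it is \<open>h * h\<close> times a nearby value of either mixed
  derivative. By continuity the two cannot differ at \<open>u\<close>.\<close>

lemma frechet_derivative_symmetric:
  fixes F :: "'a::real_normed_vector \<Rightarrow> real"
  assumes X: "open X" and F: "smooth_on X F" and u: "u \<in> X"
  shows "frechet_derivative (\<lambda>x. frechet_derivative F (at x) v) (at u) w =
    frechet_derivative (\<lambda>x. frechet_derivative F (at x) w) (at u) v" (is "?P u = ?Q u")
proof (rule ccontr)
  assume ne: "?P u \<noteq> ?Q u"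
  \<comment> \<open>Half the gap: two errors below \<open>e\<close> cannot close it.\<close>
  define e where "e = dist (?P u) (?Q u) / 2"
  have e: "e > 0" using ne by (simp add: e_def)
  have P: "continuous_on X ?P" "continuous_on X ?Q"
    using F by (auto intro!: smooth_on_continuous smooth_on_frechet)
  have "\<exists>d>0. \<forall>x. dist x u < d \<longrightarrow> x \<in> X \<and> dist (?P x) (?P u) < e \<and> dist (?Q x) (?Q u) < e"
  proof -
    obtain d0 where "d0 > 0" "\<And>x. dist x u < d0 \<Longrightarrow> x \<in> X" using X u openE by (metis dist_commute mem_ball subsetD)
    moreover obtain d1 where "d1 > 0" "\<And>x. x \<in> X \<Longrightarrow> dist x u < d1 \<Longrightarrow> dist (?P x) (?P u) < e"
      using P(1) u e unfolding continuous_on_iff by metis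
    moreover obtain d2 where "d2 > 0" "\<And>x. x \<in> X \<Longrightarrow> dist x u < d2 \<Longrightarrow> dist (?Q x) (?Q u) < e"
      using P(2) u e unfolding continuous_on_iff by metis
    ultimately show ?thesis by (intro exI[of _ "min d0 (min d1 d2)"]) auto
  qed
  then obtain d where d: "d > 0" "\<And>x. dist x u < d \<Longrightarrow> x \<in> X \<and> dist (?P x) (?P u) < e \<and> dist (?Q x) (?Q u) < e"
    by blast
  \<comment> \<open>Keeps the whole parallelogram in the ball of radius \<open>d\<close>; the
    summand 1 makes the denominator positive also for v = w = 0.\<close>
  define h where "h = d / (2 * (norm v + norm w + 1))"
  have h: "h > 0" unfolding h_def using d(1) by (auto intro!: divide_pos_pos add_nonneg_pos)
  have hb: "h * (norm v + norm w) < d"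
  proof -
    have "norm v + norm w + 1 > 0" by (auto intro!: add_nonneg_pos)
    then have "h * (norm v + norm w + 1) = d / 2" unfolding h_def by (simp add: field_simps)
    then show ?thesis using d(1) h by (simp add: algebra_simps)
  qed
  have near: "dist (u + s *\<^sub>R v + t *\<^sub>R w) u < d" if "0 \<le> s" "s \<le> h" "0 \<le> t" "t \<le> h" for s t
  proof -
    have "norm (s *\<^sub>R v + t *\<^sub>R w) \<le> h * norm v + h * norm w"
      using that by (intro order_trans[OF norm_triangle_ineq] add_mono) (auto intro!: mult_right_mono)
    then show ?thesis using hb by (simp add: dist_norm algebra_simps)
  qed
  have near': "dist (u + s *\<^sub>R w + t *\<^sub>R v) u < d" if "0 \<le> s" "s \<le> h" "0 \<le> t" "t \<le> h" for s t
    using near[OF that(3,4,1,2)] by (simp add: add.commute add.left_commute)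
  obtain s t where st: "0 < s" "s < h" "0 < t" "t < h"
    "F (u + h *\<^sub>R v + h *\<^sub>R w) - F (u + h *\<^sub>R v) - F (u + h *\<^sub>R w) + F u = h * h * ?P (u + s *\<^sub>R v + t *\<^sub>R w)"
    using second_difference_mvt[OF X F h, of u v w] d(2) near by blast
  obtain s' t' where st': "0 < s'" "s' < h" "0 < t'" "t' < h"
    "F (u + h *\<^sub>R w + h *\<^sub>R v) - F (u + h *\<^sub>R w) - F (u + h *\<^sub>R v) + F u = h * h * ?Q (u + s' *\<^sub>R w + t' *\<^sub>R v)"
    using second_difference_mvt[OF X F h, of u w v] d(2) near' by blast
  have "h * h * ?P (u + s *\<^sub>R v + t *\<^sub>R w) = h * h * ?Q (u + t' *\<^sub>R v + s' *\<^sub>R w)"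
  proof -
    have e: "u + h *\<^sub>R w + h *\<^sub>R v = u + h *\<^sub>R v + h *\<^sub>R w" "u + s' *\<^sub>R w + t' *\<^sub>R v = u + t' *\<^sub>R v + s' *\<^sub>R w"
      by (simp_all add: add.commute add.left_commute)
    show ?thesis using st(5) st'(5)[unfolded e] by linarith
  qed
  then have eq: "?P (u + s *\<^sub>R v + t *\<^sub>R w) = ?Q (u + t' *\<^sub>R v + s' *\<^sub>R w)" using h by simp
  have "dist (?P (u + s *\<^sub>R v + t *\<^sub>R w)) (?P u) < e" "dist (?Q (u + t' *\<^sub>R v + s' *\<^sub>R w)) (?Q u) < e"
    using d(2) near st st' by (meson less_imp_le)+
  then have "dist (?P u) (?Q u) < e + e" using eq unfolding dist_real_def by linarith
  then show False unfolding e_def by simp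
qed

section \<open>Rules for partial derivatives\<close>

lemma pd_cong_open:
  assumes "open X" "u \<in> X" "\<And>w. w \<in> X \<Longrightarrow> F w = G w"
  shows "pd i F u = pd i G u"
  unfolding pd_def using frechet_derivative_cong_open[OF assms] by simp

lemma pd_symmetric:
  fixes F :: "real^'n \<Rightarrow> real"
  assumes "open X" "smooth_on X F" "u \<in> X"
  shows "pd i (pd j F) u = pd j (pd i F) u"
  unfolding pd_def using frechet_derivative_symmetric[OF assms] by blast

lemma has_derivative_pd: "(F has_derivative F') (at u) \<Longrightarrow> pd i F u = F' (axis i 1)"
  unfolding pd_def using has_derivative_frechet_eq by blast

lemma pd_const [simp]: "pd i (\<lambda>v. a) u = 0"
  by (rule has_derivative_pd[of _ "\<lambda>v. 0"]) auto

lemma pd_add: "F differentiable (at u) \<Longrightarrow> G differentiable (at u) \<Longrightarrow> pd i (\<lambda>v. F v + G v) u = pd i F u + pd i G u"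
  unfolding pd_def by (rule has_derivative_frechet_eq) (intro has_derivative_add differentiable_has_derivative)

lemma pd_diff: "F differentiable (at u) \<Longrightarrow> G differentiable (at u) \<Longrightarrow> pd i (\<lambda>v. F v - G v) u = pd i F u - pd i G u"
  unfolding pd_def by (rule has_derivative_frechet_eq) (intro has_derivative_diff differentiable_has_derivative)

lemma pd_minus: "F differentiable (at u) \<Longrightarrow> pd i (\<lambda>v. - F v) u = - pd i F u"
  unfolding pd_def by (rule has_derivative_frechet_eq) (intro has_derivative_minus differentiable_has_derivative)

lemma pd_bilinear:
  assumes "bounded_bilinear B" "F differentiable (at u)" "G differentiable (at u)"
  shows "pd i (\<lambda>v. B (F v) (G v)) u = B (F u) (pd i G u) + B (pd i F u) (G u)"
  unfolding pd_def
  by (rule has_derivative_frechet_eq)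
    (use assms in \<open>intro bounded_bilinear.FDERIV[OF assms(1)] differentiable_has_derivative\<close>)

lemma pd_mult:
  fixes F G :: "real^'n \<Rightarrow> real"
  assumes "F differentiable (at u)" "G differentiable (at u)"
  shows "pd i (\<lambda>v. F v * G v) u = F u * pd i G u + pd i F u * G u"
  using pd_bilinear[OF bounded_bilinear_mult assms] .

lemma pd_linear:
  assumes "bounded_linear L" "F differentiable (at u)"
  shows "pd i (\<lambda>v. L (F v)) u = L (pd i F u)"
  unfolding pd_def
  by (rule has_derivative_frechet_eq) (use assms in \<open>intro bounded_linear.has_derivative[OF assms(1)] differentiable_has_derivative\<close>)

lemma pd_vec_nth: "F differentiable (at u) \<Longrightarrow> pd i (\<lambda>v. F v $ k) u = pd i F u $ k"
  by (rule pd_linear[OF bounded_linear_vec_nth])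

lemma pd_sum:
  assumes "\<And>k. k \<in> I \<Longrightarrow> F k differentiable (at u)"
  shows "pd i (\<lambda>v. \<Sum>k\<in>I. F k v) u = (\<Sum>k\<in>I. pd i (F k) u)"
  unfolding pd_def
  by (rule has_derivative_frechet_eq) (use assms in \<open>intro has_derivative_sum differentiable_has_derivative\<close>)

lemma pd_real_chain:
  fixes F :: "real^'n \<Rightarrow> real"
  assumes "F differentiable (at u)" "(G has_real_derivative G') (at (F u))"
  shows "pd i (\<lambda>v. G (F v)) u = G' * pd i F u"
  unfolding pd_def
  by (rule has_derivative_frechet_eq)
    (use has_derivative_compose[OF differentiable_has_derivative[OF assms(1)], of G "(*) G'"] assms(2)
      in \<open>auto simp: has_field_derivative_def\<close>)

lemma frechet_derivative_pd:
  fixes F :: "real^'n \<Rightarrow> 'b::real_normed_vector"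
  assumes "F differentiable (at u)"
  shows "frechet_derivative F (at u) w = (\<Sum>l\<in>UNIV. w $ l *\<^sub>R pd l F u)"
proof -
  interpret D: linear "frechet_derivative F (at u)"
    using assms by (simp add: frechet_derivative_works has_derivative_linear)
  have "w = (\<Sum>l\<in>UNIV. w $ l *\<^sub>R axis l 1)"
    by (simp add: vec_eq_iff axis_def if_distrib cong: if_cong)
  then have "frechet_derivative F (at u) w = frechet_derivative F (at u) (\<Sum>l\<in>UNIV. w $ l *\<^sub>R axis l 1)"
    by simp
  then show ?thesis unfolding pd_def by (simp add: D.sum D.scaleR)
qed

lemma pd_chain:
  fixes F :: "real^'m \<Rightarrow> real^'n" and G :: "real^'n \<Rightarrow> 'b::real_normed_vector"
  assumes "F differentiable (at u)" "G differentiable (at (F u))"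
  shows "pd i (\<lambda>v. G (F v)) u = (\<Sum>l\<in>UNIV. pd i F u $ l *\<^sub>R pd l G (F u))"
proof -
  have "pd i (\<lambda>v. G (F v)) u = frechet_derivative G (at (F u)) (frechet_derivative F (at u) (axis i 1))"
    by (rule has_derivative_pd)
      (use assms has_derivative_compose in \<open>blast intro: differentiable_has_derivative\<close>)
  then show ?thesis using frechet_derivative_pd[OF assms(2), of "pd i F u"] pd_def[of i F u] by metis
qed

section \<open>Riemannian metrics in coordinates\<close>

lemma smooth_on_prod:
  fixes F :: "'i \<Rightarrow> 'a::real_normed_vector \<Rightarrow> real"
  shows "open X \<Longrightarrow> (\<And>i. i \<in> I \<Longrightarrow> smooth_on X (F i)) \<Longrightarrow> smooth_on X (\<lambda>u. \<Prod>i\<in>I. F i u)"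
  by (induction I rule: infinite_finite_induct) (auto intro: smooth_on_const smooth_on_mult)

lemma smooth_on_det:
  fixes F :: "'a::real_normed_vector \<Rightarrow> real^'n^'n"
  assumes "open X" "\<And>i j. smooth_on X (\<lambda>u. F u $ i $ j)"
  shows "smooth_on X (\<lambda>u. det (F u))"
  unfolding det_def by (intro smooth_on_sum smooth_on_mult smooth_on_const smooth_on_prod assms)

lemma pd_divide_const:
  fixes F :: "real^'n \<Rightarrow> real"
  shows "F differentiable (at u) \<Longrightarrow> pd i (\<lambda>v. F v / a) u = pd i F u / a"
  by (rule pd_linear[OF bounded_linear_divide])

lemma matrix_inv_inverse:
  fixes Q :: "'a::semiring_1^'n^'n"
  assumes "invertible Q"
  shows "Q ** matrix_inv Q = mat 1" "matrix_inv Q ** Q = mat 1"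
  using someI_ex[OF assms[unfolded invertible_def]] unfolding matrix_inv_def by auto

lemma matrix_inv_unique:
  fixes Q R :: "'a::semiring_1^'n^'n"
  assumes "Q ** R = mat 1" "R ** Q = mat 1"
  shows "matrix_inv Q = R"
  using matrix_inv_inverse[of Q] assms
  by (metis invertible_def matrix_mul_assoc matrix_mul_lid matrix_mul_rid)

text \<open>Presents the entries of the inverse as quotients of determinants, from which its smooth
  dependence on the matrix is read off.\<close>

lemma matrix_inv_cramer:
  fixes Q :: "real^'n^'n"
  assumes "invertible Q"
  shows "matrix_inv Q $ k $ j = det (\<chi> i l. if l = k then axis j 1 $ i else Q $ i $ l) / det Q"
proof -
  have "Q *v column j (matrix_inv Q) = axis j 1"
    using matrix_inv_inverse(1)[OF assms]
    by (metis matrix_vector_mul_assoc matrix_vector_mul_lid matrix_vector_mult_basis)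
  moreover have "det Q \<noteq> 0" using assms invertible_det_nz by blast
  ultimately have "column j (matrix_inv Q) = (\<chi> k. det (\<chi> i l. if l = k then axis j 1 $ i else Q $ i $ l) / det Q)"
    using cramer by blast
  then show ?thesis unfolding column_def by (simp add: vec_eq_iff)
qed

lemma smooth_on_matrix_inv:
  fixes F :: "'a::real_normed_vector \<Rightarrow> real^'n^'n"
  assumes X: "open X" and F: "smooth_on X F" and inv: "\<And>u. u \<in> X \<Longrightarrow> invertible (F u)"
  shows "smooth_on X (\<lambda>u. matrix_inv (F u))"
proof -
  have F': "smooth_on X (\<lambda>u. F u $ i $ j)" for i j
    by (intro smooth_on_vec_nth X F)
  have "smooth_on X (\<lambda>u. if l = k then axis j 1 $ i else F u $ i $ l)" for i j k l
    using F' by (cases "l = k") (auto intro: smooth_on_const)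
  then have "smooth_on X (\<lambda>u. det (\<chi> i l. if l = k then axis j 1 $ i else F u $ i $ l) / det (F u))" for k j
    using F' inv by (intro smooth_on_divide smooth_on_det X) (auto simp: invertible_det_nz)
  then have "smooth_on X (\<lambda>u. matrix_inv (F u) $ k $ j)" for k j
    by (rule smooth_on_cong[OF X, rotated, of "\<lambda>u. det (\<chi> i l. if l = k then axis j 1 $ i else F u $ i $ l) / det (F u)"])
      (simp add: matrix_inv_cramer inv)
  then show ?thesis by (simp add: smooth_on_vec_iff[OF X])
qed

text \<open>The coordinate counterpart of \<open>riemannian_metric\<close>. Openness of the domain
  is included because every differentiation rule for local identities asks for it.\<close>

definition metric_on :: "(real^'n) set \<Rightarrow> (real^'n \<Rightarrow> real^'n^'n) \<Rightarrow> bool" where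
  "metric_on X G \<longleftrightarrow> open X \<and> smooth_on X G \<and>
     (\<forall>u\<in>X. transpose (G u) = G u \<and> (\<forall>Z. Z \<noteq> 0 \<longrightarrow> ginner (G u) Z Z > 0))"

lemma posdef_invertible:
  fixes Q :: "real^'n^'n"
  assumes "\<And>Z. Z \<noteq> 0 \<Longrightarrow> ginner Q Z Z > 0"
  shows "invertible Q"
proof -
  have "Z = 0" if "Q *v Z = 0" for Z
    using assms[of Z] that by (force simp: ginner_def)
  then show ?thesis
    using matrix_left_invertible_ker[of Q] invertible_left_inverse[of Q] by blast
qed

context
  fixes X and G :: "real^'n \<Rightarrow> real^'n^'n"
  assumes G: "metric_on X G"
begin

lemma metric_open: "open X"
  using G by (simp add: metric_on_def)

lemma metric_smooth: "smooth_on X G"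
  using G by (simp add: metric_on_def)

lemma metric_pos: "u \<in> X \<Longrightarrow> Z \<noteq> 0 \<Longrightarrow> ginner (G u) Z Z > 0"
  using G by (simp add: metric_on_def)

lemma metric_transpose: "u \<in> X \<Longrightarrow> transpose (G u) = G u"
  using G by (simp add: metric_on_def)

lemma metric_sym: "u \<in> X \<Longrightarrow> G u $ i $ j = G u $ j $ i"
  using arg_cong[OF metric_transpose[of u], of "\<lambda>Q. Q $ j $ i"] by (simp add: transpose_def)

lemma metric_smooth_nth: "smooth_on X (\<lambda>v. G v $ i $ j)"
  by (intro smooth_on_vec_nth metric_open metric_smooth)

lemma metric_invertible: "u \<in> X \<Longrightarrow> invertible (G u)"
  by (rule posdef_invertible) (rule metric_pos)

lemma metric_mult_inv:
  assumes "u \<in> X"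
  shows "(\<Sum>k\<in>UNIV. G u $ i $ k * matrix_inv (G u) $ k $ j) = (if i = j then 1 else 0)"
  using arg_cong[OF matrix_inv_inverse(1)[OF metric_invertible[OF assms]], of "\<lambda>Q. Q $ i $ j"]
  by (simp add: matrix_matrix_mult_def mat_def)

lemma metric_inv_smooth: "smooth_on X (\<lambda>v. matrix_inv (G v))"
  by (rule smooth_on_matrix_inv[OF metric_open metric_smooth metric_invertible])

lemma christoffel_smooth: "smooth_on X (\<lambda>v. christoffel G v k i j)"
  unfolding christoffel_def
  by (intro smooth_on_mult smooth_on_const smooth_on_sum smooth_on_add smooth_on_diff
    smooth_on_pd smooth_on_vec_nth metric_inv_smooth metric_smooth metric_open)

lemma christoffel_sym:
  assumes "u \<in> X"
  shows "christoffel G u k i j = christoffel G u k j i"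
proof -
  have "pd l (\<lambda>v. G v $ i $ j) u = pd l (\<lambda>v. G v $ j $ i) u" for l
    by (rule pd_cong_open[OF metric_open assms]) (simp add: metric_sym)
  then show ?thesis unfolding christoffel_def by (simp add: add.commute)
qed

text \<open>These are the Christoffel symbols of the first kind. Derivatives of
  \<open>christoffel\<close> are later found by differentiating this relation, so that the inverse
  matrix is never differentiated explicitly.\<close>

lemma christoffel_lower:
  assumes u: "u \<in> X"
  shows "(\<Sum>k\<in>UNIV. G u $ m $ k * christoffel G u k i j) =
    (1/2) * (pd i (\<lambda>v. G v $ m $ j) u + pd j (\<lambda>v. G v $ m $ i) u - pd m (\<lambda>v. G v $ i $ j) u)"
proof -
  let ?B = "\<lambda>l. pd i (\<lambda>v. G v $ l $ j) u + pd j (\<lambda>v. G v $ l $ i) u - pd l (\<lambda>v. G v $ i $ j) u"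
  have "(\<Sum>k\<in>UNIV. G u $ m $ k * christoffel G u k i j) =
    (\<Sum>k\<in>UNIV. \<Sum>l\<in>UNIV. (1/2) * ((G u $ m $ k * matrix_inv (G u) $ k $ l) * ?B l))"
    unfolding christoffel_def by (simp add: sum_distrib_left mult.assoc mult.left_commute)
  also have "\<dots> = (\<Sum>l\<in>UNIV. (1/2) * ((\<Sum>k\<in>UNIV. G u $ m $ k * matrix_inv (G u) $ k $ l) * ?B l))"
    by (subst sum.swap) (simp only: sum_distrib_left sum_distrib_right)
  also have "\<dots> = (\<Sum>l\<in>UNIV. if m = l then (1/2) * ?B l else 0)"
    by (intro sum.cong refl) (simp add: metric_mult_inv[OF u])
  also have "\<dots> = (1/2) * ?B m" by simp
  finally show ?thesis .
qed

text \<open>In the sum of two instances of \<open>christoffel_lower\<close> all other derivatives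
  cancel; this is the metric compatibility of the Levi-Civita connection.\<close>

lemma pd_metric:
  assumes u: "u \<in> X"
  shows "pd l (\<lambda>v. G v $ i $ j) u =
    (\<Sum>k\<in>UNIV. G u $ i $ k * christoffel G u k l j) + (\<Sum>k\<in>UNIV. G u $ j $ k * christoffel G u k l i)"
proof -
  have "pd l (\<lambda>v. G v $ j $ i) u = pd l (\<lambda>v. G v $ i $ j) u"
    "pd i (\<lambda>v. G v $ j $ l) u = pd i (\<lambda>v. G v $ l $ j) u"
    "pd j (\<lambda>v. G v $ l $ i) u = pd j (\<lambda>v. G v $ i $ l) u"
    by (auto intro!: pd_cong_open[OF metric_open u] metric_sym)
  then show ?thesis unfolding christoffel_lower[OF u] by (simp add: field_simps)
qed

end


section \<open>Curvature and Laplacian of surface metrics in coordinates\<close>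

text \<open>The trace of the Hessian, of opposite sign to \<open>laplacian\<close>, so that the
  conformal and divergence formulas have their usual form.\<close>

definition lap :: "(real^'n \<Rightarrow> real^'n^'n) \<Rightarrow> (real^'n \<Rightarrow> real) \<Rightarrow> real^'n \<Rightarrow> real" where
  "lap G L u = (\<Sum>i\<in>UNIV. \<Sum>j\<in>UNIV. matrix_inv (G u) $ i $ j *
     (pd i (pd j L) u - (\<Sum>k\<in>UNIV. christoffel G u k i j * pd k L u)))"

text \<open>The inner product of the gradients of \<open>L\<close> and \<open>M\<close>, written
  with the inverse metric on their differentials; \<open>gprod_grad\<close> makes the link.\<close>

definition gprod :: "(real^'n \<Rightarrow> real^'n^'n) \<Rightarrow> (real^'n \<Rightarrow> real) \<Rightarrow> (real^'n \<Rightarrow> real) \<Rightarrow> real^'n \<Rightarrow> real" where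
  "gprod G L M u = (\<Sum>i\<in>UNIV. \<Sum>j\<in>UNIV. matrix_inv (G u) $ i $ j * pd i L u * pd j M u)"

definition gdet :: "(real^2 \<Rightarrow> real^2^2) \<Rightarrow> real^2 \<Rightarrow> real" where
  "gdet G u = G u $ 1 $ 1 * G u $ 2 $ 2 - (G u $ 1 $ 2)\<^sup>2"

text \<open>Brioschi's formula, \<open>K (E H - F\<^sup>2)\<^sup>2\<close> in terms of the 2-jet of the metric.\<close>

definition brioschi where
  "brioschi E F H E1 E2 F1 F2 H1 H2 E22 F12 H11 =
    (E * H - F\<^sup>2) * (F12 - H11/2 - E22/2)
    - (E1/2 * (H * (F2 - H1/2) - F * (H2/2)) + (F1 - E2/2) * (E * (H2/2) - F * (F2 - H1/2)))
    + (H * (E2/2)\<^sup>2 - 2 * F * (E2/2) * (H1/2) + E * (H1/2)\<^sup>2 :: real)"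

context
  fixes X and G :: "real^2 \<Rightarrow> real^2^2"
  assumes G: "metric_on X G"
begin

lemma gdet_pos:
  assumes u: "u \<in> X"
  shows "gdet G u > 0" "G u $ 1 $ 1 > 0" "G u $ 2 $ 2 > 0"
proof -
  have *: "ginner (G u) Z Z = Z$1 * Z$1 * G u $ 1 $ 1 + 2 * Z$1 * Z$2 * G u $ 1 $ 2 + Z$2 * Z$2 * G u $ 2 $ 2" for Z
    using metric_sym[OF G u, of 2 1]
    by (simp add: ginner_def inner_vec_def matrix_vector_mult_def sum_2 algebra_simps)
  show E: "G u $ 1 $ 1 > 0"
    using metric_pos[OF G u, of "axis 1 1"] *[of "axis 1 1"] by (simp add: axis_def vec_eq_iff)
  show "G u $ 2 $ 2 > 0"
    using metric_pos[OF G u, of "axis 2 1"] *[of "axis 2 1"] by (simp add: axis_def vec_eq_iff)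
  \<comment> \<open>This vector is orthogonal to the first coordinate direction; the quadratic form
    takes there the value E times the determinant.\<close>
  define Z :: "real^2" where "Z = (\<chi> i. if i = 1 then G u $ 1 $ 2 else - G u $ 1 $ 1)"
  have Z: "Z $ 1 = G u $ 1 $ 2" "Z $ 2 = - G u $ 1 $ 1" by (simp_all add: Z_def)
  then have "Z \<noteq> 0" using E by (metis less_irrefl neg_equal_0_iff_equal zero_index)
  then have "ginner (G u) Z Z > 0" using metric_pos[OF G u] by blast
  also have "ginner (G u) Z Z = G u $ 1 $ 1 * gdet G u"
    unfolding * Z gdet_def by (simp add: algebra_simps power2_eq_square)
  finally show "gdet G u > 0" using E by (simp add: zero_less_mult_iff)
qed

lemma gdet_smooth: "smooth_on X (gdet G)"
  unfolding gdet_def[abs_def] power2_eq_square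
  by (intro smooth_on_diff smooth_on_mult metric_smooth_nth[OF G] metric_open[OF G])

lemma metric_inv_2:
  assumes u: "u \<in> X"
  shows "matrix_inv (G u) $ 1 $ 1 = G u $ 2 $ 2 / gdet G u"
    "matrix_inv (G u) $ 1 $ 2 = - G u $ 1 $ 2 / gdet G u"
    "matrix_inv (G u) $ 2 $ 1 = - G u $ 1 $ 2 / gdet G u"
    "matrix_inv (G u) $ 2 $ 2 = G u $ 1 $ 1 / gdet G u"
proof -
  define R :: "real^2^2" where "R = (\<chi> i j. if i = j then (if i = 1 then G u $ 2 $ 2 else G u $ 1 $ 1) / gdet G u
    else - G u $ 1 $ 2 / gdet G u)"
  have R: "R $ 1 $ 1 = G u $ 2 $ 2 / gdet G u" "R $ 1 $ 2 = - G u $ 1 $ 2 / gdet G u"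
    "R $ 2 $ 1 = - G u $ 1 $ 2 / gdet G u" "R $ 2 $ 2 = G u $ 1 $ 1 / gdet G u"
    by (simp_all add: R_def)
  have d: "G u $ 1 $ 1 * G u $ 2 $ 2 = gdet G u + (G u $ 1 $ 2)\<^sup>2" "gdet G u \<noteq> 0"
    using gdet_pos(1)[OF u] by (auto simp: gdet_def)
  have "matrix_inv (G u) = R"
    using metric_sym[OF G u, of 2 1] d
    by (intro matrix_inv_unique)
      (simp_all add: vec_eq_iff forall_2 matrix_matrix_mult_def sum_2 mat_def R power2_eq_square
        add_divide_distrib[symmetric] diff_divide_distrib[symmetric] mult.commute)
  then show "matrix_inv (G u) $ 1 $ 1 = G u $ 2 $ 2 / gdet G u"
    "matrix_inv (G u) $ 1 $ 2 = - G u $ 1 $ 2 / gdet G u"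
    "matrix_inv (G u) $ 2 $ 1 = - G u $ 1 $ 2 / gdet G u"
    "matrix_inv (G u) $ 2 $ 2 = G u $ 1 $ 1 / gdet G u" using R by simp_all
qed

lemma pd_metric_21:
  assumes u: "u \<in> X"
  shows "pd l (\<lambda>v. G v $ 2 $ 1) u = pd l (\<lambda>v. G v $ 1 $ 2) u"
  by (rule pd_cong_open[OF metric_open[OF G] u]) (rule metric_sym[OF G])

lemma christoffel_2:
  assumes u: "u \<in> X"
  defines "d \<equiv> gdet G u"
    and "E \<equiv> G u $ 1 $ 1" and "F \<equiv> G u $ 1 $ 2" and "H \<equiv> G u $ 2 $ 2"
    and "E1 \<equiv> pd 1 (\<lambda>v. G v $ 1 $ 1) u" and "E2 \<equiv> pd 2 (\<lambda>v. G v $ 1 $ 1) u"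
    and "F1 \<equiv> pd 1 (\<lambda>v. G v $ 1 $ 2) u" and "F2 \<equiv> pd 2 (\<lambda>v. G v $ 1 $ 2) u"
    and "H1 \<equiv> pd 1 (\<lambda>v. G v $ 2 $ 2) u" and "H2 \<equiv> pd 2 (\<lambda>v. G v $ 2 $ 2) u"
  shows "christoffel G u 1 1 1 = (H * (E1/2) - F * (F1 - E2/2)) / d"
    "christoffel G u 2 1 1 = (E * (F1 - E2/2) - F * (E1/2)) / d"
    "christoffel G u 1 1 2 = (H * (E2/2) - F * (H1/2)) / d"
    "christoffel G u 2 1 2 = (E * (H1/2) - F * (E2/2)) / d"
    "christoffel G u 1 2 1 = (H * (E2/2) - F * (H1/2)) / d"
    "christoffel G u 2 2 1 = (E * (H1/2) - F * (E2/2)) / d"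
    "christoffel G u 1 2 2 = (H * (F2 - H1/2) - F * (H2/2)) / d"
    "christoffel G u 2 2 2 = (E * (H2/2) - F * (F2 - H1/2)) / d"
  using gdet_pos(1)[OF u]
  unfolding christoffel_def sum_2 metric_inv_2[OF u] pd_metric_21[OF u] assms(2-)
  by (simp_all add: field_simps)

text \<open>Derivatives of Christoffel symbols occur only in the combination that lowers the upper
  index, and this combination comes from differentiating \<open>christoffel_lower\<close>. The rest
  is of first order in the metric and is inserted from \<open>christoffel_2\<close>; the square of
  \<open>gdet\<close> clears the denominators.\<close>

lemma curvature_brioschi:
  assumes u: "u \<in> X"
  shows "sectional G u (axis 1 1) (axis 2 1) * (gdet G u)\<^sup>2 =
    brioschi (G u $ 1 $ 1) (G u $ 1 $ 2) (G u $ 2 $ 2)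
      (pd 1 (\<lambda>v. G v $ 1 $ 1) u) (pd 2 (\<lambda>v. G v $ 1 $ 1) u)
      (pd 1 (\<lambda>v. G v $ 1 $ 2) u) (pd 2 (\<lambda>v. G v $ 1 $ 2) u)
      (pd 1 (\<lambda>v. G v $ 2 $ 2) u) (pd 2 (\<lambda>v. G v $ 2 $ 2) u)
      (pd 2 (pd 2 (\<lambda>v. G v $ 1 $ 1)) u) (pd 1 (pd 2 (\<lambda>v. G v $ 1 $ 2)) u) (pd 1 (pd 1 (\<lambda>v. G v $ 2 $ 2)) u)"
proof -
  let ?C = "christoffel G"
  let ?E = "\<lambda>v. G v $ 1 $ 1" let ?F = "\<lambda>v. G v $ 1 $ 2" let ?H = "\<lambda>v. G v $ 2 $ 2"
  have sm: "(\<lambda>v. ?C v k i j) differentiable (at u)" "(\<lambda>v. G v $ i $ j) differentiable (at u)"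
    "pd m (\<lambda>v. G v $ i $ j) differentiable (at u)" for i j k m
    using christoffel_smooth[OF G] metric_smooth_nth[OF G] u smooth_on_pd smooth_on_differentiable by blast+
  have low: "G v $ 1 $ 1 * ?C v 1 2 2 + G v $ 1 $ 2 * ?C v 2 2 2 = pd 2 ?F v - 1/2 * pd 1 ?H v"
    "G v $ 1 $ 1 * ?C v 1 1 2 + G v $ 1 $ 2 * ?C v 2 1 2 = 1/2 * pd 2 ?E v" if "v \<in> X" for v
    using christoffel_lower[OF G that, of 1 2 2] christoffel_lower[OF G that, of 1 1 2]
    by (simp_all add: sum_2 pd_metric_21[OF that] algebra_simps)
  have d1: "?E u * pd 1 (\<lambda>v. ?C v 1 2 2) u + pd 1 ?E u * ?C u 1 2 2 + (?F u * pd 1 (\<lambda>v. ?C v 2 2 2) u + pd 1 ?F u * ?C u 2 2 2)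
      = pd 1 (pd 2 ?F) u - 1/2 * pd 1 (pd 1 ?H) u"
  proof -
    have "pd 1 (\<lambda>v. ?E v * ?C v 1 2 2 + ?F v * ?C v 2 2 2) u = pd 1 (\<lambda>v. pd 2 ?F v - 1/2 * pd 1 ?H v) u"
      by (rule pd_cong_open[OF metric_open[OF G] u]) (rule low)
    then show ?thesis
      by (simp add: pd_add pd_diff pd_mult pd_divide_const sm differentiable_mult)
  qed
  have d2: "?E u * pd 2 (\<lambda>v. ?C v 1 1 2) u + pd 2 ?E u * ?C u 1 1 2 + (?F u * pd 2 (\<lambda>v. ?C v 2 1 2) u + pd 2 ?F u * ?C u 2 1 2)
      = 1/2 * pd 2 (pd 2 ?E) u"
  proof -
    have "pd 2 (\<lambda>v. ?E v * ?C v 1 1 2 + ?F v * ?C v 2 1 2) u = pd 2 (\<lambda>v. 1/2 * pd 2 ?E v) u"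
      by (rule pd_cong_open[OF metric_open[OF G] u]) (rule low)
    then show ?thesis
      by (simp add: pd_add pd_diff pd_mult pd_divide_const sm differentiable_mult)
  qed
  define N where "N = ginner (G u) (riemann G u (axis 1 1) (axis 2 1) (axis 2 1)) (axis 1 1)"
  \<comment> \<open>Pairing with the first coordinate direction weights the two components of the
    curvature vector by the first row of the metric.\<close>
  have N: "N = ?E u * riemann_coeff G u 1 2 1 2 + ?F u * riemann_coeff G u 2 2 1 2"
    unfolding N_def ginner_def riemann_def inner_vec_def matrix_vector_mult_def sum_2
    by (simp add: axis_def metric_sym[OF G u, of 2 1])
  have "N = pd 1 (pd 2 ?F) u - 1/2 * pd 1 (pd 1 ?H) u - 1/2 * pd 2 (pd 2 ?E) u
    - (pd 1 ?E u * ?C u 1 2 2 + pd 1 ?F u * ?C u 2 2 2) + (pd 2 ?E u * ?C u 1 1 2 + pd 2 ?F u * ?C u 2 1 2)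
    + ((?E u * ?C u 1 1 1 + ?F u * ?C u 2 1 1) * ?C u 1 2 2 + (?E u * ?C u 1 1 2 + ?F u * ?C u 2 1 2) * ?C u 2 2 2
      - (?E u * ?C u 1 2 1 + ?F u * ?C u 2 2 1) * ?C u 1 1 2 - (?E u * ?C u 1 2 2 + ?F u * ?C u 2 2 2) * ?C u 2 1 2)"
    unfolding N riemann_coeff_def sum_2 using d1 d2 by (simp add: algebra_simps)
  also have "?E u * ?C u 1 1 1 + ?F u * ?C u 2 1 1 = 1/2 * pd 1 ?E u"
    using christoffel_lower[OF G u, of 1 1 1] by (simp add: sum_2)
  also have "?E u * ?C u 1 2 1 + ?F u * ?C u 2 2 1 = 1/2 * pd 2 ?E u"
    using christoffel_lower[OF G u, of 1 2 1] by (simp add: sum_2 pd_metric_21[OF u])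
  also note low(1)[OF u] also note low(2)[OF u]
  finally have N2: "N = pd 1 (pd 2 ?F) u - 1/2 * pd 1 (pd 1 ?H) u - 1/2 * pd 2 (pd 2 ?E) u
    - (pd 1 ?E u * ?C u 1 2 2 + pd 1 ?F u * ?C u 2 2 2) + (pd 2 ?E u * ?C u 1 1 2 + pd 2 ?F u * ?C u 2 1 2)
    + (1/2 * pd 1 ?E u * ?C u 1 2 2 + 1/2 * pd 2 ?E u * ?C u 2 2 2
      - 1/2 * pd 2 ?E u * ?C u 1 1 2 - (pd 2 ?F u - 1/2 * pd 1 ?H u) * ?C u 2 1 2)" .
  have den: "ginner (G u) (axis 1 1) (axis 1 1) * ginner (G u) (axis 2 1) (axis 2 1) - (ginner (G u) (axis 1 1) (axis 2 1))\<^sup>2 = gdet G u"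
    unfolding ginner_def inner_vec_def matrix_vector_mult_def sum_2 gdet_def by (simp add: axis_def)
  have "sectional G u (axis 1 1) (axis 2 1) * (gdet G u)\<^sup>2 = N * gdet G u"
    unfolding sectional_def den N_def[symmetric] using gdet_pos(1)[OF u] by (simp add: power2_eq_square)
  also have "\<dots> = brioschi (?E u) (?F u) (?H u) (pd 1 ?E u) (pd 2 ?E u) (pd 1 ?F u) (pd 2 ?F u) (pd 1 ?H u) (pd 2 ?H u)
      (pd 2 (pd 2 ?E) u) (pd 1 (pd 2 ?F) u) (pd 1 (pd 1 ?H) u)"
  proof -
    have d: "gdet G u \<noteq> 0" using gdet_pos(1)[OF u] by simp
    have dd: "?E u * ?H u - (?F u)\<^sup>2 = gdet G u" by (simp add: gdet_def)
    show ?thesis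
      unfolding N2 christoffel_2[OF u] brioschi_def dd using d
      by (simp add: field_simps power2_eq_square)
  qed
  finally show ?thesis .
qed

text \<open>Without denominators the Laplacian is polynomial in the jets of \<open>G\<close> and
  \<open>L\<close>, as is the curvature in \<open>curvature_brioschi\<close>, so the two can be
  compared by algebra.\<close>

lemma lap_2:
  assumes u: "u \<in> X" and L: "smooth_on X L"
  defines "E \<equiv> G u $ 1 $ 1" and "F \<equiv> G u $ 1 $ 2" and "H \<equiv> G u $ 2 $ 2"
    and "E1 \<equiv> pd 1 (\<lambda>v. G v $ 1 $ 1) u" and "E2 \<equiv> pd 2 (\<lambda>v. G v $ 1 $ 1) u"
    and "F1 \<equiv> pd 1 (\<lambda>v. G v $ 1 $ 2) u" and "F2 \<equiv> pd 2 (\<lambda>v. G v $ 1 $ 2) u"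
    and "H1 \<equiv> pd 1 (\<lambda>v. G v $ 2 $ 2) u" and "H2 \<equiv> pd 2 (\<lambda>v. G v $ 2 $ 2) u"
  shows "lap G L u * (gdet G u)\<^sup>2 = gdet G u * (H * pd 1 (pd 1 L) u - 2 * F * pd 1 (pd 2 L) u + E * pd 2 (pd 2 L) u)
    - (H * (H * (E1/2) - F * (F1 - E2/2)) - 2 * F * (H * (E2/2) - F * (H1/2)) + E * (H * (F2 - H1/2) - F * (H2/2))) * pd 1 L u
    - (H * (E * (F1 - E2/2) - F * (E1/2)) - 2 * F * (E * (H1/2) - F * (E2/2)) + E * (E * (H2/2) - F * (F2 - H1/2))) * pd 2 L u"
proof -
  have "pd 2 (pd 1 L) u = pd 1 (pd 2 L) u" by (rule pd_symmetric[OF metric_open[OF G] L u])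
  moreover have "gdet G u \<noteq> 0" using gdet_pos(1)[OF u] by simp
  ultimately show ?thesis
    unfolding lap_def sum_2 christoffel_2[OF u] metric_inv_2[OF u] assms(3-)
    by (simp add: field_simps power2_eq_square)
qed

end

text \<open>The two quotients are the components of the Hodge star of dL, and the identity says that
  its exterior derivative is \<open>lap\<close> times the area form. It turns closedness of
  one-forms into Laplace equations and back.\<close>

lemma lap_divergence:
  fixes G :: "real^2 \<Rightarrow> real^2^2"
  assumes G: "metric_on X G" and u: "u \<in> X" and L: "smooth_on X L"
  shows "lap G L u * sqrt (gdet G u) =
    pd 1 (\<lambda>v. (G v $ 2 $ 2 * pd 1 L v - G v $ 1 $ 2 * pd 2 L v) / sqrt (gdet G v)) u -
    pd 2 (\<lambda>v. (G v $ 1 $ 2 * pd 1 L v - G v $ 1 $ 1 * pd 2 L v) / sqrt (gdet G v)) u"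
proof -
  define w where "w = (\<lambda>v. inverse (sqrt (gdet G v)))"
  have pos: "gdet G v > 0" if "v \<in> X" for v using gdet_pos(1)[OF G that] .
  note X = metric_open[OF G]
  have wsm: "smooth_on X w" unfolding w_def
    using pos by (intro smooth_on_inverse smooth_on_sqrt gdet_smooth[OF G] X) force+
  have ww: "w v * w v * gdet G v = 1" if "v \<in> X" for v
    using pos[OF that] by (simp add: w_def field_simps)
  have sm: "(\<lambda>v. G v $ i $ j) differentiable (at u)" "pd i L differentiable (at u)" "w differentiable (at u)"
    "gdet G differentiable (at u)" for i j
    using metric_smooth_nth[OF G] smooth_on_pd[OF L] wsm gdet_smooth[OF G] u smooth_on_differentiable by blast+
  have dd: "pd i (gdet G) u = G u $ 1 $ 1 * pd i (\<lambda>v. G v $ 2 $ 2) u + pd i (\<lambda>v. G v $ 1 $ 1) u * G u $ 2 $ 2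
      - 2 * G u $ 1 $ 2 * pd i (\<lambda>v. G v $ 1 $ 2) u" for i
    unfolding gdet_def[abs_def] power2_eq_square by (simp add: pd_diff pd_mult sm differentiable_mult)
  \<comment> \<open>Differentiating the relation \<open>ww\<close> gives the derivative of the
    density without differentiating a square root.\<close>
  have dw: "2 * pd i w u * gdet G u = - w u * pd i (gdet G) u" for i
  proof -
    have "pd i (\<lambda>v. w v * w v * gdet G v) u = pd i (\<lambda>v. 1) u"
      by (rule pd_cong_open[OF X u]) (rule ww)
    then have "w u * (w u * pd i (gdet G) u + 2 * pd i w u * gdet G u) = 0"
      by (simp add: pd_mult sm differentiable_mult algebra_simps)
    then show ?thesis using ww[OF u] by auto
  qed
  have comm: "pd 2 (pd 1 L) u = pd 1 (pd 2 L) u" by (rule pd_symmetric[OF X L u])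
  have e1: "pd 1 (\<lambda>v. (G v $ 2 $ 2 * pd 1 L v - G v $ 1 $ 2 * pd 2 L v) * w v) u =
     (G u $ 2 $ 2 * pd 1 L u - G u $ 1 $ 2 * pd 2 L u) * pd 1 w u +
     (G u $ 2 $ 2 * pd 1 (pd 1 L) u + pd 1 (\<lambda>v. G v $ 2 $ 2) u * pd 1 L u
       - (G u $ 1 $ 2 * pd 1 (pd 2 L) u + pd 1 (\<lambda>v. G v $ 1 $ 2) u * pd 2 L u)) * w u"
    by (simp add: pd_diff pd_mult sm differentiable_mult)
  have e2: "pd 2 (\<lambda>v. (G v $ 1 $ 2 * pd 1 L v - G v $ 1 $ 1 * pd 2 L v) * w v) u =
     (G u $ 1 $ 2 * pd 1 L u - G u $ 1 $ 1 * pd 2 L u) * pd 2 w u +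
     (G u $ 1 $ 2 * pd 1 (pd 2 L) u + pd 2 (\<lambda>v. G v $ 1 $ 2) u * pd 1 L u
       - (G u $ 1 $ 1 * pd 2 (pd 2 L) u + pd 2 (\<lambda>v. G v $ 1 $ 1) u * pd 2 L u)) * w u"
    by (simp add: pd_diff pd_mult sm differentiable_mult comm)
  define D where "D = pd 1 (\<lambda>v. (G v $ 2 $ 2 * pd 1 L v - G v $ 1 $ 2 * pd 2 L v) * w v) u
     - pd 2 (\<lambda>v. (G v $ 1 $ 2 * pd 1 L v - G v $ 1 $ 1 * pd 2 L v) * w v) u"
  have D2: "D * (2 * gdet G u) = w u * (
     2 * gdet G u * (G u $ 2 $ 2 * pd 1 (pd 1 L) u + pd 1 (\<lambda>v. G v $ 2 $ 2) u * pd 1 L u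
       - (G u $ 1 $ 2 * pd 1 (pd 2 L) u + pd 1 (\<lambda>v. G v $ 1 $ 2) u * pd 2 L u))
     - 2 * gdet G u * (G u $ 1 $ 2 * pd 1 (pd 2 L) u + pd 2 (\<lambda>v. G v $ 1 $ 2) u * pd 1 L u
       - (G u $ 1 $ 1 * pd 2 (pd 2 L) u + pd 2 (\<lambda>v. G v $ 1 $ 1) u * pd 2 L u))
     - (G u $ 2 $ 2 * pd 1 L u - G u $ 1 $ 2 * pd 2 L u) * pd 1 (gdet G) u
     + (G u $ 1 $ 2 * pd 1 L u - G u $ 1 $ 1 * pd 2 L u) * pd 2 (gdet G) u)"
    unfolding D_def e1 e2 using dw[of 1] dw[of 2] by (simp add: algebra_simps) algebra
  also have "\<dots> = 2 * w u * (lap G L u * (gdet G u)\<^sup>2)"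
    unfolding lap_2[OF G u L] dd by (simp add: gdet_def power2_eq_square) algebra
  finally have "D = lap G L u * (w u * gdet G u)"
    using pos[OF u] by (simp add: power2_eq_square)
  moreover have "w u * gdet G u = sqrt (gdet G u)"
    using pos[OF u] by (simp add: w_def real_div_sqrt divide_inverse[symmetric] mult.commute)
  ultimately show ?thesis unfolding D_def w_def divide_inverse by simp
qed

lemma metric_on_scale:
  assumes "metric_on X G" "smooth_on X s" "\<And>u. u \<in> X \<Longrightarrow> s u > 0"
  shows "metric_on X (\<lambda>u. s u *\<^sub>R G u)"
proof -
  have "ginner (s u *\<^sub>R G u) Z Z = s u * ginner (G u) Z Z" for u Z
    by (simp add: ginner_def scaleR_matrix_vector_assoc[symmetric])
  moreover have "transpose (s u *\<^sub>R G u) = s u *\<^sub>R transpose (G u)" for u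
    by (simp add: transpose_def vec_eq_iff)
  ultimately show ?thesis using assms by (auto simp: metric_on_def intro!: smooth_on_scaleR)
qed

text \<open>The 2-jet of the scaled metric is expanded and put into Brioschi's formula. The
  derivatives of \<open>s\<close> assemble into the Laplacian of ln s, and after clearing
  denominators the claim is a polynomial identity.\<close>

lemma curvature_conformal:
  fixes G :: "real^2 \<Rightarrow> real^2^2"
  assumes G: "metric_on X G" and s: "smooth_on X s" "\<And>u. u \<in> X \<Longrightarrow> s u > 0" and u: "u \<in> X"
  shows "sectional (\<lambda>v. s v *\<^sub>R G v) u (axis 1 1) (axis 2 1) =
    (sectional G u (axis 1 1) (axis 2 1) - lap G (\<lambda>v. ln (s v)) u / 2) / s u"
proof -
  note X = metric_open[OF G]
  let ?G = "\<lambda>v. s v *\<^sub>R G v"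
  have G': "metric_on X ?G" by (rule metric_on_scale[OF G s])
  have su: "s u > 0" using s(2)[OF u] .
  have Lsm: "smooth_on X (\<lambda>v. ln (s v))" using s by (intro smooth_on_ln X) auto
  have sm: "(\<lambda>v. G v $ i $ j) differentiable (at v)" "s differentiable (at v)" "pd i s differentiable (at v)"
    "pd k (\<lambda>v. G v $ i $ j) differentiable (at v)" if "v \<in> X" for i j k v
    using metric_smooth_nth[OF G] s(1) that smooth_on_pd smooth_on_differentiable by blast+
  have p1: "pd k (\<lambda>v. (s v *\<^sub>R G v) $ i $ j) v = s v * pd k (\<lambda>v. G v $ i $ j) v + pd k s v * G v $ i $ j"
    if "v \<in> X" for i j k v
    using sm[OF that] by (simp add: pd_mult)
  have p2: "pd l (pd k (\<lambda>v. (s v *\<^sub>R G v) $ i $ j)) u =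
      s u * pd l (pd k (\<lambda>v. G v $ i $ j)) u + pd l s u * pd k (\<lambda>v. G v $ i $ j) u
      + (pd k s u * pd l (\<lambda>v. G v $ i $ j) u + pd l (pd k s) u * G u $ i $ j)" for i j k l
  proof -
    have "pd l (pd k (\<lambda>v. (s v *\<^sub>R G v) $ i $ j)) u =
      pd l (\<lambda>v. s v * pd k (\<lambda>v. G v $ i $ j) v + pd k s v * G v $ i $ j) u"
      by (rule pd_cong_open[OF X u]) (rule p1)
    then show ?thesis using sm[OF u] by (simp add: pd_add pd_mult differentiable_mult)
  qed
  have l1: "pd k (\<lambda>v. ln (s v)) v = inverse (s v) * pd k s v" if "v \<in> X" for k v
    using s(2)[OF that] sm[OF that] by (intro pd_real_chain) (auto intro!: derivative_eq_intros simp: divide_inverse)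
  have l2: "pd l (pd k (\<lambda>v. ln (s v))) u = inverse (s u) * pd l (pd k s) u - (inverse (s u))\<^sup>2 * pd l s u * pd k s u" for k l
  proof -
    have "pd l (pd k (\<lambda>v. ln (s v))) u = pd l (\<lambda>v. inverse (s v) * pd k s v) u"
      by (rule pd_cong_open[OF X u]) (rule l1)
    moreover have "pd l (\<lambda>v. inverse (s v)) u = - (inverse (s u))\<^sup>2 * pd l s u"
      using su sm[OF u] by (intro pd_real_chain) (auto intro!: derivative_eq_intros simp: power2_eq_square)
    moreover have "(\<lambda>v. inverse (s v)) differentiable (at u)" using su sm[OF u] by (intro differentiable_inverse) auto
    ultimately show ?thesis using sm[OF u] by (simp add: pd_mult)
  qed
  have gd: "gdet ?G u = (s u)\<^sup>2 * gdet G u" by (simp add: gdet_def power2_eq_square algebra_simps)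
  define K where "K = sectional G u (axis 1 1) (axis 2 1)"
  define K' where "K' = sectional ?G u (axis 1 1) (axis 2 1)"
  define J where "J = lap G (\<lambda>v. ln (s v)) u"
  have comm: "pd 2 (pd 1 s) u = pd 1 (pd 2 s) u" by (rule pd_symmetric[OF X s(1) u])
  note k' = curvature_brioschi[OF G' u, unfolded gd p1[OF u] p2, folded K'_def]
  note k = curvature_brioschi[OF G u, folded K_def]
  note j = lap_2[OF G u Lsm, unfolded l1[OF u] l2, folded J_def]
  have "K' * ((s u)\<^sup>2 * gdet G u)\<^sup>2 = (s u)^3 * (K * (gdet G u)\<^sup>2 - J * (gdet G u)\<^sup>2 / 2)"
    using su unfolding k' k j unfolding brioschi_def gdet_def
    by (simp add: field_simps power2_eq_square power3_eq_cube)
  then have "(s u)^3 * (gdet G u)\<^sup>2 * (K' * s u - (K - J / 2)) = 0"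
    by (simp add: algebra_simps power2_eq_square power3_eq_cube)
  then have "K' * s u = K - J / 2"
    using su gdet_pos(1)[OF G u] by simp
  then show ?thesis unfolding K_def K'_def J_def using su by (simp add: field_simps)
qed

text \<open>The forms a dx + b dy and c dx + d dy are a closed orthonormal coframe, whose primitives
  would be Euclidean coordinates. Instead of integrating, the closedness relations and their
  derivatives are inserted into Brioschi's formula, where everything cancels.\<close>

lemma flat_of_closed_coframe:
  fixes G :: "real^2 \<Rightarrow> real^2^2"
  assumes G: "metric_on X G" and u: "u \<in> X"
    and sm: "smooth_on X a" "smooth_on X b" "smooth_on X c" "smooth_on X d"
    and closed: "\<And>v. v \<in> X \<Longrightarrow> pd 1 b v = pd 2 a v" "\<And>v. v \<in> X \<Longrightarrow> pd 1 d v = pd 2 c v"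
    and E: "\<And>v. v \<in> X \<Longrightarrow> G v $ 1 $ 1 = a v * a v + c v * c v"
    and F: "\<And>v. v \<in> X \<Longrightarrow> G v $ 1 $ 2 = a v * b v + c v * d v"
    and H: "\<And>v. v \<in> X \<Longrightarrow> G v $ 2 $ 2 = b v * b v + d v * d v"
  shows "sectional G u (axis 1 1) (axis 2 1) = 0"
proof -
  note X = metric_open[OF G]
  have df: "a differentiable (at v)" "b differentiable (at v)" "c differentiable (at v)" "d differentiable (at v)"
     "pd i a differentiable (at v)" "pd i b differentiable (at v)" "pd i c differentiable (at v)" "pd i d differentiable (at v)"
     if "v \<in> X" for i v
    using sm smooth_on_differentiable[OF _ that] smooth_on_pd by blast+
  have E1: "pd k (\<lambda>v. G v $ 1 $ 1) v = 2 * (a v * pd k a v + c v * pd k c v)" if "v \<in> X" for k v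
  proof -
    have "pd k (\<lambda>v. G v $ 1 $ 1) v = pd k (\<lambda>v. a v * a v + c v * c v) v"
      by (rule pd_cong_open[OF X that]) (rule E)
    then show ?thesis using df[OF that] by (simp add: pd_add pd_mult differentiable_mult)
  qed
  have F1: "pd k (\<lambda>v. G v $ 1 $ 2) v = a v * pd k b v + pd k a v * b v + (c v * pd k d v + pd k c v * d v)" if "v \<in> X" for k v
  proof -
    have "pd k (\<lambda>v. G v $ 1 $ 2) v = pd k (\<lambda>v. a v * b v + c v * d v) v"
      by (rule pd_cong_open[OF X that]) (rule F)
    then show ?thesis using df[OF that] by (simp add: pd_add pd_mult differentiable_mult)
  qed
  have H1: "pd k (\<lambda>v. G v $ 2 $ 2) v = 2 * (b v * pd k b v + d v * pd k d v)" if "v \<in> X" for k v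
  proof -
    have "pd k (\<lambda>v. G v $ 2 $ 2) v = pd k (\<lambda>v. b v * b v + d v * d v) v"
      by (rule pd_cong_open[OF X that]) (rule H)
    then show ?thesis using df[OF that] by (simp add: pd_add pd_mult differentiable_mult)
  qed
  have E2: "pd 2 (pd 2 (\<lambda>v. G v $ 1 $ 1)) u = 2 * (a u * pd 2 (pd 2 a) u + pd 2 a u * pd 2 a u + (c u * pd 2 (pd 2 c) u + pd 2 c u * pd 2 c u))"
  proof -
    have "pd 2 (pd 2 (\<lambda>v. G v $ 1 $ 1)) u = pd 2 (\<lambda>v. 2 * (a v * pd 2 a v + c v * pd 2 c v)) u"
      by (rule pd_cong_open[OF X u]) (rule E1)
    then show ?thesis using df[OF u] by (simp add: pd_add pd_mult differentiable_mult)
  qed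
  have F2: "pd 1 (pd 2 (\<lambda>v. G v $ 1 $ 2)) u = a u * pd 1 (pd 2 b) u + pd 1 a u * pd 2 b u + (pd 2 a u * pd 1 b u + pd 1 (pd 2 a) u * b u)
     + (c u * pd 1 (pd 2 d) u + pd 1 c u * pd 2 d u + (pd 2 c u * pd 1 d u + pd 1 (pd 2 c) u * d u))"
  proof -
    have "pd 1 (pd 2 (\<lambda>v. G v $ 1 $ 2)) u = pd 1 (\<lambda>v. a v * pd 2 b v + pd 2 a v * b v + (c v * pd 2 d v + pd 2 c v * d v)) u"
      by (rule pd_cong_open[OF X u]) (rule F1)
    then show ?thesis using df[OF u] by (simp add: pd_add pd_mult differentiable_mult differentiable_add)
  qed
  have H2: "pd 1 (pd 1 (\<lambda>v. G v $ 2 $ 2)) u = 2 * (b u * pd 1 (pd 1 b) u + pd 1 b u * pd 1 b u + (d u * pd 1 (pd 1 d) u + pd 1 d u * pd 1 d u))"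
  proof -
    have "pd 1 (pd 1 (\<lambda>v. G v $ 2 $ 2)) u = pd 1 (\<lambda>v. 2 * (b v * pd 1 b v + d v * pd 1 d v)) u"
      by (rule pd_cong_open[OF X u]) (rule H1)
    then show ?thesis using df[OF u] by (simp add: pd_add pd_mult differentiable_mult)
  qed
  have c1: "pd 1 (pd 1 b) u = pd 1 (pd 2 a) u" "pd 1 (pd 1 d) u = pd 1 (pd 2 c) u"
    by (rule pd_cong_open[OF X u], rule closed, assumption)+
  have c2: "pd 1 (pd 2 b) u = pd 2 (pd 2 a) u" "pd 1 (pd 2 d) u = pd 2 (pd 2 c) u"
    unfolding pd_symmetric[OF X sm(2) u, of 1 2] pd_symmetric[OF X sm(4) u, of 1 2]
    by (rule pd_cong_open[OF X u], rule closed, assumption)+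
  have "sectional G u (axis 1 1) (axis 2 1) * (gdet G u)\<^sup>2 = 0"
    unfolding curvature_brioschi[OF G u] E[OF u] F[OF u] H[OF u] E1[OF u] F1[OF u] H1[OF u] E2 F2 H2 c1 c2 closed[OF u] brioschi_def
    by (simp add: field_simps power2_eq_square)
  then show ?thesis using gdet_pos(1)[OF G u] by simp
qed

section \<open>Sum, product and chain rules for the Laplacian, and locality of Laplacian and
  curvature\<close>

lemma lap_add:
  assumes "open X" "u \<in> X" "smooth_on X L" "smooth_on X M"
  shows "lap G (\<lambda>v. L v + M v) u = lap G L u + lap G M u"
proof -
  have 1: "pd k (\<lambda>v. L v + M v) v = pd k L v + pd k M v" if "v \<in> X" for k v
    using assms that smooth_on_differentiable by (intro pd_add) blast+
  have 2: "pd l (pd k (\<lambda>v. L v + M v)) u = pd l (pd k L) u + pd l (pd k M) u" for k l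
  proof -
    have "pd l (pd k (\<lambda>v. L v + M v)) u = pd l (\<lambda>v. pd k L v + pd k M v) u"
      by (rule pd_cong_open[OF assms(1,2)]) (rule 1)
    then show ?thesis using assms smooth_on_pd smooth_on_differentiable by (subst (asm) pd_add) blast+
  qed
  show ?thesis unfolding lap_def 1[OF assms(2)] 2
    by (simp add: algebra_simps sum.distrib sum_subtractf)
qed

lemma lap_cmult:
  assumes X: "open X" and u: "u \<in> X" and L: "smooth_on X L"
  shows "lap G (\<lambda>v. a * L v) u = a * lap G L u"
proof -
  have 1: "pd k (\<lambda>v. a * L v) v = a * pd k L v" if "v \<in> X" for k v
    using smooth_on_differentiable[OF L that] by (intro pd_linear[OF bounded_linear_mult_right])
  have 2: "pd l (pd k (\<lambda>v. a * L v)) u = a * pd l (pd k L) u" for k l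
  proof -
    have "pd l (pd k (\<lambda>v. a * L v)) u = pd l (\<lambda>v. a * pd k L v) u"
      by (rule pd_cong_open[OF X u]) (rule 1)
    also have "\<dots> = a * pd l (pd k L) u"
      by (intro pd_linear[OF bounded_linear_mult_right] smooth_on_differentiable[OF smooth_on_pd[OF L] u])
    finally show ?thesis .
  qed
  show ?thesis unfolding lap_def 1[OF u] 2
    by (simp add: algebra_simps sum_distrib_left)
qed

lemma lap_cong_open:
  assumes "open X" "u \<in> X" "\<And>v. v \<in> X \<Longrightarrow> L v = M v"
  shows "lap G L u = lap G M u"
proof -
  have 1: "pd k L v = pd k M v" if "v \<in> X" for k v
    by (rule pd_cong_open[OF assms(1) that assms(3)])
  have "pd l (pd k L) u = pd l (pd k M) u" for k l
    by (rule pd_cong_open[OF assms(1,2) 1])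
  then show ?thesis unfolding lap_def 1[OF assms(2)] by simp
qed

lemma sectional_cong_open:
  assumes "open X" "u \<in> X" "\<And>v. v \<in> X \<Longrightarrow> G v = G' v"
  shows "sectional G u V W = sectional G' u V W"
proof -
  have "pd k (\<lambda>v. G v $ i $ j) v = pd k (\<lambda>v. G' v $ i $ j) v" if "v \<in> X" for i j k v
    by (rule pd_cong_open[OF assms(1) that]) (simp add: assms(3))
  then have 1: "christoffel G v k i j = christoffel G' v k i j" if "v \<in> X" for v i j k
    using that by (simp add: christoffel_def assms(3))
  have "pd l (\<lambda>v. christoffel G v k i j) u = pd l (\<lambda>v. christoffel G' v k i j) u" for i j k l
    by (rule pd_cong_open[OF assms(1,2) 1])
  then have "riemann G u V W W = riemann G' u V W W"
    unfolding riemann_def riemann_coeff_def 1[OF assms(2)] by simp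
  then show ?thesis unfolding sectional_def by (simp add: assms)
qed

text \<open>The two cross terms of the product rule agree by symmetry of the inverse metric, hence
  the factor 2.\<close>

lemma lap_mult:
  assumes X: "open X" and u: "u \<in> X" and L: "smooth_on X L" and M: "smooth_on X M"
    and sym: "\<And>i j. matrix_inv (G u) $ i $ j = matrix_inv (G u) $ j $ i"
  shows "lap G (\<lambda>v. L v * M v) u = L u * lap G M u + M u * lap G L u + 2 * gprod G L M u"
proof -
  have df: "L differentiable (at v)" "M differentiable (at v)" "pd i L differentiable (at v)" "pd i M differentiable (at v)"
    if "v \<in> X" for v i
    using L M smooth_on_differentiable[OF _ that] smooth_on_pd by blast+
  have 1: "pd k (\<lambda>v. L v * M v) v = L v * pd k M v + pd k L v * M v" if "v \<in> X" for k v
    by (intro pd_mult df that)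
  have 2: "pd l (pd k (\<lambda>v. L v * M v)) u = L u * pd l (pd k M) u + pd l L u * pd k M u + (pd k L u * pd l M u + pd l (pd k L) u * M u)" for k l
  proof -
    have "pd l (pd k (\<lambda>v. L v * M v)) u = pd l (\<lambda>v. L v * pd k M v + pd k L v * M v) u"
      by (rule pd_cong_open[OF X u]) (rule 1)
    then show ?thesis using df[OF u] by (simp add: pd_add pd_mult differentiable_mult)
  qed
  have g: "gprod G L M u = (\<Sum>i\<in>UNIV. \<Sum>j\<in>UNIV. matrix_inv (G u) $ i $ j * pd j L u * pd i M u)"
    unfolding gprod_def by (subst sum.swap) (simp add: sym)
  have "lap G (\<lambda>v. L v * M v) u = L u * lap G M u + M u * lap G L u + (gprod G L M u + gprod G L M u)"
    unfolding lap_def 1[OF u] 2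
    by (subst (2) g, unfold gprod_def) (simp add: algebra_simps sum.distrib sum_subtractf sum_distrib_left)
  then show ?thesis by simp
qed

lemma lap_real_chain:
  assumes X: "open X" and u: "u \<in> X" and L: "smooth_on X L" "L ` X \<subseteq> Y"
    and m: "\<And>y. y \<in> Y \<Longrightarrow> (m has_real_derivative m' y) (at y)" "\<And>y. y \<in> Y \<Longrightarrow> (m' has_real_derivative m'' y) (at y)"
  shows "lap G (\<lambda>v. m (L v)) u = m' (L u) * lap G L u + m'' (L u) * gprod G L L u"
proof -
  have df: "L differentiable (at v)" "pd i L differentiable (at v)" "L v \<in> Y" if "v \<in> X" for v i
    using L smooth_on_differentiable[OF _ that] smooth_on_pd that by blast+
  have 1: "pd k (\<lambda>v. m (L v)) v = m' (L v) * pd k L v" if "v \<in> X" for k v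
    using df[OF that] m by (intro pd_real_chain) auto
  have 2: "pd l (pd k (\<lambda>v. m (L v))) u = m' (L u) * pd l (pd k L) u + m'' (L u) * pd l L u * pd k L u" for k l
  proof -
    have "pd l (pd k (\<lambda>v. m (L v))) u = pd l (\<lambda>v. m' (L v) * pd k L v) u"
      by (rule pd_cong_open[OF X u]) (rule 1)
    moreover have "pd l (\<lambda>v. m' (L v)) u = m'' (L u) * pd l L u"
      using df[OF u] m by (intro pd_real_chain) auto
    moreover have "(\<lambda>v. m' (L v)) differentiable (at u)"
      using differentiable_compose[of m' L u UNIV] m(2) df[OF u] real_differentiable_def
      by (meson differentiable_chain_at has_field_derivative_at_within field_differentiable_imp_differentiable
        field_differentiable_def o_def differentiable_compose)
    ultimately show ?thesis using df[OF u] by (simp add: pd_mult)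
  qed
  show ?thesis unfolding lap_def gprod_def 1[OF u] 2
    by (simp add: algebra_simps sum.distrib sum_subtractf sum_distrib_left)
qed

section \<open>Covariant derivatives along maps\<close>

lemma pd_symmetric_vec:
  fixes G :: "real^'m \<Rightarrow> real^'n"
  assumes X: "open X" and G: "smooth_on X G" and u: "u \<in> X"
  shows "pd i (pd j G) u = pd j (pd i G) u"
proof -
  have "pd i (pd j G) u $ a = pd j (pd i G) u $ a" for a
  proof -
    have c: "smooth_on X (\<lambda>u. G u $ a)" by (intro smooth_on_vec_nth X G)
    have p: "pd i (pd j (\<lambda>u. G u $ a)) u = pd i (pd j G) u $ a" for i j
    proof -
      have "pd i (pd j (\<lambda>u. G u $ a)) u = pd i (\<lambda>u. pd j G u $ a) u"
        by (rule pd_cong_open[OF X u]) (rule pd_vec_nth, rule smooth_on_differentiable[OF G])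
      also have "\<dots> = pd i (pd j G) u $ a"
        by (rule pd_vec_nth) (rule smooth_on_differentiable[OF smooth_on_pd[OF G] u])
      finally show ?thesis .
    qed
    show ?thesis using pd_symmetric[OF X c u, of i j] unfolding p .
  qed
  then show ?thesis by (simp add: vec_eq_iff)
qed

lemma ginner_sum: "ginner Q V W = (\<Sum>i\<in>UNIV. \<Sum>j\<in>UNIV. Q $ i $ j * V $ i * W $ j)"
  by (simp add: ginner_def inner_vec_def matrix_vector_mult_def sum_distrib_left mult.assoc mult.left_commute)

lemma ginner_simps:
  "ginner Q (V + V') W = ginner Q V W + ginner Q V' W"
  "ginner Q V (W + W') = ginner Q V W + ginner Q V W'"
  "ginner Q (V - V') W = ginner Q V W - ginner Q V' W"
  "ginner Q V (W - W') = ginner Q V W - ginner Q V W'"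
  "ginner Q (- V) W = - ginner Q V W"
  "ginner Q V (- W) = - ginner Q V W"
  "ginner Q (a *\<^sub>R V) W = a * ginner Q V W"
  "ginner Q V (a *\<^sub>R W) = a * ginner Q V W"
  "ginner Q 0 W = 0" "ginner Q V 0 = 0"
  using matrix_vector_mult_scaleR[of Q "-1" W]
  by (simp_all add: ginner_def inner_simps matrix_vector_right_distrib matrix_vector_mult_diff_distrib
      matrix_vector_mult_scaleR)

lemma ginner_commute: "transpose Q = Q \<Longrightarrow> ginner Q V W = ginner Q W V"
  unfolding ginner_def by (metis dot_lmul_matrix inner_commute transpose_matrix_vector)

definition gam :: "(real^'n \<Rightarrow> real^'n^'n) \<Rightarrow> real^'n \<Rightarrow> real^'n \<Rightarrow> real^'n \<Rightarrow> real^'n" where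
  "gam H y V W = (\<chi> a. \<Sum>b\<in>UNIV. \<Sum>d\<in>UNIV. christoffel H y a b d * V $ b * W $ d)"

definition dgam :: "(real^'n \<Rightarrow> real^'n^'n) \<Rightarrow> real^'n \<Rightarrow> real^'n \<Rightarrow> real^'n \<Rightarrow> real^'n \<Rightarrow> real^'n" where
  "dgam H y U V W = (\<chi> a. \<Sum>b\<in>UNIV. \<Sum>d\<in>UNIV.
     (\<Sum>c\<in>UNIV. U $ c * pd c (\<lambda>z. christoffel H z a b d) y) * V $ b * W $ d)"

text \<open>The Levi-Civita connection of \<open>H\<close> pulled back by \<open>F\<close>. It is
  \<open>cov_deriv_along\<close> freed from charts, and it applies also to auxiliary maps such as
  planes in the ambient coordinates.\<close>

definition cov :: "(real^'n \<Rightarrow> real^'n^'n) \<Rightarrow> (real^'m \<Rightarrow> real^'n) \<Rightarrow> (real^'m \<Rightarrow> real^'n) \<Rightarrow> 'm \<Rightarrow> real^'m \<Rightarrow> real^'n" where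
  "cov H F V i u = pd i V u + gam H (F u) (pd i F u) (V u)"

lemma gam_simps:
  "gam H y (V + V') W = gam H y V W + gam H y V' W"
  "gam H y V (W + W') = gam H y V W + gam H y V W'"
  "gam H y (V - V') W = gam H y V W - gam H y V' W"
  "gam H y V (W - W') = gam H y V W - gam H y V W'"
  "gam H y (a *\<^sub>R V) W = a *\<^sub>R gam H y V W"
  "gam H y V (a *\<^sub>R W) = a *\<^sub>R gam H y V W"
  by (simp_all add: gam_def vec_eq_iff distrib_left distrib_right right_diff_distrib left_diff_distrib
      sum.distrib sum_subtractf sum_distrib_left mult.assoc mult.left_commute)

text \<open>In vector form the curvature is an alternated derivative plus a commutator of
  \<open>gam\<close>. The labour lies in reordering finite sums; skew symmetry in the first pair and
  the Bianchi identity can then be read off.\<close>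

lemma riemann_gam:
  "riemann H y A B C = dgam H y A B C - dgam H y B A C + gam H y A (gam H y B C) - gam H y B (gam H y A C)"
proof -
  have "(\<Sum>i\<in>UNIV. \<Sum>j\<in>UNIV. \<Sum>k\<in>UNIV. pd i (\<lambda>v. christoffel H v l j k) y * A $ i * B $ j * C $ k)
     = dgam H y A B C $ l" for A B l
  proof -
    have "dgam H y A B C $ l = (\<Sum>j\<in>UNIV. \<Sum>k\<in>UNIV. \<Sum>i\<in>UNIV. pd i (\<lambda>v. christoffel H v l j k) y * A $ i * B $ j * C $ k)"
      by (simp add: dgam_def sum_distrib_right sum_distrib_left mult.assoc mult.left_commute)
    also have "\<dots> = (\<Sum>j\<in>UNIV. \<Sum>i\<in>UNIV. \<Sum>k\<in>UNIV. pd i (\<lambda>v. christoffel H v l j k) y * A $ i * B $ j * C $ k)"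
      by (rule sum.cong[OF refl], rule sum.swap)
    also have "\<dots> = (\<Sum>i\<in>UNIV. \<Sum>j\<in>UNIV. \<Sum>k\<in>UNIV. pd i (\<lambda>v. christoffel H v l j k) y * A $ i * B $ j * C $ k)"
      by (rule sum.swap)
    finally show ?thesis by simp
  qed
  note 1 = this
  have 2: "(\<Sum>i\<in>UNIV. \<Sum>j\<in>UNIV. \<Sum>k\<in>UNIV. pd j (\<lambda>v. christoffel H v l i k) y * A $ i * B $ j * C $ k)
     = dgam H y B A C $ l" for l
    unfolding 1[symmetric] by (rule trans[OF sum.swap]) (simp add: mult.assoc mult.left_commute)
  have 3: "(\<Sum>i\<in>UNIV. \<Sum>j\<in>UNIV. \<Sum>k\<in>UNIV. \<Sum>m\<in>UNIV. christoffel H y l i m * christoffel H y m j k * A $ i * B $ j * C $ k)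
     = gam H y A (gam H y B C) $ l" for A B l
  proof -
    have "gam H y A (gam H y B C) $ l = (\<Sum>i\<in>UNIV. \<Sum>m\<in>UNIV. \<Sum>j\<in>UNIV. \<Sum>k\<in>UNIV.
        christoffel H y l i m * christoffel H y m j k * A $ i * B $ j * C $ k)"
      by (simp add: gam_def sum_distrib_right sum_distrib_left mult.assoc mult.left_commute)
    also have "\<dots> = (\<Sum>i\<in>UNIV. \<Sum>j\<in>UNIV. \<Sum>m\<in>UNIV. \<Sum>k\<in>UNIV.
        christoffel H y l i m * christoffel H y m j k * A $ i * B $ j * C $ k)"
      by (rule sum.cong[OF refl], rule sum.swap)
    also have "\<dots> = (\<Sum>i\<in>UNIV. \<Sum>j\<in>UNIV. \<Sum>k\<in>UNIV. \<Sum>m\<in>UNIV.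
        christoffel H y l i m * christoffel H y m j k * A $ i * B $ j * C $ k)"
      by (rule sum.cong[OF refl], rule sum.cong[OF refl], rule sum.swap)
    finally show ?thesis by simp
  qed
  have 4: "(\<Sum>i\<in>UNIV. \<Sum>j\<in>UNIV. \<Sum>k\<in>UNIV. \<Sum>m\<in>UNIV. christoffel H y l j m * christoffel H y m i k * A $ i * B $ j * C $ k)
     = gam H y B (gam H y A C) $ l" for l
    unfolding 3[symmetric] by (rule trans[OF sum.swap]) (simp add: mult.assoc mult.left_commute)
  have "riemann H y A B C $ l =
    (\<Sum>i\<in>UNIV. \<Sum>j\<in>UNIV. \<Sum>k\<in>UNIV. pd i (\<lambda>v. christoffel H v l j k) y * A $ i * B $ j * C $ k)
    - (\<Sum>i\<in>UNIV. \<Sum>j\<in>UNIV. \<Sum>k\<in>UNIV. pd j (\<lambda>v. christoffel H v l i k) y * A $ i * B $ j * C $ k)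
    + (\<Sum>i\<in>UNIV. \<Sum>j\<in>UNIV. \<Sum>k\<in>UNIV. \<Sum>m\<in>UNIV. christoffel H y l i m * christoffel H y m j k * A $ i * B $ j * C $ k)
    - (\<Sum>i\<in>UNIV. \<Sum>j\<in>UNIV. \<Sum>k\<in>UNIV. \<Sum>m\<in>UNIV. christoffel H y l j m * christoffel H y m i k * A $ i * B $ j * C $ k)" for l
    by (simp add: riemann_def riemann_coeff_def left_diff_distrib distrib_right sum.distrib
      sum_subtractf sum_distrib_right)
  then show ?thesis unfolding 1 2 3 4 by (simp add: vec_eq_iff)
qed

section \<open>Symmetry of the connection, first Bianchi identity and metric compatibility\<close>

context
  fixes Y and H :: "real^'n \<Rightarrow> real^'n^'n"
  assumes H: "metric_on Y H"
begin

lemma metric_commute: "y \<in> Y \<Longrightarrow> ginner (H y) V W = ginner (H y) W V"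
  by (rule ginner_commute) (rule metric_transpose[OF H])

lemma gam_sym:
  assumes "y \<in> Y"
  shows "gam H y V W = gam H y W V"
  unfolding gam_def vec_eq_iff
  by (subst sum.swap) (simp add: christoffel_sym[OF H assms] mult.assoc mult.left_commute mult.commute)

lemma dgam_sym:
  assumes "y \<in> Y"
  shows "dgam H y U V W = dgam H y U W V"
proof -
  have "pd c (\<lambda>z. christoffel H z a b d) y = pd c (\<lambda>z. christoffel H z a d b) y" for a b c d
    by (rule pd_cong_open[OF metric_open[OF H] assms]) (rule christoffel_sym[OF H])
  then show ?thesis
    unfolding dgam_def vec_eq_iff
    by (subst sum.swap) (simp add: mult.assoc mult.left_commute mult.commute)
qed

lemma riemann_antisym12: "riemann H y A B C = - riemann H y B A C"
  unfolding riemann_gam by simp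

text \<open>By the symmetry of \<open>gam\<close> and \<open>dgam\<close> every term of the cyclic
  sum meets its negative.\<close>

lemma riemann_bianchi: "y \<in> Y \<Longrightarrow> riemann H y A B C + riemann H y B C A + riemann H y C A B = 0"
  unfolding riemann_gam
  by (simp add: dgam_sym[of y A C B] dgam_sym[of y B A C] dgam_sym[of y C B A]
      gam_sym[of y C B] gam_sym[of y C A] gam_sym[of y B A])

text \<open>The chain rule reduces the derivative of the metric along \<open>F\<close> to
  \<open>pd_metric\<close>, contracted with the velocity of \<open>F\<close>.\<close>

lemma pd_metric_along:
  fixes F :: "real^'m \<Rightarrow> real^'n"
  assumes F: "F differentiable (at u)" and y: "F u \<in> Y"
  shows "ginner (pd i (\<lambda>v. H (F v)) u) V W =
    ginner (H (F u)) (gam H (F u) (pd i F u) V) W + ginner (H (F u)) V (gam H (F u) (pd i F u) W)"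
proof -
  let ?Z = "pd i F u" and ?C = "christoffel H (F u)" and ?H = "H (F u)"
  have Hd: "H differentiable (at (F u))" using smooth_on_differentiable[OF metric_smooth[OF H] y] .
  have HF: "(\<lambda>v. H (F v)) differentiable (at u)"
    using differentiable_chain_at[OF F Hd] by (simp add: o_def)
  have pdH: "pd i (\<lambda>v. H (F v)) u $ a $ b = (\<Sum>l\<in>UNIV. ?Z $ l * ((\<Sum>k\<in>UNIV. ?H $ a $ k * ?C k l b) + (\<Sum>k\<in>UNIV. ?H $ b $ k * ?C k l a)))" for a b
  proof -
    have "pd i (\<lambda>v. H (F v)) u $ a $ b = (\<Sum>l\<in>UNIV. ?Z $ l * (pd l H (F u) $ a $ b))"
      by (simp add: pd_chain[OF F Hd] sum_component)
    also have "\<dots> = (\<Sum>l\<in>UNIV. ?Z $ l * pd l (\<lambda>y. H y $ a $ b) (F u))"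
    proof -
      have "(\<lambda>y. H y $ a) differentiable (at (F u))"
        using smooth_on_differentiable[OF smooth_on_vec_nth[OF metric_open[OF H] metric_smooth[OF H]] y] .
      then show ?thesis using Hd by (simp add: pd_vec_nth)
    qed
    finally show ?thesis by (simp only: pd_metric[OF H y])
  qed
  have A: "(\<Sum>a\<in>UNIV. \<Sum>b\<in>UNIV. (\<Sum>l\<in>UNIV. ?Z $ l * (\<Sum>k\<in>UNIV. ?H $ a $ k * ?C k l b)) * V $ a * W $ b)
     = ginner ?H V (gam H (F u) ?Z W)" for V W
  proof -
    have "ginner ?H V (gam H (F u) ?Z W) = (\<Sum>a\<in>UNIV. \<Sum>k\<in>UNIV. \<Sum>l\<in>UNIV. \<Sum>b\<in>UNIV. ?H $ a $ k * ?C k l b * ?Z $ l * V $ a * W $ b)"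
      by (simp add: ginner_sum gam_def sum_distrib_left sum_distrib_right mult.assoc mult.left_commute)
    also have "\<dots> = (\<Sum>a\<in>UNIV. \<Sum>l\<in>UNIV. \<Sum>k\<in>UNIV. \<Sum>b\<in>UNIV. ?H $ a $ k * ?C k l b * ?Z $ l * V $ a * W $ b)"
      by (rule sum.cong[OF refl], rule sum.swap)
    also have "\<dots> = (\<Sum>a\<in>UNIV. \<Sum>l\<in>UNIV. \<Sum>b\<in>UNIV. \<Sum>k\<in>UNIV. ?H $ a $ k * ?C k l b * ?Z $ l * V $ a * W $ b)"
      by (rule sum.cong[OF refl], rule sum.cong[OF refl], rule sum.swap)
    also have "\<dots> = (\<Sum>a\<in>UNIV. \<Sum>b\<in>UNIV. \<Sum>l\<in>UNIV. \<Sum>k\<in>UNIV. ?H $ a $ k * ?C k l b * ?Z $ l * V $ a * W $ b)"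
      by (rule sum.cong[OF refl], rule sum.swap)
    finally show ?thesis by (simp add: sum_distrib_left sum_distrib_right mult.assoc mult.left_commute)
  qed
  have B: "(\<Sum>a\<in>UNIV. \<Sum>b\<in>UNIV. (\<Sum>l\<in>UNIV. ?Z $ l * (\<Sum>k\<in>UNIV. ?H $ b $ k * ?C k l a)) * V $ a * W $ b)
     = ginner ?H (gam H (F u) ?Z V) W"
    unfolding metric_commute[OF y, of "gam H (F u) ?Z V" W] A[symmetric]
    by (rule trans[OF sum.swap]) (simp add: mult.assoc mult.commute mult.left_commute)
  have "ginner (pd i (\<lambda>v. H (F v)) u) V W =
      (\<Sum>a\<in>UNIV. \<Sum>b\<in>UNIV. (\<Sum>l\<in>UNIV. ?Z $ l * (\<Sum>k\<in>UNIV. ?H $ a $ k * ?C k l b)) * V $ a * W $ b)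
    + (\<Sum>a\<in>UNIV. \<Sum>b\<in>UNIV. (\<Sum>l\<in>UNIV. ?Z $ l * (\<Sum>k\<in>UNIV. ?H $ b $ k * ?C k l a)) * V $ a * W $ b)"
    unfolding ginner_sum pdH by (simp add: distrib_left distrib_right sum.distrib)
  then show ?thesis unfolding A B by simp
qed

end

lemma differentiable_vec_nth: "F differentiable (at u) \<Longrightarrow> (\<lambda>v. F v $ a) differentiable (at u)"
  unfolding differentiable_def using bounded_linear.has_derivative[OF bounded_linear_vec_nth] by blast

lemma pd_ginner:
  fixes Q :: "real^'m \<Rightarrow> real^'n^'n"
  assumes "Q differentiable (at u)" "V differentiable (at u)" "W differentiable (at u)"
  shows "pd i (\<lambda>v. ginner (Q v) (V v) (W v)) u =
    ginner (pd i Q u) (V u) (W u) + ginner (Q u) (pd i V u) (W u) + ginner (Q u) (V u) (pd i W u)"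
proof -
  have d: "(\<lambda>v. Q v $ a) differentiable (at u)" "(\<lambda>v. Q v $ a $ b) differentiable (at u)"
    "(\<lambda>v. V v $ a) differentiable (at u)" "(\<lambda>v. W v $ a) differentiable (at u)" for a b
    using assms by (auto intro!: differentiable_vec_nth)
  show ?thesis
    unfolding ginner_sum
    by (simp add: pd_sum pd_mult pd_vec_nth assms d differentiable_mult differentiable_sum
      algebra_simps sum.distrib)
qed

lemma ginner_smooth:
  fixes Q :: "real^'m \<Rightarrow> real^'n^'n"
  assumes "open X" "smooth_on X Q" "smooth_on X V" "smooth_on X W"
  shows "smooth_on X (\<lambda>v. ginner (Q v) (V v) (W v))"
  unfolding ginner_sum by (intro smooth_on_sum smooth_on_mult smooth_on_vec_nth assms)

context
  fixes Y and H :: "real^'n \<Rightarrow> real^'n^'n" and X and F :: "real^'m \<Rightarrow> real^'n"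
  assumes H: "metric_on Y H" and X: "open X" and F: "smooth_on X F" and FX: "F ` X \<subseteq> Y"
begin

lemma christoffel_along_smooth: "smooth_on X (\<lambda>u. christoffel H (F u) a b d)"
  by (rule smooth_on_compose[OF X metric_open[OF H] F christoffel_smooth[OF H] FX])

lemma metric_along_smooth: "smooth_on X (\<lambda>u. H (F u))"
  by (rule smooth_on_compose[OF X metric_open[OF H] F metric_smooth[OF H] FX])

lemma gam_along_smooth:
  assumes "smooth_on X V" "smooth_on X W"
  shows "smooth_on X (\<lambda>u. gam H (F u) (V u) (W u))"
  unfolding gam_def
  by (intro smooth_on_vec_lambda smooth_on_sum smooth_on_mult smooth_on_vec_nth christoffel_along_smooth X assms)

lemma cov_smooth: "smooth_on X V \<Longrightarrow> smooth_on X (cov H F V i)"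
  unfolding cov_def[abs_def] by (intro smooth_on_add gam_along_smooth smooth_on_pd F X)

lemma cov_metric:
  assumes V: "smooth_on X V" and W: "smooth_on X W" and u: "u \<in> X"
  shows "pd i (\<lambda>v. ginner (H (F v)) (V v) (W v)) u =
    ginner (H (F u)) (cov H F V i u) (W u) + ginner (H (F u)) (V u) (cov H F W i u)"
proof -
  have d: "(\<lambda>v. H (F v)) differentiable (at u)" "V differentiable (at u)" "W differentiable (at u)" "F differentiable (at u)"
    using smooth_on_differentiable[OF _ u] metric_along_smooth V W F by blast+
  have "F u \<in> Y" using FX u by auto
  then show ?thesis
    unfolding pd_ginner[OF d(1,2,3)] cov_def by (simp add: pd_metric_along[OF H d(4)] ginner_simps)
qed

lemma cov_torsion_free:
  assumes u: "u \<in> X"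
  shows "cov H F (pd j F) i u = cov H F (pd i F) j u"
proof -
  have y: "F u \<in> Y" using FX u by auto
  have "pd i (pd j F) u = pd j (pd i F) u" by (rule pd_symmetric_vec[OF X F u])
  then show ?thesis unfolding cov_def by (simp add: gam_sym[OF H y, of "pd i F u"])
qed

lemma pd_gam_along:
  assumes V: "smooth_on X V" and W: "smooth_on X W" and u: "u \<in> X"
  shows "pd i (\<lambda>v. gam H (F v) (V v) (W v)) u = dgam H (F u) (pd i F u) (V u) (W u)
    + gam H (F u) (pd i V u) (W u) + gam H (F u) (V u) (pd i W u)"
proof -
  have y: "F u \<in> Y" using FX u by auto
  have d: "F differentiable (at u)" "V differentiable (at u)" "W differentiable (at u)"
    "(\<lambda>v. V v $ a) differentiable (at u)" "(\<lambda>v. W v $ a) differentiable (at u)"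
    "(\<lambda>v. christoffel H (F v) a b d) differentiable (at u)"
    "(\<lambda>y. christoffel H y a b d) differentiable (at (F u))"
    "(\<lambda>v. gam H (F v) (V v) (W v)) differentiable (at u)" for a b d
    using smooth_on_differentiable[OF _ u] smooth_on_differentiable[OF christoffel_smooth[OF H] y]
      V W F christoffel_along_smooth gam_along_smooth[OF V W] smooth_on_vec_nth[OF X] by blast+
  have "pd i (\<lambda>v. gam H (F v) (V v) (W v)) u $ a = (dgam H (F u) (pd i F u) (V u) (W u)
    + gam H (F u) (pd i V u) (W u) + gam H (F u) (V u) (pd i W u)) $ a" for a
  proof -
    have "pd i (\<lambda>v. gam H (F v) (V v) (W v)) u $ a = pd i (\<lambda>v. gam H (F v) (V v) (W v) $ a) u"
      by (rule pd_vec_nth[symmetric]) (rule d)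
    also have "\<dots> = pd i (\<lambda>v. \<Sum>b\<in>UNIV. \<Sum>e\<in>UNIV. christoffel H (F v) a b e * V v $ b * W v $ e) u"
      by (simp add: gam_def)
    also have "\<dots> = (dgam H (F u) (pd i F u) (V u) (W u)
      + gam H (F u) (pd i V u) (W u) + gam H (F u) (V u) (pd i W u)) $ a"
      by (simp add: pd_sum pd_mult d differentiable_mult differentiable_sum pd_vec_nth
        pd_chain[OF d(1) d(7)] gam_def dgam_def distrib_left distrib_right sum.distrib add.commute add.left_commute
        mult.assoc mult.left_commute)
    finally show ?thesis .
  qed
  then show ?thesis by (simp add: vec_eq_iff)
qed

text \<open>A second covariant derivative consists of second partial derivatives of \<open>V\<close>
  and \<open>F\<close>, which commute, of mixed first-order terms, which are symmetric in
  \<open>i\<close> and \<open>j\<close>, and of the terms of \<open>riemann_gam\<close>.\<close>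

lemma cov_commutator:
  assumes V: "smooth_on X V" and u: "u \<in> X"
  shows "cov H F (cov H F V j) i u - cov H F (cov H F V i) j u = riemann H (F u) (pd i F u) (pd j F u) (V u)"
proof -
  have second: "cov H F (cov H F V j) i u = pd i (pd j V) u + dgam H (F u) (pd i F u) (pd j F u) (V u)
    + gam H (F u) (pd i (pd j F) u) (V u) + gam H (F u) (pd j F u) (pd i V u)
    + gam H (F u) (pd i F u) (pd j V u) + gam H (F u) (pd i F u) (gam H (F u) (pd j F u) (V u))" for i j
  proof -
    have "pd i (cov H F V j) u = pd i (pd j V) u + pd i (\<lambda>v. gam H (F v) (pd j F v) (V v)) u"
      unfolding cov_def[abs_def]
      by (intro pd_add smooth_on_differentiable[OF _ u] smooth_on_pd V gam_along_smooth F)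
    then show ?thesis
      unfolding cov_def[of H F "cov H F V j"] pd_gam_along[OF smooth_on_pd[OF F] V u]
      by (simp add: cov_def gam_simps)
  qed
  show ?thesis unfolding second pd_symmetric_vec[OF X V u, of i j] pd_symmetric_vec[OF X F u, of i j] riemann_gam by simp
qed

end

text \<open>On a plane through \<open>y\<close> with velocities \<open>A\<close> and
  \<open>B\<close> the second partial derivatives of the function h(C, D) commute. By metric
  compatibility this says that the curvature terms of the constant fields \<open>C\<close> and
  \<open>D\<close> cancel.\<close>

lemma riemann_antisym34:
  fixes H :: "real^'n \<Rightarrow> real^'n^'n"
  assumes H: "metric_on Y H" and y: "y \<in> Y"
  shows "ginner (H y) (riemann H y A B C) D = - ginner (H y) (riemann H y A B D) C"
proof -
  define F :: "real^2 \<Rightarrow> real^'n" where "F = (\<lambda>s. y + s $ 1 *\<^sub>R A + s $ 2 *\<^sub>R B)"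
  have Fsm: "smooth_on UNIV F" unfolding F_def
    by (intro smooth_on_add smooth_on_const smooth_on_scaleR smooth_on_vec_nth smooth_on_id) auto
  define X where "X = F -` Y"
  have X: "open X" unfolding X_def
    by (rule open_vimage[OF metric_open[OF H] smooth_on_continuous[OF Fsm]])
  have F: "smooth_on X F" using Fsm smooth_on_subset by blast
  have FX: "F ` X \<subseteq> Y" unfolding X_def by auto
  have 0: "(0::real^2) \<in> X" using y by (simp add: X_def F_def)
  have dF: "pd i F u = axis i 1 $ 1 *\<^sub>R A + axis i 1 $ 2 *\<^sub>R B" for i u
    unfolding F_def
    by (rule has_derivative_pd) (auto intro!: derivative_eq_intros bounded_linear.has_derivative[OF bounded_linear_vec_nth] simp: add.commute)
  have p1: "pd 1 F 0 = A" and p2: "pd 2 F 0 = B" by (simp_all add: dF axis_def)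
  have F0: "F 0 = y" by (simp add: F_def)
  let ?C = "\<lambda>u::real^2. C" and ?D = "\<lambda>u::real^2. D"
  note sm = smooth_on_const[of X C] smooth_on_const[of X D]
  let ?h = "\<lambda>u. ginner (H (F u)) C D"
  note cs = cov_smooth[OF H X F FX]
  note cm = cov_metric[OF H X F FX]
  have hsm: "smooth_on X ?h" by (intro ginner_smooth X metric_along_smooth[OF H X F FX] sm)
  have h1: "pd j ?h u = ginner (H (F u)) (cov H F ?C j u) D + ginner (H (F u)) C (cov H F ?D j u)" if "u \<in> X" for j u
    using cm[OF sm that] by simp
  have h2: "pd i (pd j ?h) 0 = ginner (H y) (cov H F (cov H F ?C j) i 0) D + ginner (H y) (cov H F ?C j 0) (cov H F ?D i 0)
     + (ginner (H y) (cov H F ?C i 0) (cov H F ?D j 0) + ginner (H y) C (cov H F (cov H F ?D j) i 0))" for i j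
  proof -
    have "pd i (pd j ?h) 0 = pd i (\<lambda>u. ginner (H (F u)) (cov H F ?C j u) (?D u) + ginner (H (F u)) (?C u) (cov H F ?D j u)) 0"
      by (rule pd_cong_open[OF X 0]) (rule h1)
    also have "\<dots> = pd i (\<lambda>u. ginner (H (F u)) (cov H F ?C j u) (?D u)) 0 + pd i (\<lambda>u. ginner (H (F u)) (?C u) (cov H F ?D j u)) 0"
      by (intro pd_add smooth_on_differentiable[OF _ 0] ginner_smooth X metric_along_smooth[OF H X F FX] sm cs)
    finally show ?thesis using cm[OF cs[OF sm(1)] sm(2) 0] cm[OF sm(1) cs[OF sm(2)] 0] by (simp add: F0)
  qed
  have "pd 1 (pd 2 ?h) 0 = pd 2 (pd 1 ?h) 0" by (rule pd_symmetric[OF X hsm 0])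
  then have "ginner (H y) (cov H F (cov H F ?C 2) 1 0 - cov H F (cov H F ?C 1) 2 0) D
     + ginner (H y) C (cov H F (cov H F ?D 2) 1 0 - cov H F (cov H F ?D 1) 2 0) = 0"
    unfolding h2 by (simp add: ginner_simps)
  then have "ginner (H y) (riemann H y A B C) D + ginner (H y) C (riemann H y A B D) = 0"
    unfolding cov_commutator[OF H X F FX sm(1) 0] cov_commutator[OF H X F FX sm(2) 0] F0 p1 p2 .
  then show ?thesis using metric_commute[OF H y, of C] by simp
qed

text \<open>The classical octahedron argument: four Bianchi identities are combined by means of the
  two skew symmetries.\<close>

lemma riemann_pair_sym:
  fixes H :: "real^'n \<Rightarrow> real^'n^'n"
  assumes H: "metric_on Y H" and y: "y \<in> Y"
  shows "ginner (H y) (riemann H y A B C) D = ginner (H y) (riemann H y C D A) B"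
proof -
  define r where "r A B C D = ginner (H y) (riemann H y A B C) D" for A B C D
  have a: "r A B C D = - r B A C D" for A B C D
    unfolding r_def by (subst riemann_antisym12[OF H]) (simp add: ginner_simps)
  have b: "r A B C D = - r A B D C" for A B C D
    unfolding r_def by (rule riemann_antisym34[OF H y])
  have c: "r A B C D + r B C A D + r C A B D = 0" for A B C D
    using arg_cong[OF riemann_bianchi[OF H y, of A B C], of "\<lambda>Z. ginner (H y) Z D"]
    by (simp add: r_def ginner_simps)
  have "r A B C D = r C D A B"
    using c[of A B C D] c[of B C D A] c[of C D A B] c[of D A B C]
      a[of A B C D] a[of A B D C] a[of B C A D] a[of B C D A] a[of C A B D] a[of C A D B]
      a[of C D A B] a[of C D B A] a[of D B C A] a[of D B A C] a[of D A B C] a[of D A C B]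
      a[of B D A C] a[of B D C A] a[of A C B D] a[of A C D B]
      b[of A B C D] b[of B C A D] b[of C A B D] b[of C D A B] b[of D B C A] b[of D A B C]
      b[of B A C D] b[of C B A D] b[of A C B D] b[of D C A B] b[of B D C A] b[of A D B C]
    by linarith
  then show ?thesis unfolding r_def .
qed

section \<open>Constant sectional curvature and orthonormal frames\<close>

lemma constant_curvature_orthogonal:
  fixes H :: "real^'n \<Rightarrow> real^'n^'n"
  assumes H: "metric_on Y H" and y: "y \<in> Y"
    and sec: "\<And>A B. A \<noteq> B \<Longrightarrow> independent {A, B} \<Longrightarrow> sectional H y A B = c"
    and AB: "A \<noteq> 0" "B \<noteq> 0" "ginner (H y) A B = 0"
  shows "ginner (H y) (riemann H y A B B) A = c * (ginner (H y) A A * ginner (H y) B B)"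
proof -
  have pos: "ginner (H y) A A > 0" "ginner (H y) B B > 0"
    using metric_pos[OF H y] AB by auto
  have "A \<notin> span {B}"
  proof
    assume "A \<in> span {B}"
    then obtain k where "A = k *\<^sub>R B" by (auto simp: span_singleton)
    then show False using AB pos by (auto simp: ginner_simps)
  qed
  then have "A \<noteq> B" "independent {A, B}" using AB by (auto simp: independent_insert span_base)
  then have "sectional H y A B = c" by (rule sec)
  then show ?thesis using pos AB unfolding sectional_def by (simp add: field_simps)
qed

text \<open>Polarisation: the planes of \<open>N\<close> with \<open>T\<close>, with
  \<open>E\<close> and with \<open>T + E\<close> have the same curvature, and the mixed term that
  this isolates is symmetric in \<open>T\<close> and \<open>E\<close> by pair symmetry. Its
  vanishing is what removes the ambient curvature from the Codazzi equations.\<close>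

lemma constant_curvature_orthonormal:
  fixes H :: "real^'n \<Rightarrow> real^'n^'n"
  assumes H: "metric_on Y H" and y: "y \<in> Y"
    and sec: "\<And>A B. A \<noteq> B \<Longrightarrow> independent {A, B} \<Longrightarrow> sectional H y A B = c"
    and on: "ginner (H y) N N = 1" "ginner (H y) T T = 1" "ginner (H y) E E = 1"
      "ginner (H y) N T = 0" "ginner (H y) N E = 0" "ginner (H y) T E = 0"
  shows "ginner (H y) (riemann H y N T T) N = c"
    and "ginner (H y) (riemann H y N T E) N = 0"
proof -
  have sym: "ginner (H y) V W = ginner (H y) W V" for V W by (rule metric_commute[OF H y])
  have nz: "N \<noteq> 0" "T \<noteq> 0" "E \<noteq> 0" using on by (auto simp: ginner_simps)
  note R = constant_curvature_orthogonal[OF H y sec]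
  show 1: "ginner (H y) (riemann H y N T T) N = c" using R[OF _ _ nz(1,2)] on by simp
  have 2: "ginner (H y) (riemann H y N E E) N = c" using R[OF _ _ nz(1,3)] on by simp
  have TE: "ginner (H y) (T + E) (T + E) = 2" "ginner (H y) N (T + E) = 0"
    using on sym[of E T] by (simp_all add: ginner_simps)
  have "T + E \<noteq> 0"
  proof
    assume "T + E = 0"
    then have "ginner (H y) (T + E) (T + E) = 0" by (simp only: ginner_simps(9))
    then show False using TE by simp
  qed
  then have 3: "ginner (H y) (riemann H y N (T + E) (T + E)) N = 2 * c" using R[OF _ _ nz(1)] on TE by simp
  have lin2: "riemann H y N (V + V') W = riemann H y N V W + riemann H y N V' W" for V V' W
    by (simp add: riemann_def vec_eq_iff distrib_left distrib_right sum.distrib)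
  have lin3: "riemann H y N V (W + W') = riemann H y N V W + riemann H y N V W'" for V W W'
    by (simp add: riemann_def vec_eq_iff distrib_left distrib_right sum.distrib)
  have "ginner (H y) (riemann H y N T E) N + ginner (H y) (riemann H y N E T) N = 0"
    using 1 2 3 by (simp add: lin2 lin3 ginner_simps)
  moreover have "ginner (H y) (riemann H y N E T) N = ginner (H y) (riemann H y N T E) N"
    using riemann_pair_sym[OF H y, of N E T N] riemann_antisym12[OF H, of y T N N]
      riemann_antisym34[OF H y, of N T N E] by (simp add: ginner_simps)
  ultimately show "ginner (H y) (riemann H y N T E) N = 0" by simp
qed

text \<open>With the frame vectors as rows of \<open>R\<close>, orthonormality gives
  \<open>R\<close> a right inverse, which for a square matrix is also a left inverse. So the
  remainder of \<open>A\<close> after projection, being orthogonal to the frame, is zero.\<close>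

lemma orthonormal_parseval_3:
  fixes Q :: "real^3^3"
  assumes Q: "transpose Q = Q" and pos: "\<And>Z. Z \<noteq> 0 \<Longrightarrow> ginner Q Z Z > 0"
    and on: "ginner Q N N = 1" "ginner Q T T = 1" "ginner Q E E = 1"
      "ginner Q N T = 0" "ginner Q N E = 0" "ginner Q T E = 0"
  shows "ginner Q A B = ginner Q A N * ginner Q B N + ginner Q A T * ginner Q B T + ginner Q A E * ginner Q B E"
proof -
  note sym = ginner_commute[OF Q]
  define Z where "Z = A - (ginner Q A N *\<^sub>R N + ginner Q A T *\<^sub>R T + ginner Q A E *\<^sub>R E)"
  have orth: "ginner Q N Z = 0" "ginner Q T Z = 0" "ginner Q E Z = 0"
    using on sym[of T N] sym[of E N] sym[of E T] sym[of N A] sym[of T A] sym[of E A]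
    by (simp_all add: Z_def ginner_simps)
  define R :: "real^3^3" where "R = (\<chi> i. if i = 1 then N else if i = 2 then T else E)"
  have R: "R $ 1 = N" "R $ 2 = T" "R $ 3 = E" by (simp_all add: R_def)
  have "(R ** (Q ** transpose R)) $ i $ j = ginner Q (R $ i) (R $ j)" for i j
    by (simp add: ginner_def inner_vec_def matrix_matrix_mult_def matrix_vector_mult_def transpose_def)
  then have "R ** (Q ** transpose R) = mat 1"
    using on sym[of T N] sym[of E N] sym[of E T] by (simp add: vec_eq_iff forall_3 R mat_def)
  then have inv: "(Q ** transpose R) ** R = mat 1" by (simp add: matrix_left_right_inverse)
  have "(R *v (Q *v Z)) $ i = ginner Q (R $ i) Z" for i
    by (simp add: ginner_def inner_vec_def matrix_vector_mult_def)
  then have "R *v (Q *v Z) = 0" using orth by (simp add: vec_eq_iff forall_3 R)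
  then have "Q *v Z = 0"
    by (metis inv matrix_vector_mul_assoc matrix_vector_mul_lid matrix_vector_mult_0_right)
  then have "Z = 0" using pos[of Z] by (force simp: ginner_def)
  then have "A = ginner Q A N *\<^sub>R N + ginner Q A T *\<^sub>R T + ginner Q A E *\<^sub>R E" by (simp add: Z_def)
  then have "ginner Q A B = ginner Q (ginner Q A N *\<^sub>R N + ginner Q A T *\<^sub>R T + ginner Q A E *\<^sub>R E) B" by simp
  also have "\<dots> = ginner Q A N * ginner Q N B + ginner Q A T * ginner Q T B + ginner Q A E * ginner Q E B"
    by (simp add: ginner_simps)
  finally show ?thesis using sym by simp
qed

section \<open>Biconservative surfaces in coordinates\<close>

text \<open>One chart of the surface and one of the ambient space: \<open>F\<close> is the
  immersion, \<open>E\<close> the unit normal, \<open>f\<close> the mean curvature, as functions of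
  the coordinates. \<open>f\<close> is a parameter tied to the shape operator by
  \<open>shape_trace\<close>; the smoothness of the actual mean curvature is settled when the locale
  is interpreted.\<close>

locale biconservative_patch =
  fixes Y and H :: "real^3 \<Rightarrow> real^3^3" and X and F :: "real^2 \<Rightarrow> real^3"
    and G :: "real^2 \<Rightarrow> real^2^2" and E :: "real^2 \<Rightarrow> real^3" and f :: "real^2 \<Rightarrow> real" and c :: real
  assumes H: "metric_on Y H"
    and curv: "\<And>y A B. y \<in> Y \<Longrightarrow> A \<noteq> B \<Longrightarrow> independent {A, B} \<Longrightarrow> sectional H y A B = c"
    and F: "smooth_on X F" and FX: "F ` X \<subseteq> Y"
    and G: "metric_on X G"
    and GF: "\<And>u i j. u \<in> X \<Longrightarrow> G u $ i $ j = ginner (H (F u)) (pd i F u) (pd j F u)"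
    and E: "smooth_on X E"
    and EE: "\<And>u. u \<in> X \<Longrightarrow> ginner (H (F u)) (E u) (E u) = 1"
    and EF: "\<And>u i. u \<in> X \<Longrightarrow> ginner (H (F u)) (E u) (pd i F u) = 0"
    and f: "smooth_on X f" and f_pos: "\<And>u. u \<in> X \<Longrightarrow> f u > 0"
    and shape_trace: "\<And>u. u \<in> X \<Longrightarrow>
      trace (matrix_inv (G u) ** (\<chi> j i. - ginner (H (F u)) (cov H F E i u) (pd j F u))) = f u"
    and shape_grad: "\<And>u. u \<in> X \<Longrightarrow>
      (matrix_inv (G u) ** (\<chi> j i. - ginner (H (F u)) (cov H F E i u) (pd j F u))) *v
        (matrix_inv (G u) *v (\<chi> j. pd j f u)) = - (f u / 2) *\<^sub>R (matrix_inv (G u) *v (\<chi> j. pd j f u))"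
    and grad_nz: "\<And>u. u \<in> X \<Longrightarrow> matrix_inv (G u) *v (\<chi> j. pd j f u) \<noteq> 0"
begin

lemma X: "open X" by (rule metric_open[OF G])

definition rd where "rd u = sqrt (gdet G u)"
definition nf where "nf u = sqrt (gprod G f f u)"
definition n where "n i u = pd i f u / nf u" for i :: 2
text \<open>\<open>t1\<close> and \<open>t2\<close> are the components of the Hodge star of the unit
  form \<open>n\<close>; they have the shape of the quotients in
  \<open>lap_divergence\<close>.\<close>

definition t1 where "t1 u = (G u $ 1 $ 2 * n 1 u - G u $ 1 $ 1 * n 2 u) / rd u"
definition t2 where "t2 u = (G u $ 2 $ 2 * n 1 u - G u $ 1 $ 2 * n 2 u) / rd u"
text \<open>Cramer's rule for the frame dual to the coframe: \<open>N\<close> and \<open>T\<close>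
  are the solution of the two equations of \<open>F_frame\<close>, whose determinant is
  \<open>rd\<close> by \<open>n_t\<close>.\<close>

definition N where "N u = inverse (rd u) *\<^sub>R (t2 u *\<^sub>R pd 1 F u - t1 u *\<^sub>R pd 2 F u)"
definition T where "T u = inverse (rd u) *\<^sub>R (n 1 u *\<^sub>R pd 2 F u - n 2 u *\<^sub>R pd 1 F u)"

abbreviation "ip u V W \<equiv> ginner (H (F u)) V W"
abbreviation "D i V u \<equiv> cov H F V i u"

lemma rd_pos: "u \<in> X \<Longrightarrow> rd u > 0"
  unfolding rd_def using gdet_pos(1)[OF G] by simp

lemma rd_sq: "u \<in> X \<Longrightarrow> rd u * rd u = G u $ 1 $ 1 * G u $ 2 $ 2 - (G u $ 1 $ 2)\<^sup>2"
  unfolding rd_def using gdet_pos(1)[OF G, of u] by (simp add: gdet_def)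

lemma gprod_2:
  assumes u: "u \<in> X"
  shows "gprod G L M u * gdet G u = G u $ 2 $ 2 * pd 1 L u * pd 1 M u
    - G u $ 1 $ 2 * (pd 1 L u * pd 2 M u + pd 2 L u * pd 1 M u) + G u $ 1 $ 1 * pd 2 L u * pd 2 M u"
  using gdet_pos(1)[OF G u] unfolding gprod_def sum_2 metric_inv_2[OF G u] by (simp add: field_simps)

lemma metric_inv_sym:
  assumes "u \<in> X"
  shows "matrix_inv (G u) $ i $ j = matrix_inv (G u) $ j $ i"
  using metric_inv_2[OF G assms] exhaust_2[of i] exhaust_2[of j] by auto

lemma gprod_grad:
  assumes u: "u \<in> X"
  shows "gprod G L M u = ginner (G u) (matrix_inv (G u) *v (\<chi> j. pd j L u)) (matrix_inv (G u) *v (\<chi> j. pd j M u))"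
proof -
  have "G u *v (matrix_inv (G u) *v (\<chi> j. pd j M u)) = (\<chi> j. pd j M u)"
    using matrix_inv_inverse(1)[OF metric_invertible[OF G u]] by (simp add: matrix_vector_mul_assoc)
  then show ?thesis
    unfolding gprod_def ginner_def
    by (simp add: inner_vec_def matrix_vector_mult_def sum_2 metric_inv_sym[OF u, of 2 1] algebra_simps)
qed

lemma nf_pos: "u \<in> X \<Longrightarrow> nf u > 0"
  unfolding nf_def using gprod_grad metric_pos[OF G _ grad_nz] by simp

lemma nf_sq: "u \<in> X \<Longrightarrow> nf u * nf u = gprod G f f u"
  unfolding nf_def using gprod_grad metric_pos[OF G _ grad_nz, of u u] by simp

lemma pd_f: "u \<in> X \<Longrightarrow> pd i f u = nf u * n i u"
  unfolding n_def using nf_pos[of u] by simp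

lemma gprod_smooth: "smooth_on X L \<Longrightarrow> smooth_on X M \<Longrightarrow> smooth_on X (gprod G L M)"
  unfolding gprod_def[abs_def]
  by (intro smooth_on_sum smooth_on_mult smooth_on_vec_nth smooth_on_pd metric_inv_smooth[OF G] X)

lemma rd_smooth: "smooth_on X rd"
  unfolding rd_def[abs_def] using gdet_pos(1)[OF G] by (intro smooth_on_sqrt gdet_smooth[OF G] X)

lemma nf_smooth: "smooth_on X nf"
  unfolding nf_def[abs_def] using nf_pos by (intro smooth_on_sqrt gprod_smooth f X) (simp add: nf_def)

lemma n_smooth: "smooth_on X (n i)"
  unfolding n_def[abs_def] using nf_pos by (intro smooth_on_divide smooth_on_pd f nf_smooth X) force

lemma t1_smooth: "smooth_on X t1"
  unfolding t1_def[abs_def] using rd_pos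
  by (intro smooth_on_divide smooth_on_diff smooth_on_mult metric_smooth_nth[OF G] n_smooth rd_smooth X) force

lemma t2_smooth: "smooth_on X t2"
  unfolding t2_def[abs_def] using rd_pos
  by (intro smooth_on_divide smooth_on_diff smooth_on_mult metric_smooth_nth[OF G] n_smooth rd_smooth X) force

lemma N_smooth: "smooth_on X N"
  unfolding N_def[abs_def] using rd_pos
  by (intro smooth_on_scaleR smooth_on_diff smooth_on_inverse rd_smooth t1_smooth t2_smooth smooth_on_pd F X) force

lemma T_smooth: "smooth_on X T"
  unfolding T_def[abs_def] using rd_pos
  by (intro smooth_on_scaleR smooth_on_diff smooth_on_inverse rd_smooth n_smooth smooth_on_pd F X) force

section \<open>Pointwise algebra of the adapted frame and coframe\<close>

context
  fixes u assumes u: "u \<in> X"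
begin

text \<open>Says that \<open>n\<close> has length 1, multiplied by the determinant of the
  metric.\<close>

lemma n_unit: "G u $ 2 $ 2 * n 1 u * n 1 u - 2 * G u $ 1 $ 2 * n 1 u * n 2 u + G u $ 1 $ 1 * n 2 u * n 2 u = rd u * rd u"
proof -
  have "(nf u * nf u) * gdet G u = (nf u * nf u) * (G u $ 2 $ 2 * n 1 u * n 1 u - 2 * G u $ 1 $ 2 * n 1 u * n 2 u + G u $ 1 $ 1 * n 2 u * n 2 u)"
    unfolding nf_sq[OF u] gprod_2[OF u] unfolding pd_f[OF u] nf_sq[OF u, symmetric] by (simp add: algebra_simps)
  then show ?thesis using nf_pos[OF u] rd_sq[OF u] by (simp add: gdet_def)
qed

lemma rt: "rd u * t1 u = G u $ 1 $ 2 * n 1 u - G u $ 1 $ 1 * n 2 u" "rd u * t2 u = G u $ 2 $ 2 * n 1 u - G u $ 1 $ 2 * n 2 u"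
  using rd_pos[OF u] by (simp_all add: t1_def t2_def)

text \<open>The coframe is positively oriented: n \<and> t is the area form.\<close>

lemma n_t: "n 1 u * t2 u - n 2 u * t1 u = rd u"
proof -
  have "rd u * (n 1 u * t2 u - n 2 u * t1 u) = n 1 u * (rd u * t2 u) - n 2 u * (rd u * t1 u)"
    by (simp add: algebra_simps)
  also have "\<dots> = rd u * rd u" unfolding rt n_unit[symmetric] by (simp add: algebra_simps)
  finally show ?thesis using rd_pos[OF u] by simp
qed

lemma metric_coframe:
  "G u $ 1 $ 1 = n 1 u * n 1 u + t1 u * t1 u"
  "G u $ 1 $ 2 = n 1 u * n 2 u + t1 u * t2 u"
  "G u $ 2 $ 2 = n 2 u * n 2 u + t2 u * t2 u"
proof -
  have r: "rd u * rd u \<noteq> 0" using rd_pos[OF u] by simp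
  have *: "(rd u * rd u) * (t1 u * t1 u) = (rd u * t1 u) * (rd u * t1 u)"
    "(rd u * rd u) * (t1 u * t2 u) = (rd u * t1 u) * (rd u * t2 u)"
    "(rd u * rd u) * (t2 u * t2 u) = (rd u * t2 u) * (rd u * t2 u)"
    by simp_all
  have "(rd u * rd u) * (G u $ 1 $ 1 - n 1 u * n 1 u - t1 u * t1 u) = 0"
    "(rd u * rd u) * (G u $ 1 $ 2 - n 1 u * n 2 u - t1 u * t2 u) = 0"
    "(rd u * rd u) * (G u $ 2 $ 2 - n 2 u * n 2 u - t2 u * t2 u) = 0"
    unfolding right_diff_distrib * rt
    using n_unit rd_sq[OF u] by (simp_all add: power2_eq_square) algebra+
  then show "G u $ 1 $ 1 = n 1 u * n 1 u + t1 u * t1 u"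
    "G u $ 1 $ 2 = n 1 u * n 2 u + t1 u * t2 u"
    "G u $ 2 $ 2 = n 2 u * n 2 u + t2 u * t2 u" using r by auto
qed

lemma yu: "F u \<in> Y" using FX u by auto

lemma ip_sym: "ip u V W = ip u W V" by (rule metric_commute[OF H yu])

lemma ip_FF: "ip u (pd 1 F u) (pd 1 F u) = G u $ 1 $ 1" "ip u (pd 1 F u) (pd 2 F u) = G u $ 1 $ 2"
  "ip u (pd 2 F u) (pd 1 F u) = G u $ 1 $ 2" "ip u (pd 2 F u) (pd 2 F u) = G u $ 2 $ 2"
  using GF[OF u] ip_sym by simp_all

lemma frame_F: "ip u (N u) (pd 1 F u) = n 1 u" "ip u (N u) (pd 2 F u) = n 2 u"
  "ip u (T u) (pd 1 F u) = t1 u" "ip u (T u) (pd 2 F u) = t2 u"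
proof -
  have 1: "rd u * ip u (N u) V = t2 u * ip u (pd 1 F u) V - t1 u * ip u (pd 2 F u) V"
    "rd u * ip u (T u) V = n 1 u * ip u (pd 2 F u) V - n 2 u * ip u (pd 1 F u) V" for V
    using rd_pos[OF u] by (simp_all add: N_def T_def ginner_simps)
  have "rd u * ip u (N u) (pd 1 F u) = rd u * n 1 u" "rd u * ip u (N u) (pd 2 F u) = rd u * n 2 u"
    "rd u * ip u (T u) (pd 1 F u) = rd u * t1 u" "rd u * ip u (T u) (pd 2 F u) = rd u * t2 u"
    unfolding 1 ip_FF metric_coframe unfolding n_t[symmetric] by (simp_all add: algebra_simps)
  then show "ip u (N u) (pd 1 F u) = n 1 u" "ip u (N u) (pd 2 F u) = n 2 u"
    "ip u (T u) (pd 1 F u) = t1 u" "ip u (T u) (pd 2 F u) = t2 u" using rd_pos[OF u] by simp_all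
qed

lemma F_frame: "pd 1 F u = n 1 u *\<^sub>R N u + t1 u *\<^sub>R T u" "pd 2 F u = n 2 u *\<^sub>R N u + t2 u *\<^sub>R T u"
proof -
  have r: "rd u \<noteq> 0" using rd_pos[OF u] by simp
  have 1: "rd u *\<^sub>R N u = t2 u *\<^sub>R pd 1 F u - t1 u *\<^sub>R pd 2 F u" "rd u *\<^sub>R T u = n 1 u *\<^sub>R pd 2 F u - n 2 u *\<^sub>R pd 1 F u"
    using r by (simp_all add: N_def T_def)
  have "rd u *\<^sub>R (n 1 u *\<^sub>R N u + t1 u *\<^sub>R T u) = n 1 u *\<^sub>R (rd u *\<^sub>R N u) + t1 u *\<^sub>R (rd u *\<^sub>R T u)"
    by (simp add: scaleR_add_right mult.commute)
  also have "\<dots> = (n 1 u * t2 u - n 2 u * t1 u) *\<^sub>R pd 1 F u"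
    unfolding 1 by (simp add: vec_eq_iff algebra_simps)
  finally show "pd 1 F u = n 1 u *\<^sub>R N u + t1 u *\<^sub>R T u" unfolding n_t using r by simp
  have "rd u *\<^sub>R (n 2 u *\<^sub>R N u + t2 u *\<^sub>R T u) = n 2 u *\<^sub>R (rd u *\<^sub>R N u) + t2 u *\<^sub>R (rd u *\<^sub>R T u)"
    by (simp add: scaleR_add_right mult.commute)
  also have "\<dots> = (n 1 u * t2 u - n 2 u * t1 u) *\<^sub>R pd 2 F u"
    unfolding 1 by (simp add: vec_eq_iff algebra_simps)
  finally show "pd 2 F u = n 2 u *\<^sub>R N u + t2 u *\<^sub>R T u" unfolding n_t using r by simp
qed

lemma frame_ip: "ip u V (N u) = (t2 u * ip u V (pd 1 F u) - t1 u * ip u V (pd 2 F u)) / rd u"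
  "ip u V (T u) = (n 1 u * ip u V (pd 2 F u) - n 2 u * ip u V (pd 1 F u)) / rd u"
  by (simp_all add: N_def T_def ginner_simps divide_inverse mult.commute)

lemma frame_orthonormal: "ip u (N u) (N u) = 1" "ip u (T u) (T u) = 1" "ip u (E u) (E u) = 1"
  "ip u (N u) (T u) = 0" "ip u (N u) (E u) = 0" "ip u (T u) (E u) = 0"
proof -
  have "rd u \<noteq> 0" using rd_pos[OF u] by simp
  then show "ip u (N u) (N u) = 1" "ip u (T u) (T u) = 1" "ip u (N u) (T u) = 0"
    unfolding frame_ip frame_F using n_t by (simp_all add: mult.commute)
  show "ip u (E u) (E u) = 1" by (rule EE[OF u])
  show "ip u (N u) (E u) = 0" "ip u (T u) (E u) = 0"
    unfolding ip_sym[of "N u" "E u"] ip_sym[of "T u" "E u"] frame_ip EF[OF u] by simp_all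
qed

lemma parseval: "ip u V W = ip u V (N u) * ip u W (N u) + ip u V (T u) * ip u W (T u) + ip u V (E u) * ip u W (E u)"
  by (rule orthonormal_parseval_3[OF metric_transpose[OF H yu] metric_pos[OF H yu] frame_orthonormal])

end

section \<open>Shape operator, structure equations and the equations of Codazzi and Gauss\<close>

lemma cov_ip:
  assumes "smooth_on X V" "smooth_on X W" "u \<in> X"
  shows "pd i (\<lambda>v. ip v (V v) (W v)) u = ip u (D i V u) (W u) + ip u (V u) (D i W u)"
  by (rule cov_metric[OF H X F FX assms])

lemma cov_ip_const:
  assumes "smooth_on X V" "smooth_on X W" "u \<in> X" "\<And>v. v \<in> X \<Longrightarrow> ip v (V v) (W v) = a"
  shows "ip u (D i V u) (W u) + ip u (V u) (D i W u) = 0"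
proof -
  have "pd i (\<lambda>v. ip v (V v) (W v)) u = pd i (\<lambda>v. a) u"
    by (rule pd_cong_open[OF X assms(3)]) (rule assms(4))
  then show ?thesis using cov_ip[OF assms(1-3)] by simp
qed

lemmas frame_smooth = N_smooth T_smooth E

text \<open>Differentiating the orthogonality of \<open>E\<close> and \<open>pd j F\<close> moves
  the derivative onto \<open>pd j F\<close>, where torsion-freeness makes it symmetric in the
  indices.\<close>

lemma shape_sym:
  assumes u: "u \<in> X"
  shows "ip u (D i E u) (pd j F u) = ip u (D j E u) (pd i F u)"
  using cov_ip_const[OF E smooth_on_pd[OF F] u EF, of i j] cov_ip_const[OF E smooth_on_pd[OF F] u EF, of j i]
    cov_torsion_free[OF H X F FX u, of i j] by simp

text \<open>\<open>N\<close> points along the gradient of \<open>f\<close>, an eigenvector with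
  eigenvalue -f/2, and the trace leaves 3f/2 for \<open>T\<close>. Signs are reversed because the
  entries belong to the derivative of \<open>E\<close>, which is minus the shape operator.\<close>

lemma shape_frame:
  assumes u: "u \<in> X"
  shows "ip u (D 1 E u) (N u) = f u / 2 * n 1 u" "ip u (D 2 E u) (N u) = f u / 2 * n 2 u"
    "ip u (D 1 E u) (T u) = - (3 * f u / 2) * t1 u" "ip u (D 2 E u) (T u) = - (3 * f u / 2) * t2 u"
proof -
  define A where "A j i = - ip u (D i E u) (pd j F u)" for i j
  define M :: "real^2^2" where "M = (\<chi> j i. A j i)"
  define df :: "real^2" where "df = (\<chi> j. pd j f u)"
  let ?g = "matrix_inv (G u) *v df"
  have A21: "A 2 1 = A 1 2" unfolding A_def using shape_sym[OF u] by simp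
  have S: "matrix_inv (G u) ** M *v ?g = - (f u / 2) *\<^sub>R ?g" and tr: "trace (matrix_inv (G u) ** M) = f u"
    using shape_grad[OF u] shape_trace[OF u] unfolding M_def A_def df_def by simp_all
  note GI = matrix_inv_inverse(1)[OF metric_invertible[OF G u]]
  have "M *v ?g = G u *v (matrix_inv (G u) ** M *v ?g)"
    using GI by (simp add: matrix_vector_mul_assoc matrix_mul_assoc)
  also have "\<dots> = - (f u / 2) *\<^sub>R (G u *v ?g)" unfolding S by (rule matrix_vector_mult_scaleR)
  also have "G u *v ?g = df" using GI by (simp add: matrix_vector_mul_assoc)
  finally have Mg: "M *v ?g = - (f u / 2) *\<^sub>R df" .
  have d: "gdet G u = rd u * rd u" using rd_sq[OF u] by (simp add: gdet_def)
  have r: "rd u > 0" "nf u > 0" using rd_pos[OF u] nf_pos[OF u] .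
  have g: "?g $ 1 = nf u * t2 u / rd u" "?g $ 2 = - (nf u * t1 u / rd u)"
    using r unfolding matrix_vector_mult_def sum_2 df_def
    by (simp_all add: metric_inv_2[OF G u] d pd_f[OF u] t1_def t2_def field_simps)
  \<comment> \<open>The eigenvector equation; by \<open>g\<close> the gradient has coordinates
    proportional to (t2, - t1).\<close>
  have key: "A j 1 * t2 u - A j 2 * t1 u = - (f u / 2) * rd u * n j u" for j
  proof -
    have "(M *v ?g) $ j = A j 1 * ?g $ 1 + A j 2 * ?g $ 2" by (simp add: matrix_vector_mult_def sum_2 M_def)
    then have "A j 1 * ?g $ 1 + A j 2 * ?g $ 2 = - (f u / 2) * (nf u * n j u)"
      unfolding Mg by (simp add: df_def pd_f[OF u])
    then have "nf u * (A j 1 * t2 u - A j 2 * t1 u) = nf u * (- (f u / 2) * rd u * n j u)"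
      unfolding g using r by (simp add: field_simps)
    then show ?thesis by (rule mult_left_cancel[THEN iffD1, rotated]) (use r in simp)
  qed
  have tr2: "G u $ 2 $ 2 * A 1 1 - 2 * G u $ 1 $ 2 * A 1 2 + G u $ 1 $ 1 * A 2 2 = f u * (rd u * rd u)"
  proof -
    have "f u = (G u $ 2 $ 2 * A 1 1 - 2 * G u $ 1 $ 2 * A 1 2 + G u $ 1 $ 1 * A 2 2) / (rd u * rd u)"
      unfolding tr[symmetric] trace_def matrix_matrix_mult_def sum_2 M_def
      by (simp add: metric_inv_2[OF G u] d A21 add_divide_distrib diff_divide_distrib)
    then show ?thesis using r by simp
  qed
  have Ai: "ip u (D i E u) (pd j F u) = - A j i" for i j by (simp add: A_def)
  show "ip u (D 1 E u) (N u) = f u / 2 * n 1 u" "ip u (D 2 E u) (N u) = f u / 2 * n 2 u"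
    unfolding frame_ip[OF u] Ai using key[of 1] key[of 2] r A21 by (simp_all add: field_simps)
  have nt: "n 1 u * t2 u - n 2 u * t1 u = rd u" by (rule n_t[OF u])
  \<comment> \<open>In the coframe the trace is the value of the form on \<open>N\<close> plus its
    value on \<open>T\<close>. Removing the former leaves the latter, because \<open>T\<close> has
    coordinates (- n 2, n 1) / rd.\<close>
  have q: "n 2 u * n 2 u * A 1 1 - 2 * n 1 u * n 2 u * A 1 2 + n 1 u * n 1 u * A 2 2 = (3/2) * f u * (rd u * rd u)"
  proof -
    have "t2 u * (A 1 1 * t2 u - A 1 2 * t1 u) - t1 u * (A 2 1 * t2 u - A 2 2 * t1 u) = - (f u / 2) * rd u * (n 1 u * t2 u - n 2 u * t1 u)"
      unfolding key by (simp add: algebra_simps)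
    then show ?thesis using tr2 unfolding metric_coframe[OF u] nt A21 by (simp add: algebra_simps)
  qed
  \<comment> \<open>Up to the factor \<open>rd\<close> these pair \<open>T\<close> with the two
    coordinate directions. Contraction with \<open>N\<close> gives 0 in \<open>b1\<close>,
    contraction with \<open>T\<close> the eigenvalue in \<open>b2\<close>, and the two contractions
    determine both numbers.\<close>
  define B1 B2 where "B1 = n 1 u * A 1 2 - n 2 u * A 1 1" and "B2 = n 1 u * A 2 2 - n 2 u * A 1 2"
  have b1: "t2 u * B1 - t1 u * B2 = 0"
  proof -
    have "t2 u * B1 - t1 u * B2 = n 1 u * (A 2 1 * t2 u - A 2 2 * t1 u) - n 2 u * (A 1 1 * t2 u - A 1 2 * t1 u)"
      unfolding B1_def B2_def A21 by (simp add: algebra_simps)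
    then show ?thesis unfolding key by (simp add: algebra_simps)
  qed
  have b2: "n 1 u * B2 - n 2 u * B1 = (3/2) * f u * (rd u * rd u)"
    unfolding B1_def B2_def q[symmetric] by (simp add: algebra_simps)
  have "rd u * B1 = n 1 u * (t2 u * B1 - t1 u * B2) + t1 u * (n 1 u * B2 - n 2 u * B1)"
    "rd u * B2 = n 2 u * (t2 u * B1 - t1 u * B2) + t2 u * (n 1 u * B2 - n 2 u * B1)"
    unfolding nt[symmetric] by (simp_all add: algebra_simps)
  then have "B1 = (3/2) * f u * rd u * t1 u" "B2 = (3/2) * f u * rd u * t2 u"
    unfolding b1 b2 using r by simp_all
  then show "ip u (D 1 E u) (T u) = - (3 * f u / 2) * t1 u" "ip u (D 2 E u) (T u) = - (3 * f u / 2) * t2 u"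
    unfolding frame_ip[OF u] Ai B1_def B2_def using r A21 by (simp_all add: field_simps)
qed

text \<open>The connection form of the tangent frame \<open>N\<close>, \<open>T\<close>.\<close>

definition \<theta> where "\<theta> i u = ip u (D i N u) (T u)"

lemma \<theta>_smooth: "smooth_on X (\<theta> i)"
  unfolding \<theta>_def[abs_def]
  by (intro ginner_smooth X metric_along_smooth[OF H X F FX] cov_smooth[OF H X F FX] frame_smooth)

text \<open>The inner products of the frame are constant, so differentiating them makes the matrix
  of connection forms skew.\<close>

lemma structure_coefficients:
  assumes u: "u \<in> X"
  shows "ip u (D i N u) (N u) = 0" "ip u (D i N u) (T u) = \<theta> i u" "ip u (D i N u) (E u) = - ip u (D i E u) (N u)"
    "ip u (D i T u) (N u) = - \<theta> i u" "ip u (D i T u) (T u) = 0" "ip u (D i T u) (E u) = - ip u (D i E u) (T u)"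
    "ip u (D i E u) (E u) = 0"
proof -
  note s = ip_sym[OF u]
  show "ip u (D i N u) (N u) = 0"
    using cov_ip_const[OF N_smooth N_smooth u frame_orthonormal(1), of i] s[of "N u" "D i N u"] by simp
  show "ip u (D i T u) (T u) = 0"
    using cov_ip_const[OF T_smooth T_smooth u frame_orthonormal(2), of i] s[of "T u" "D i T u"] by simp
  show "ip u (D i E u) (E u) = 0"
    using cov_ip_const[OF E E u frame_orthonormal(3), of i] s[of "E u" "D i E u"] by simp
  show "ip u (D i N u) (T u) = \<theta> i u" by (simp add: \<theta>_def)
  show "ip u (D i N u) (E u) = - ip u (D i E u) (N u)"
    using cov_ip_const[OF N_smooth E u frame_orthonormal(5), of i] s[of "N u" "D i E u"] by simp
  show "ip u (D i T u) (E u) = - ip u (D i E u) (T u)"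
    using cov_ip_const[OF T_smooth E u frame_orthonormal(6), of i] s[of "T u" "D i E u"] by simp
  show "ip u (D i T u) (N u) = - \<theta> i u"
    using cov_ip_const[OF N_smooth T_smooth u frame_orthonormal(4), of i] s[of "N u" "D i T u"] by (simp add: \<theta>_def)
qed

text \<open>The first structure equations: second derivatives of \<open>F\<close> drop out by
  torsion-freeness, and only the rotation of the frame is left.\<close>

lemma coframe_derivative:
  assumes u: "u \<in> X"
  shows "pd 1 (n 2) u - pd 2 (n 1) u = \<theta> 1 u * t2 u - \<theta> 2 u * t1 u"
    "pd 1 t2 u - pd 2 t1 u = \<theta> 2 u * n 1 u - \<theta> 1 u * n 2 u"
proof -
  have p: "pd i (n 1) u = pd i (\<lambda>v. ip v (N v) (pd 1 F v)) u" "pd i (n 2) u = pd i (\<lambda>v. ip v (N v) (pd 2 F v)) u"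
    "pd i t1 u = pd i (\<lambda>v. ip v (T v) (pd 1 F v)) u" "pd i t2 u = pd i (\<lambda>v. ip v (T v) (pd 2 F v)) u" for i
    by (rule pd_cong_open[OF X u]; simp add: frame_F)+
  show "pd 1 (n 2) u - pd 2 (n 1) u = \<theta> 1 u * t2 u - \<theta> 2 u * t1 u"
    "pd 1 t2 u - pd 2 t1 u = \<theta> 2 u * n 1 u - \<theta> 1 u * n 2 u"
    unfolding p cov_ip[OF N_smooth smooth_on_pd[OF F] u] cov_ip[OF T_smooth smooth_on_pd[OF F] u]
      cov_torsion_free[OF H X F FX u, of 2 1]
    by (simp_all add: F_frame[OF u] ginner_simps structure_coefficients[OF u])
qed

text \<open>The exterior derivative of the one-form h(D V, W) is the curvature on the area element
  plus terms quadratic in first derivatives. V = E yields the two Codazzi equations, V = N and W = T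
  the Gauss equation.\<close>

lemma curvature_equation:
  assumes u: "u \<in> X" and V: "smooth_on X V" and W: "smooth_on X W"
    and a: "\<And>v. v \<in> X \<Longrightarrow> ip v (D 1 V v) (W v) = a1 v" "\<And>v. v \<in> X \<Longrightarrow> ip v (D 2 V v) (W v) = a2 v"
  shows "pd 1 a2 u - pd 2 a1 u = rd u * ip u (riemann H (F u) (N u) (T u) (V u)) (W u)
    + ip u (D 2 V u) (D 1 W u) - ip u (D 1 V u) (D 2 W u)"
proof -
  have p: "pd 1 a2 u = pd 1 (\<lambda>v. ip v (D 2 V v) (W v)) u" "pd 2 a1 u = pd 2 (\<lambda>v. ip v (D 1 V v) (W v)) u"
    by (rule pd_cong_open[OF X u]; simp add: a)+
  have cs: "smooth_on X (cov H F V i)" for i by (rule cov_smooth[OF H X F FX V])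
  \<comment> \<open>Curvature alternates in its first two arguments, so on the coordinate directions
    it is the value on \<open>N\<close>, \<open>T\<close> times the determinant of the
    coframe.\<close>
  have lin: "riemann H y (a *\<^sub>R P + b *\<^sub>R Q) (a' *\<^sub>R P + b' *\<^sub>R Q) Z = (a * b' - b * a') *\<^sub>R riemann H y P Q Z" for y a b a' b' P Q Z
  proof -
    have d: "riemann H y (a *\<^sub>R P + b *\<^sub>R Q) Z' Z = a *\<^sub>R riemann H y P Z' Z + b *\<^sub>R riemann H y Q Z' Z" for a b P Q Z'
      by (simp add: riemann_def vec_eq_iff algebra_simps sum.distrib sum_distrib_left)
    have e: "riemann H y Z' (a *\<^sub>R P + b *\<^sub>R Q) Z = a *\<^sub>R riemann H y Z' P Z + b *\<^sub>R riemann H y Z' Q Z" for a b P Q Z'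
      by (simp add: riemann_def vec_eq_iff algebra_simps sum.distrib sum_distrib_left)
    have z: "riemann H y P P Z = 0" for P
      using riemann_antisym12[OF H, of y P P Z] by (simp add: vec_eq_iff)
    show ?thesis unfolding d e z riemann_antisym12[OF H, of y Q P] by (simp add: vec_eq_iff algebra_simps)
  qed
  have "cov H F (cov H F V 2) 1 u - cov H F (cov H F V 1) 2 u = rd u *\<^sub>R riemann H (F u) (N u) (T u) (V u)"
    unfolding cov_commutator[OF H X F FX V u] F_frame[OF u] lin n_t[OF u, symmetric] by (simp add: mult.commute)
  then have "ip u (cov H F (cov H F V 2) 1 u) (W u) - ip u (cov H F (cov H F V 1) 2 u) (W u)
     = rd u * ip u (riemann H (F u) (N u) (T u) (V u)) (W u)"
    unfolding ginner_simps(3)[symmetric] by (simp add: ginner_simps)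
  then show ?thesis unfolding p cov_ip[OF cs W u] by simp
qed

text \<open>Constant curvature contributes nothing to the Codazzi equations and the constant c to
  the Gauss equation.\<close>

lemma ambient_curvature:
  assumes u: "u \<in> X"
  shows "ip u (riemann H (F u) (N u) (T u) (E u)) (N u) = 0"
    "ip u (riemann H (F u) (N u) (T u) (E u)) (T u) = 0"
    "ip u (riemann H (F u) (N u) (T u) (N u)) (T u) = - c"
proof -
  note y = yu[OF u] and on = frame_orthonormal[OF u] and s = ip_sym[OF u]
  note C = constant_curvature_orthonormal[OF H y curv[OF y]]
  show "ip u (riemann H (F u) (N u) (T u) (E u)) (N u) = 0" by (rule C(2)[OF _ _ on])
  have "ip u (riemann H (F u) (T u) (N u) (E u)) (T u) = 0"
    by (rule C(2)) (use on s[of "T u" "N u"] in auto)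
  then show "ip u (riemann H (F u) (N u) (T u) (E u)) (T u) = 0"
    using riemann_antisym12[OF H, of "F u" "N u" "T u" "E u"] by (simp add: ginner_simps)
  have "ip u (riemann H (F u) (N u) (T u) (T u)) (N u) = c" by (rule C(1)[OF _ _ on])
  then show "ip u (riemann H (F u) (N u) (T u) (N u)) (T u) = - c"
    using riemann_antisym34[OF H y, of "N u" "T u" "N u" "T u"] by simp
qed

lemma df_parallel_n: "u \<in> X \<Longrightarrow> pd 1 f u * n 2 u = pd 2 f u * n 1 u"
  by (simp add: pd_f)

text \<open>Codazzi along \<open>N\<close>: as df \<and> n = 0 and dn = \<theta> \<and> t, it reads
  (f/2) dn = - (3f/2) dn, and f > 0.\<close>

lemma n_closed:
  assumes u: "u \<in> X"
  shows "pd 1 (n 2) u = pd 2 (n 1) u"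
proof -
  have df: "f differentiable (at u)" "n i differentiable (at u)" for i
    using f n_smooth u smooth_on_differentiable by blast+
  have p: "pd k (\<lambda>v. f v / 2 * n i v) u = f u / 2 * pd k (n i) u + pd k f u / 2 * n i u" for i k
    using df by (simp add: pd_mult pd_divide_const)
  note ce = curvature_equation[OF u E N_smooth, of "\<lambda>v. f v / 2 * n 1 v" "\<lambda>v. f v / 2 * n 2 v",
    OF shape_frame(1,2), unfolded ambient_curvature[OF u] parseval[OF u, of "D 2 E u" "D 1 N u"] parseval[OF u, of "D 1 E u" "D 2 N u"]
    structure_coefficients[OF u] shape_frame[OF u]]
  have "pd 1 (\<lambda>v. f v / 2 * n 2 v) u - pd 2 (\<lambda>v. f v / 2 * n 1 v) u = - (3 * f u / 2) * (\<theta> 1 u * t2 u - \<theta> 2 u * t1 u)"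
    using ce by (simp add: algebra_simps)
  then have "f u * (pd 1 (n 2) u - pd 2 (n 1) u) = 0"
    unfolding p coframe_derivative(1)[OF u, symmetric] using df_parallel_n[OF u] by (simp add: algebra_simps)
  then show ?thesis using f_pos[OF u] by simp
qed

text \<open>Codazzi along \<open>T\<close> reads - (3/2) (f dt + df \<and> t) = (f/2) dt; this is
  the origin of 3/4.\<close>

lemma t_derivative:
  assumes u: "u \<in> X"
  shows "f u * (pd 1 t2 u - pd 2 t1 u) = - (3/4) * (pd 1 f u * t2 u - pd 2 f u * t1 u)"
proof -
  have df: "f differentiable (at u)" "t1 differentiable (at u)" "t2 differentiable (at u)"
    using f t1_smooth t2_smooth u smooth_on_differentiable by blast+
  have p: "pd k (\<lambda>v. - (3 * f v / 2) * t1 v) u = - (3/2) * (f u * pd k t1 u + pd k f u * t1 u)"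
     "pd k (\<lambda>v. - (3 * f v / 2) * t2 v) u = - (3/2) * (f u * pd k t2 u + pd k f u * t2 u)" for k
    using df by (simp_all add: pd_mult pd_divide_const pd_minus field_simps)
  note ce = curvature_equation[OF u E T_smooth, of "\<lambda>v. - (3 * f v / 2) * t1 v" "\<lambda>v. - (3 * f v / 2) * t2 v",
    OF shape_frame(3,4), unfolded ambient_curvature[OF u] parseval[OF u, of "D 2 E u" "D 1 T u"] parseval[OF u, of "D 1 E u" "D 2 T u"]
    structure_coefficients[OF u] shape_frame[OF u]]
  have "pd 1 (\<lambda>v. - (3 * f v / 2) * t2 v) u - pd 2 (\<lambda>v. - (3 * f v / 2) * t1 v) u = f u / 2 * (\<theta> 2 u * n 1 u - \<theta> 1 u * n 2 u)"
    using ce by (simp add: algebra_simps)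
  then show ?thesis
    unfolding p coframe_derivative(2)[OF u, symmetric] by (simp add: algebra_simps)
qed

text \<open>The Gauss equation; the product of the principal curvatures -f/2 and 3f/2 is -
  3f^2/4.\<close>

lemma \<theta>_derivative:
  assumes u: "u \<in> X"
  shows "pd 1 (\<theta> 2) u - pd 2 (\<theta> 1) u = - (c - 3 * (f u)\<^sup>2 / 4) * rd u"
proof -
  note ce = curvature_equation[OF u N_smooth T_smooth, of "\<theta> 1" "\<theta> 2", OF \<theta>_def[symmetric] \<theta>_def[symmetric],
    unfolded ambient_curvature[OF u] parseval[OF u, of "D 2 N u" "D 1 T u"] parseval[OF u, of "D 1 N u" "D 2 T u"]
    structure_coefficients[OF u] shape_frame[OF u]]
  have "pd 1 (\<theta> 2) u - pd 2 (\<theta> 1) u = - (c * rd u) + 3 * (f u)\<^sup>2 / 4 * (n 1 u * t2 u - n 2 u * t1 u)"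
    using ce by (simp add: field_simps power2_eq_square)
  then show ?thesis unfolding n_t[OF u] by (simp add: algebra_simps)
qed

text \<open>dn = \<theta> \<and> t = 0 makes \<theta> a multiple of \<open>t\<close>, and the
  formula for dt fixes the multiple. Thus \<theta> is -3/4 times the Hodge star of d(ln f), so that
  the Gauss equation becomes a Laplace equation for ln f.\<close>

lemma \<theta>_eq:
  assumes u: "u \<in> X"
  shows "\<theta> 1 u = - (3/4) * (nf u / f u) * t1 u" "\<theta> 2 u = - (3/4) * (nf u / f u) * t2 u"
proof -
  define dt where "dt = \<theta> 2 u * n 1 u - \<theta> 1 u * n 2 u"
  have "f u * dt = - (3/4) * (nf u * (n 1 u * t2 u - n 2 u * t1 u))"
    using t_derivative[OF u] unfolding coframe_derivative(2)[OF u] dt_def pd_f[OF u] by (simp add: algebra_simps)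
  then have dt: "dt = - (3/4) * (nf u / f u) * rd u"
    unfolding n_t[OF u] using f_pos[OF u] by (simp add: field_simps)
  have 0: "\<theta> 1 u * t2 u - \<theta> 2 u * t1 u = 0" using coframe_derivative(1)[OF u] n_closed[OF u] by simp
  have "rd u * \<theta> 1 u = n 1 u * (\<theta> 1 u * t2 u - \<theta> 2 u * t1 u) + t1 u * dt"
    "rd u * \<theta> 2 u = n 2 u * (\<theta> 1 u * t2 u - \<theta> 2 u * t1 u) + t2 u * dt"
    unfolding n_t[OF u, symmetric] dt_def by (simp_all add: algebra_simps)
  then have "rd u * \<theta> 1 u = rd u * (- (3/4) * (nf u / f u) * t1 u)"
    "rd u * \<theta> 2 u = rd u * (- (3/4) * (nf u / f u) * t2 u)"
    unfolding 0 dt by simp_all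
  moreover have "rd u \<noteq> 0" using rd_pos[OF u] by simp
  ultimately show "\<theta> 1 u = - (3/4) * (nf u / f u) * t1 u" "\<theta> 2 u = - (3/4) * (nf u / f u) * t2 u"
    by (blast intro: mult_left_cancel[THEN iffD1])+
qed

section \<open>The Laplacian of ln f\<close>

lemma pd_ln_f:
  assumes u: "u \<in> X"
  shows "pd i (\<lambda>v. ln (f v)) u = nf u * n i u / f u"
proof -
  have "pd i (\<lambda>v. ln (f v)) u = inverse (f u) * pd i f u"
    using f_pos[OF u] smooth_on_differentiable[OF f u]
    by (intro pd_real_chain) (auto intro!: derivative_eq_intros simp: divide_inverse)
  then show ?thesis by (simp add: pd_f[OF u] divide_inverse)
qed

lemma ln_f_smooth: "smooth_on X (\<lambda>v. ln (f v))"
  by (intro smooth_on_ln f f_pos X)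

text \<open>In \<open>lap_divergence\<close> the form to be differentiated is -4/3 times \<theta>,
  whose exterior derivative is given by the Gauss equation.\<close>

lemma lap_ln_f:
  assumes u: "u \<in> X"
  shows "lap G (\<lambda>v. ln (f v)) u = 4/3 * c - (f u)\<^sup>2"
proof -
  have df: "\<theta> i differentiable (at u)" for i using \<theta>_smooth u smooth_on_differentiable by blast
  have e: "(G v $ 2 $ 2 * pd 1 (\<lambda>v. ln (f v)) v - G v $ 1 $ 2 * pd 2 (\<lambda>v. ln (f v)) v) / sqrt (gdet G v) = (- (4/3)) * \<theta> 2 v"
    "(G v $ 1 $ 2 * pd 1 (\<lambda>v. ln (f v)) v - G v $ 1 $ 1 * pd 2 (\<lambda>v. ln (f v)) v) / sqrt (gdet G v) = (- (4/3)) * \<theta> 1 v"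
    if "v \<in> X" for v
    using rd_pos[OF that] f_pos[OF that]
    unfolding \<theta>_eq[OF that] pd_ln_f[OF that] rd_def[symmetric] t1_def t2_def
    by (simp_all add: field_simps)
  have "pd 1 (\<lambda>v. (G v $ 2 $ 2 * pd 1 (\<lambda>v. ln (f v)) v - G v $ 1 $ 2 * pd 2 (\<lambda>v. ln (f v)) v) / sqrt (gdet G v)) u
      = pd 1 (\<lambda>v. (- (4/3)) * \<theta> 2 v) u"
    "pd 2 (\<lambda>v. (G v $ 1 $ 2 * pd 1 (\<lambda>v. ln (f v)) v - G v $ 1 $ 1 * pd 2 (\<lambda>v. ln (f v)) v) / sqrt (gdet G v)) u
      = pd 2 (\<lambda>v. (- (4/3)) * \<theta> 1 v) u"
    by (rule pd_cong_open[OF X u], erule e)+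
  then have "lap G (\<lambda>v. ln (f v)) u * rd u = pd 1 (\<lambda>v. (- (4/3)) * \<theta> 2 v) u - pd 2 (\<lambda>v. (- (4/3)) * \<theta> 1 v) u"
    using lap_divergence[OF G u ln_f_smooth] by (simp only: rd_def)
  also have "\<dots> = (- (4/3)) * (pd 1 (\<theta> 2) u - pd 2 (\<theta> 1) u)"
    using df pd_mult[of "\<lambda>v. - (4/3)" u "\<theta> _"] by (simp add: pd_mult algebra_simps)
  also have "\<dots> = (4/3 * c - (f u)\<^sup>2) * rd u"
    unfolding \<theta>_derivative[OF u] by (simp add: algebra_simps)
  finally show ?thesis using rd_pos[OF u] by simp
qed

section \<open>The closed coframe, the flat conformal metric and the intrinsic curvature\<close>

definition \<omega> where "\<omega> i u = f u powr (3/4) * n i u"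
definition \<sigma>1 where "\<sigma>1 u = f u powr (3/4) * t1 u"
definition \<sigma>2 where "\<sigma>2 u = f u powr (3/4) * t2 u"

lemma f_powr_smooth: "smooth_on X (\<lambda>v. f v powr a)"
  by (intro smooth_on_powr smooth_on_const f f_pos X)

lemma \<omega>_smooth: "smooth_on X (\<omega> i)"
  unfolding \<omega>_def[abs_def] by (intro smooth_on_mult f_powr_smooth n_smooth X)

lemma \<sigma>_smooth: "smooth_on X \<sigma>1" "smooth_on X \<sigma>2"
  unfolding \<sigma>1_def[abs_def] \<sigma>2_def[abs_def] by (intro smooth_on_mult f_powr_smooth t1_smooth t2_smooth X)+

lemma pd_f_powr:
  assumes u: "u \<in> X"
  shows "pd i (\<lambda>v. f v powr (3/4)) u = (3/4) * f u powr (3/4) / f u * pd i f u"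
  using f_pos[OF u] smooth_on_differentiable[OF f u] powr_diff[of "f u" "3/4" 1]
  by (intro pd_real_chain) (auto intro!: derivative_eq_intros)

lemma \<omega>_closed:
  assumes u: "u \<in> X"
  shows "pd 1 (\<omega> 2) u = pd 2 (\<omega> 1) u"
proof -
  have df: "(\<lambda>v. f v powr (3/4)) differentiable (at u)" "n i differentiable (at u)" for i
    using f_powr_smooth n_smooth u smooth_on_differentiable by blast+
  show ?thesis
    unfolding \<omega>_def[abs_def] pd_mult[OF df] pd_f_powr[OF u] n_closed[OF u] using df_parallel_n[OF u] by simp
qed

lemma \<sigma>_closed:
  assumes u: "u \<in> X"
  shows "pd 1 \<sigma>2 u = pd 2 \<sigma>1 u"
proof -
  have df: "(\<lambda>v. f v powr (3/4)) differentiable (at u)" "t1 differentiable (at u)" "t2 differentiable (at u)"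
    using f_powr_smooth t1_smooth t2_smooth u smooth_on_differentiable by blast+
  define p where "p = f u powr (3/4)"
  have "pd 1 \<sigma>2 u - pd 2 \<sigma>1 u = p / f u * (f u * (pd 1 t2 u - pd 2 t1 u) + (3/4) * (pd 1 f u * t2 u - pd 2 f u * t1 u))"
    using f_pos[OF u]
    unfolding \<sigma>1_def[abs_def] \<sigma>2_def[abs_def] pd_mult[OF df(1,2)] pd_mult[OF df(1,3)] pd_f_powr[OF u] p_def[symmetric]
    by (simp add: field_simps)
  then show ?thesis unfolding t_derivative[OF u] by simp
qed

lemma powr_34_sq: "u \<in> X \<Longrightarrow> f u powr (3/4) * f u powr (3/4) = f u powr (3/2)"
  by (simp add: powr_add[symmetric])

lemma flat_conformal:
  assumes u: "u \<in> X"
  shows "sectional (\<lambda>v. f v powr (3/2) *\<^sub>R G v) u (axis 1 1) (axis 2 1) = 0"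
proof (rule flat_of_closed_coframe[OF _ u \<omega>_smooth \<omega>_smooth \<sigma>_smooth \<omega>_closed \<sigma>_closed])
  show "metric_on X (\<lambda>v. f v powr (3/2) *\<^sub>R G v)"
    by (rule metric_on_scale[OF G f_powr_smooth]) (use f_pos in force)
qed (simp_all add: metric_coframe powr_34_sq[symmetric] \<omega>_def \<sigma>1_def \<sigma>2_def algebra_simps)

text \<open>The curvature of the flat conformal metric is known, so
  \<open>curvature_conformal\<close> expresses that of \<open>G\<close> by half the Laplacian of
  (3/2) ln f. No second curvature computation in the frame is made.\<close>

lemma curvature_eq:
  assumes u: "u \<in> X"
  shows "sectional G u (axis 1 1) (axis 2 1) = c - 3 * (f u)\<^sup>2 / 4"
proof -
  let ?s = "\<lambda>v. f v powr (3/2)"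
  have s: "?s v > 0" if "v \<in> X" for v using f_pos[OF that] by simp
  have "(sectional G u (axis 1 1) (axis 2 1) - lap G (\<lambda>v. ln (?s v)) u / 2) / ?s u = 0"
    using curvature_conformal[OF G f_powr_smooth s u] flat_conformal[OF u] by simp
  then have 1: "sectional G u (axis 1 1) (axis 2 1) = lap G (\<lambda>v. ln (?s v)) u / 2"
    using s[OF u] by simp
  have ln_s: "(\<lambda>v. ln (?s v)) = (\<lambda>v. (3/2) * ln (f v))" by (rule ext) (simp add: ln_powr)
  have "lap G (\<lambda>v. ln (?s v)) u = (3/2) * (4/3 * c - (f u)\<^sup>2)"
    unfolding ln_s lap_cmult[OF X u ln_f_smooth] lap_ln_f[OF u] ..
  with 1 show ?thesis by simp
qed

lemma gprod_eq_\<omega>: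
  assumes u: "u \<in> X" and x: "\<And>i. pd i x u = \<omega> i u"
  shows "gprod G x x u = f u powr (3/2)"
proof -
  have "gprod G x x u * gdet G u = f u powr (3/2) * (rd u * rd u)"
    unfolding gprod_2[OF u] x \<omega>_def powr_34_sq[OF u, symmetric] n_unit[OF u, symmetric] by (simp add: algebra_simps)
  moreover have "gdet G u = rd u * rd u" using rd_sq[OF u] by (simp add: gdet_def)
  ultimately show ?thesis using rd_pos[OF u] by simp
qed

text \<open>The Hodge star of \<omega> is the form with components \<open>\<sigma>1\<close>,
  \<open>\<sigma>2\<close>, which is closed. The set \<open>X'\<close> is there because a primitive
  of \<omega> exists only locally.\<close>

lemma lap_eq_0:
  assumes u: "u \<in> X'" and X': "open X'" "X' \<subseteq> X" and xs: "smooth_on X' x"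
    and x: "\<And>i v. v \<in> X' \<Longrightarrow> pd i x v = \<omega> i v"
  shows "lap G x u = 0"
proof -
  have G': "metric_on X' G" using G X' smooth_on_subset unfolding metric_on_def by blast
  have e: "(G v $ 2 $ 2 * pd 1 x v - G v $ 1 $ 2 * pd 2 x v) / sqrt (gdet G v) = \<sigma>2 v"
    "(G v $ 1 $ 2 * pd 1 x v - G v $ 1 $ 1 * pd 2 x v) / sqrt (gdet G v) = \<sigma>1 v" if "v \<in> X'" for v
    using that X' unfolding x[OF that] \<omega>_def \<sigma>1_def \<sigma>2_def t1_def t2_def rd_def by (simp_all add: field_simps)
  have "pd 1 (\<lambda>v. (G v $ 2 $ 2 * pd 1 x v - G v $ 1 $ 2 * pd 2 x v) / sqrt (gdet G v)) u = pd 1 \<sigma>2 u"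
    "pd 2 (\<lambda>v. (G v $ 1 $ 2 * pd 1 x v - G v $ 1 $ 1 * pd 2 x v) / sqrt (gdet G v)) u = pd 2 \<sigma>1 u"
    by (rule pd_cong_open[OF X'(1) u], erule e)+
  then have "lap G x u * sqrt (gdet G u) = pd 1 \<sigma>2 u - pd 2 \<sigma>1 u"
    using lap_divergence[OF G' u xs] by simp
  then show ?thesis using \<sigma>_closed[of u] u X' gdet_pos(1)[OF G', OF u] by auto
qed

end

section \<open>Change of coordinates in the ambient space\<close>

definition pushv :: "(real^'n \<Rightarrow> real^'k) \<Rightarrow> real^'n \<Rightarrow> real^'n \<Rightarrow> real^'k" where
  "pushv \<tau> y V = (\<Sum>l\<in>UNIV. V $ l *\<^sub>R pd l \<tau> y)"

text \<open>The second differential of \<tau>, which is the inhomogeneous term in the transformation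
  law of the Christoffel symbols.\<close>

definition hess :: "(real^'n \<Rightarrow> real^'k) \<Rightarrow> real^'n \<Rightarrow> real^'n \<Rightarrow> real^'n \<Rightarrow> real^'k" where
  "hess \<tau> y V Z = (\<Sum>l\<in>UNIV. V $ l *\<^sub>R (\<Sum>k\<in>UNIV. Z $ k *\<^sub>R pd k (pd l \<tau>) y))"

lemma pd_pushv:
  fixes F :: "real^'m \<Rightarrow> real^'n" and \<tau> :: "real^'n \<Rightarrow> real^'k"
  assumes \<tau>: "smooth_on Y \<tau>" and y: "F u \<in> Y" and F: "F differentiable (at u)" and V: "V differentiable (at u)"
  shows "pd i (\<lambda>v. pushv \<tau> (F v) (V v)) u = pushv \<tau> (F u) (pd i V u) + hess \<tau> (F u) (V u) (pd i F u)"
    and "(\<lambda>v. pushv \<tau> (F v) (V v)) differentiable (at u)"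
proof -
  have d: "pd l \<tau> differentiable (at (F u))" for l
    by (rule smooth_on_differentiable[OF smooth_on_pd[OF \<tau>] y])
  have dF: "(\<lambda>v. pd l \<tau> (F v)) differentiable (at u)" for l
    using differentiable_chain_at[OF F d[of l]] by (simp add: o_def)
  have dV: "(\<lambda>v. V v $ l) differentiable (at u)" for l by (rule differentiable_vec_nth[OF V])
  have ds: "(\<lambda>v. V v $ l *\<^sub>R pd l \<tau> (F v)) differentiable (at u)" for l
    using dF dV by (intro differentiable_scaleR)
  have "pd i (\<lambda>v. V v $ l *\<^sub>R pd l \<tau> (F v)) u =
      V u $ l *\<^sub>R (\<Sum>k\<in>UNIV. pd i F u $ k *\<^sub>R pd k (pd l \<tau>) (F u)) + pd i V u $ l *\<^sub>R pd l \<tau> (F u)" for l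
    unfolding pd_bilinear[OF bounded_bilinear_scaleR dV dF] pd_chain[OF F d] pd_vec_nth[OF V] ..
  then show "pd i (\<lambda>v. pushv \<tau> (F v) (V v)) u = pushv \<tau> (F u) (pd i V u) + hess \<tau> (F u) (V u) (pd i F u)"
    unfolding pushv_def hess_def by (simp add: pd_sum ds sum.distrib add.commute)
  show "(\<lambda>v. pushv \<tau> (F v) (V v)) differentiable (at u)"
    unfolding pushv_def using ds by (intro differentiable_sum) auto
qed

lemma hess_sym:
  assumes "open Y" "smooth_on Y \<tau>" "y \<in> Y"
  shows "hess \<tau> y V Z = hess \<tau> y Z V"
proof -
  have "hess \<tau> y V Z = (\<Sum>l\<in>UNIV. \<Sum>k\<in>UNIV. (V $ l * Z $ k) *\<^sub>R pd k (pd l \<tau>) y)"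
    by (simp add: hess_def scaleR_sum_right)
  also have "\<dots> = (\<Sum>k\<in>UNIV. \<Sum>l\<in>UNIV. (Z $ k * V $ l) *\<^sub>R pd l (pd k \<tau>) y)"
    by (subst sum.swap) (simp add: pd_symmetric_vec[OF assms] mult.commute)
  also have "\<dots> = hess \<tau> y Z V" by (simp add: hess_def scaleR_sum_right)
  finally show ?thesis .
qed

lemma pd_pushv_chain:
  assumes "F differentiable (at u)" "\<tau> differentiable (at (F u))"
  shows "pd i (\<lambda>v. \<tau> (F v)) u = pushv \<tau> (F u) (pd i F u)"
  unfolding pushv_def by (rule pd_chain[OF assms])

text \<open>The difference of the two sides is symmetric in \<open>Z, V\<close>, and differentiating the isometry condition shows
  that it is skew in \<open>V, W\<close>; hence it vanishes.\<close>

lemma christoffel_transform: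
  fixes H :: "real^'n \<Rightarrow> real^'n^'n" and H' :: "real^'k \<Rightarrow> real^'k^'k"
  assumes H: "metric_on Y H" and H': "metric_on Y' H'"
    and Y0: "open Y0" "Y0 \<subseteq> Y" and \<tau>: "smooth_on Y0 \<tau>" "\<tau> ` Y0 \<subseteq> Y'"
    and iso: "\<And>y V W. y \<in> Y0 \<Longrightarrow> ginner (H y) V W = ginner (H' (\<tau> y)) (pushv \<tau> y V) (pushv \<tau> y W)"
    and y: "y \<in> Y0"
  shows "ginner (H y) (gam H y Z V) W =
    ginner (H' (\<tau> y)) (gam H' (\<tau> y) (pushv \<tau> y Z) (pushv \<tau> y V) + hess \<tau> y V Z) (pushv \<tau> y W)"
proof -
  let ?P = "pushv \<tau> y" and ?i = "ginner (H y)" and ?i' = "ginner (H' (\<tau> y))" and ?B = "hess \<tau> y"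
  define x where "x Z V W = ?i (gam H y Z V) W - ?i' (gam H' (\<tau> y) (?P Z) (?P V)) (?P W) - ?i' (?B V Z) (?P W)" for Z V W
  have yY: "y \<in> Y" "\<tau> y \<in> Y'" using y Y0 \<tau> by auto
  have s: "x Z V W = x V Z W" for Z V W
    unfolding x_def using gam_sym[OF H yY(1), of Z V] gam_sym[OF H' yY(2), of "?P Z" "?P V"] hess_sym[OF Y0(1) \<tau>(1) y, of V Z] by simp
  have a: "x Z V W = - x Z W V" for Z V W
  proof -
    \<comment> \<open>A line with velocity \<open>Z\<close>, parametrised by \<open>real^1\<close>
      so that the rules for partial derivatives along maps apply to it.\<close>
    define \<gamma> :: "real^1 \<Rightarrow> real^'n" where "\<gamma> = (\<lambda>s. y + s $ 1 *\<^sub>R Z)"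
    have \<gamma>0: "\<gamma> 0 = y" by (simp add: \<gamma>_def)
    have sm: "smooth_on UNIV \<gamma>" unfolding \<gamma>_def
      by (intro smooth_on_add smooth_on_const smooth_on_scaleR smooth_on_vec_nth smooth_on_id) auto
    have d\<gamma>: "\<gamma> differentiable (at 0)" using smooth_on_differentiable[OF sm] by simp
    have p\<gamma>: "pd 1 \<gamma> 0 = Z"
    proof -
      have "pd 1 \<gamma> 0 = axis 1 (1::real) $ (1::1) *\<^sub>R Z" unfolding \<gamma>_def
        by (rule has_derivative_pd) (auto intro!: derivative_eq_intros bounded_linear.has_derivative[OF bounded_linear_vec_nth])
      then show ?thesis by (simp add: axis_def)
    qed
    define X where "X = \<gamma> -` Y0"
    have X: "open X" unfolding X_def by (rule open_vimage[OF Y0(1) smooth_on_continuous[OF sm]])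
    have 0: "0 \<in> X" by (simp add: X_def \<gamma>0 y)
    have y0: "\<gamma> 0 \<in> Y" "\<gamma> 0 \<in> Y0" using yY y by (simp_all add: \<gamma>0)
    have d\<tau>: "\<tau> differentiable (at (\<gamma> 0))" by (rule smooth_on_differentiable[OF \<tau>(1) y0(2)])
    have dt: "(\<lambda>s. \<tau> (\<gamma> s)) differentiable (at 0)"
      using differentiable_chain_at[OF d\<gamma> d\<tau>] by (simp add: o_def)
    have dH: "(\<lambda>s. H (\<gamma> s)) differentiable (at 0)"
      using differentiable_chain_at[OF d\<gamma> smooth_on_differentiable[OF metric_smooth[OF H] y0(1)]] by (simp add: o_def)
    have dH': "(\<lambda>s. H' (\<tau> (\<gamma> s))) differentiable (at 0)"
      using differentiable_chain_at[OF dt, of H'] smooth_on_differentiable[OF metric_smooth[OF H'] yY(2)] by (simp add: o_def \<gamma>0)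
    have c: "(\<lambda>s. A) differentiable (at (0::real^1))" for A :: "real^'n" by simp
    note PV = pd_pushv[OF \<tau>(1) y0(2) d\<gamma> c]
    have "pd 1 (\<lambda>s. ginner (H (\<gamma> s)) V W) 0 =
        pd 1 (\<lambda>s. ginner (H' (\<tau> (\<gamma> s))) (pushv \<tau> (\<gamma> s) V) (pushv \<tau> (\<gamma> s) W)) 0"
      by (rule pd_cong_open[OF X 0]) (rule iso, simp add: X_def)
    then have "ginner (pd 1 (\<lambda>s. H (\<gamma> s)) 0) V W =
        ginner (pd 1 (\<lambda>s. H' (\<tau> (\<gamma> s))) 0) (?P V) (?P W) + ?i' (?B V Z) (?P W) + ?i' (?P V) (?B W Z)"
      unfolding pd_ginner[OF dH c c] pd_ginner[OF dH' PV(2) PV(2)] PV(1) p\<gamma> \<gamma>0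
      by (simp add: ginner_simps pushv_def)
    then have "?i (gam H y Z V) W + ?i V (gam H y Z W) =
       ?i' (gam H' (\<tau> y) (?P Z) (?P V)) (?P W) + ?i' (?P V) (gam H' (\<tau> y) (?P Z) (?P W))
       + ?i' (?B V Z) (?P W) + ?i' (?P V) (?B W Z)"
      using pd_metric_along[OF H d\<gamma> y0(1), of 1 V W] pd_metric_along[OF H' dt, of 1 "?P V" "?P W"] yY(2)
        pd_pushv_chain[OF d\<gamma> d\<tau>, of 1]
      by (simp add: \<gamma>0 p\<gamma>)
    then show ?thesis unfolding x_def
      using metric_commute[OF H yY(1), of V] metric_commute[OF H' yY(2), of "?P V"] by simp
  qed
  \<comment> \<open>Three symmetric and three skew exchanges in alternation lead back to the start
    with the opposite sign.\<close>
  have "x Z V W = 0" using s[of Z V W] s[of Z W V] s[of V W Z] a[of Z V W] a[of W Z V] a[of V W Z] s[of W V Z] by linarith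
  then show ?thesis unfolding x_def by (simp add: ginner_simps)
qed

text \<open>Differentiating the pushed field produces exactly the \<open>hess\<close> term by which
  the Christoffel terms of the two charts differ.\<close>

lemma cov_transform:
  fixes H :: "real^'n \<Rightarrow> real^'n^'n" and H' :: "real^'k \<Rightarrow> real^'k^'k" and F :: "real^'m \<Rightarrow> real^'n"
  assumes H: "metric_on Y H" and H': "metric_on Y' H'"
    and Y0: "open Y0" "Y0 \<subseteq> Y" and \<tau>: "smooth_on Y0 \<tau>" "\<tau> ` Y0 \<subseteq> Y'"
    and iso: "\<And>y V W. y \<in> Y0 \<Longrightarrow> ginner (H y) V W = ginner (H' (\<tau> y)) (pushv \<tau> y V) (pushv \<tau> y W)"
    and F: "F differentiable (at u)" "F u \<in> Y0" and E: "E differentiable (at u)"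
  shows "ginner (H (F u)) (cov H F E i u) W =
    ginner (H' (\<tau> (F u))) (cov H' (\<lambda>v. \<tau> (F v)) (\<lambda>v. pushv \<tau> (F v) (E v)) i u) (pushv \<tau> (F u) W)"
  unfolding cov_def pd_pushv(1)[OF \<tau>(1) F(2,1) E] pd_pushv_chain[OF F(1) smooth_on_differentiable[OF \<tau>(1) F(2)]]
    iso[OF F(2), of "pd i E u"]
  using christoffel_transform[OF assms(1-7) F(2), of "pd i F u" "E u" W] iso[OF F(2), of "pd i E u" W]
  by (simp add: ginner_simps)


section \<open>Closed one-forms on balls\<close>

text \<open>Poincare's lemma: the primitive is the integral of the form along the segment from the
  centre.\<close>

lemma closed_form_exact:
  fixes w :: "'n::finite \<Rightarrow> real^'n \<Rightarrow> real"
  assumes w: "\<And>i. smooth_on (ball a r) (w i)" and r: "r > 0"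
    and closed: "\<And>i j u. u \<in> ball a r \<Longrightarrow> pd i (w j) u = pd j (w i) u"
  shows "\<exists>x. smooth_on (ball a r) x \<and> x a = 0 \<and> (\<forall>u\<in>ball a r. \<forall>i. pd i x u = w i u)"
proof -
  let ?U = "ball a r"
  \<comment> \<open>\<open>leibniz_rule\<close> takes derivatives as bounded linear functions, so
    the coordinate forms are made into such.\<close>
  define e :: "'n \<Rightarrow> (real^'n) \<Rightarrow>\<^sub>L real" where "e j = Blinfun (\<lambda>v. v $ j)" for j
  have e: "blinfun_apply (e j) v = v $ j" for j v
    by (simp add: e_def bounded_linear_Blinfun_apply bounded_linear_vec_nth)
  define p where "p u t = a + t *\<^sub>R (u - a)" for u and t :: real
  have pU: "p u t \<in> ?U" if "u \<in> ?U" "t \<in> cbox 0 1" for u t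
  proof -
    have "dist a (p u t) = t * dist a u" using that by (simp add: p_def dist_norm norm_minus_commute)
    also have "\<dots> \<le> 1 * dist a u" using that by (intro mult_right_mono) auto
    finally show ?thesis using that by simp
  qed
  define f where "f u t = (\<Sum>j\<in>UNIV. (u - a) $ j * w j (p u t))" for u t
  \<comment> \<open>The differential of \<open>f u t\<close> in \<open>u\<close>, with the indices
    of \<open>pd i (w j)\<close> already exchanged by closedness. In this form it is the
    \<open>t\<close>-derivative of t w(p u t), so its integral is the value at t = 1.\<close>
  define g where "g u t = (\<Sum>j\<in>UNIV. w j (p u t) *\<^sub>R e j) + t *\<^sub>R (\<Sum>j\<in>UNIV. (\<Sum>i\<in>UNIV. (u - a) $ i * pd i (w j) (p u t)) *\<^sub>R e j)" for u t
  have wd: "(w j has_derivative (\<lambda>v. \<Sum>i\<in>UNIV. v $ i * pd i (w j) u)) (at u)" if "u \<in> ?U" for j u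
  proof -
    have d: "w j differentiable (at u)" by (rule smooth_on_differentiable[OF w that])
    have "frechet_derivative (w j) (at u) = (\<lambda>v. \<Sum>i\<in>UNIV. v $ i * pd i (w j) u)"
      using frechet_derivative_pd[OF d] by (intro ext) simp
    then show ?thesis using differentiable_has_derivative[OF d] by simp
  qed
  have fg: "((\<lambda>u. f u t) has_derivative blinfun_apply (g u t)) (at u within ?U)" if "u \<in> ?U" "t \<in> cbox 0 1" for u t
  proof -
    have "((\<lambda>u. p u t) has_derivative (\<lambda>v. t *\<^sub>R v)) (at u)" unfolding p_def by (auto intro!: derivative_eq_intros)
    then have wp: "((\<lambda>u. w j (p u t)) has_derivative (\<lambda>v. \<Sum>i\<in>UNIV. (t *\<^sub>R v) $ i * pd i (w j) (p u t))) (at u)" for j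
      by (rule has_derivative_compose[of "\<lambda>u. p u t" "\<lambda>v. t *\<^sub>R v" u UNIV "w j", OF _ wd[OF pU[OF that]]])
    have "((\<lambda>u. (u - a) $ j) has_derivative (\<lambda>v. v $ j)) (at u)" for j
      by (intro bounded_linear.has_derivative[OF bounded_linear_vec_nth]) (auto intro!: derivative_eq_intros)
    then have "((\<lambda>u. f u t) has_derivative (\<lambda>v. \<Sum>j\<in>UNIV. (u - a) $ j * (\<Sum>i\<in>UNIV. (t *\<^sub>R v) $ i * pd i (w j) (p u t)) + v $ j * w j (p u t))) (at u)"
      unfolding f_def by (intro has_derivative_sum has_derivative_mult wp)
    moreover have "(\<Sum>j\<in>UNIV. (u - a) $ j * (\<Sum>i\<in>UNIV. (t *\<^sub>R v) $ i * pd i (w j) (p u t)) + v $ j * w j (p u t)) = blinfun_apply (g u t) v" for v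
    proof -
      have "(\<Sum>j\<in>UNIV. (u - a) $ j * (\<Sum>i\<in>UNIV. (t *\<^sub>R v) $ i * pd i (w j) (p u t)))
         = (\<Sum>j\<in>UNIV. \<Sum>i\<in>UNIV. t * (v $ i * ((u - a) $ j * pd j (w i) (p u t))))"
        using closed[OF pU[OF that]] by (simp add: sum_distrib_left mult.assoc mult.left_commute)
      also have "\<dots> = (\<Sum>i\<in>UNIV. \<Sum>j\<in>UNIV. t * (v $ i * ((u - a) $ j * pd j (w i) (p u t))))"
        by (rule sum.swap)
      finally show ?thesis
        by (simp add: g_def blinfun.add_left blinfun.sum_left blinfun.scaleR_left e sum.distrib sum_distrib_left
          sum_distrib_right mult.assoc mult.left_commute mult.commute)
    qed
    ultimately have "((\<lambda>u. f u t) has_derivative blinfun_apply (g u t)) (at u)" by simp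
    then show ?thesis by (rule has_derivative_at_withinI)
  qed
  have cw: "continuous_on ?U (w j)" "continuous_on ?U (pd i (w j))" for i j
    using w smooth_on_pd smooth_on_continuous by blast+
  have cp: "continuous_on S (\<lambda>z. p (h z) (k z))" if "continuous_on S h" "continuous_on S k" for S h k
    unfolding p_def by (intro continuous_intros that)
  have "continuous_on (?U \<times> cbox 0 1) (\<lambda>(u, t). g u t)"
    unfolding g_def split_beta
    by (intro continuous_intros continuous_on_compose2[OF cw(1)] continuous_on_compose2[OF cw(2)] cp)
      (auto intro!: pU)
  moreover have "f u integrable_on cbox 0 1" if "u \<in> ?U" for u
    unfolding f_def
    by (intro integrable_continuous continuous_intros continuous_on_compose2[OF cw(1)] cp)
      (use that pU in auto)
  ultimately have main: "((\<lambda>u. integral (cbox 0 1) (f u)) has_derivative integral (cbox 0 1) (g u)) (at u within ?U)"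
    if "u \<in> ?U" for u
    by (intro leibniz_rule fg that) auto
  define x where "x u = integral (cbox 0 1) (f u)" for u
  have ig: "integral (cbox 0 1) (g u) = (\<Sum>j\<in>UNIV. w j u *\<^sub>R e j)" if "u \<in> ?U" for u
  proof -
    have "((\<lambda>t. t *\<^sub>R (\<Sum>j\<in>UNIV. w j (p u t) *\<^sub>R e j)) has_vector_derivative g u t) (at t within {0..1})" if t: "t \<in> {0..1}" for t
    proof -
      have "p u t \<in> ?U" using pU[OF \<open>u \<in> ?U\<close>] t by simp
      have "((\<lambda>t. p u t) has_derivative (\<lambda>s. s *\<^sub>R (u - a))) (at t)" unfolding p_def by (auto intro!: derivative_eq_intros)
      then have "((\<lambda>t. w j (p u t)) has_derivative (\<lambda>s. \<Sum>i\<in>UNIV. (s *\<^sub>R (u - a)) $ i * pd i (w j) (p u t))) (at t)" for j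
        by (rule has_derivative_compose[of "\<lambda>t. p u t" "\<lambda>s. s *\<^sub>R (u - a)" t UNIV "w j", OF _ wd[OF \<open>p u t \<in> ?U\<close>]])
      then have "((\<lambda>t. w j (p u t)) has_real_derivative (\<Sum>i\<in>UNIV. (u - a) $ i * pd i (w j) (p u t))) (at t)" for j
        unfolding has_field_derivative_def
        by (rule has_derivative_eq_rhs) (simp add: fun_eq_iff sum_distrib_left mult.assoc mult.commute mult.left_commute)
      then have "((\<lambda>t. w j (p u t)) has_real_derivative (\<Sum>i\<in>UNIV. (u - a) $ i * pd i (w j) (p u t))) (at t within {0..1})" for j
        by (rule has_field_derivative_at_within)
      then show ?thesis
        unfolding g_def
        by (auto intro!: derivative_eq_intros has_vector_derivative_sum simp: add.commute)
    qed
    then have "(g u has_integral (1 *\<^sub>R (\<Sum>j\<in>UNIV. w j (p u 1) *\<^sub>R e j) - 0 *\<^sub>R (\<Sum>j\<in>UNIV. w j (p u 0) *\<^sub>R e j))) {0..1}"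
      by (intro fundamental_theorem_of_calculus) auto
    then show ?thesis by (simp add: integral_unique p_def)
  qed
  have xd: "(x has_derivative (\<lambda>v. \<Sum>j\<in>UNIV. w j u * v $ j)) (at u)" if "u \<in> ?U" for u
  proof -
    have "(x has_derivative blinfun_apply (\<Sum>j\<in>UNIV. w j u *\<^sub>R e j)) (at u)"
      using main[OF that] at_within_open[OF that open_ball] unfolding ig[OF that] x_def by simp
    then show ?thesis
      by (rule has_derivative_eq_rhs) (simp add: fun_eq_iff blinfun.sum_left blinfun.scaleR_left e)
  qed
  have "smooth_on ?U x"
    by (rule smooth_onI[OF open_ball xd]) (auto intro!: smooth_on_sum smooth_on_mult w smooth_on_const)
  moreover have "f a = (\<lambda>t. 0)" by (rule ext) (simp add: f_def)
  then have "x a = 0" by (simp add: x_def)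
  moreover have "pd i x u = w i u" if "u \<in> ?U" for i u
    using has_derivative_pd[OF xd[OF that], of i] by (simp add: axis_def if_distrib cong: if_cong)
  ultimately show ?thesis by blast
qed


section \<open>The one-dimensional Ricci equation\<close>

text \<open>The energy integral \<open>m'\<^sup>2 = b - e\<^sup>-\<^sup>2\<^sup>m - c e\<^sup>2\<^sup>m\<close> reduces the equation to a quadrature.\<close>

lemma ricci_ode:
  fixes c :: real
  obtains d m m' where "d > 0" "smooth_on {- d<..<d} m"
    "\<And>s. s \<in> {- d<..<d} \<Longrightarrow> (m has_real_derivative m' s) (at s)"
    "\<And>s. s \<in> {- d<..<d} \<Longrightarrow> (m' has_real_derivative exp (- 2 * m s) - c * exp (2 * m s)) (at s)"
proof -
  \<comment> \<open>On [-1, 1] the sum e^(-2s) + c e^(2s) is at most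
    \<open>exp 2 * (1 + \<bar>c\<bar>)\<close>; the extra 1 keeps \<open>P\<close> positive
    there.\<close>
  define b where "b = exp 2 * (1 + \<bar>c\<bar>) + 1"
  define P where "P s = b - exp (- 2 * s) - c * exp (2 * s)" for s :: real
  define Q where "Q s = sqrt (P s)" for s
  have P: "P s > 0" if "s \<in> {-1..1}" for s
  proof -
    have "exp (- 2 * s) \<le> exp 2" "exp (2 * s) \<le> exp 2" using that by auto
    moreover have "c * exp (2 * s) \<le> \<bar>c\<bar> * exp (2 * s)" by (intro mult_right_mono) auto
    moreover have "\<bar>c\<bar> * exp (2 * s) \<le> \<bar>c\<bar> * exp 2" using that by (intro mult_left_mono) auto
    moreover have "exp 2 * (1 + \<bar>c\<bar>) = exp 2 + \<bar>c\<bar> * exp 2" by (simp add: algebra_simps)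
    ultimately have "exp (- 2 * s) + c * exp (2 * s) \<le> exp 2 * (1 + \<bar>c\<bar>)" by linarith
    then show ?thesis by (simp add: P_def b_def)
  qed
  have Q: "Q s > 0" if "s \<in> {-1..1}" for s using P[OF that] by (simp add: Q_def)
  have Qsm: "smooth_on {-1<..<1} Q"
    unfolding Q_def P_def
    by (intro smooth_on_sqrt smooth_on_diff smooth_on_const smooth_on_exp smooth_on_mult smooth_on_id)
      (use P in \<open>auto simp: P_def\<close>)
  have Pc: "continuous_on S P" for S unfolding P_def by (intro continuous_intros)
  have Qc: "continuous_on {-1..1} (\<lambda>s. 1 / Q s)"
    using Q P unfolding Q_def by (intro continuous_intros Pc) force+
  \<comment> \<open>m' = Q(m) is separable: \<open>h\<close> is the inverse function of the
    solution, normalised by h(0) = 0. Integration starts at -1 so that 0 lies inside the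
    interval.\<close>
  define h where "h s = integral {-1..s} (\<lambda>s. 1 / Q s) - integral {-1..0} (\<lambda>s. 1 / Q s)" for s
  have hd: "(h has_real_derivative 1 / Q s) (at s)" if "s \<in> {-1<..<1}" for s
  proof -
    have "((\<lambda>x. integral {-1..x} (\<lambda>s. 1 / Q s)) has_real_derivative 1 / Q s) (at s within {-1..1})"
      by (rule integral_has_real_derivative[OF Qc]) (use that in auto)
    moreover have "at s within {-1..1} = at s" by (rule at_within_interior) (use that in auto)
    ultimately have "((\<lambda>x. integral {-1..x} (\<lambda>s. 1 / Q s)) has_real_derivative 1 / Q s) (at s)" by simp
    then show ?thesis unfolding h_def by (auto intro!: derivative_eq_intros)
  qed
  have mono: "h s < h t" if "s \<in> {-1<..<1}" "t \<in> {-1<..<1}" "s < t" for s t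
    by (rule DERIV_pos_imp_increasing[OF that(3)]) (use that hd Q in \<open>fastforce intro!: exI[of _ "1 / Q _"]\<close>)
  \<comment> \<open>A compact interval inside the open one where \<open>h\<close> is differentiable;
    compactness makes the inverse of \<open>h\<close> continuous.\<close>
  let ?I = "{-(1/2)..1/2::real}"
  have inj: "inj_on h ?I"
  proof (rule inj_onI)
    fix s t assume "s \<in> ?I" "t \<in> ?I" "h s = h t"
    then show "s = t" using mono[of s t] mono[of t s] by (cases s t rule: linorder_cases) auto
  qed
  have hc: "continuous_on ?I h"
    by (intro continuous_at_imp_continuous_on ballI DERIV_isCont[OF hd]) auto
  define m where "m = inv_into ?I h"
  have h0: "h 0 = 0" by (simp add: h_def)
  define d where "d = min (h (1/2)) (- h (-(1/2)))"
  have d: "d > 0" using mono[of 0 "1/2"] mono[of "-(1/2)" 0] by (simp add: d_def h0)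
  have img: "s \<in> h ` {-(1/2)<..<1/2}" if "s \<in> {-d<..<d}" for s
  proof -
    have "\<exists>t. -(1/2) \<le> t \<and> t \<le> 1/2 \<and> h t = s"
      by (rule IVT') (use that hc in \<open>auto simp: d_def\<close>)
    then obtain t where t: "-(1/2) \<le> t" "t \<le> 1/2" "h t = s" by blast
    moreover have "s < h (1/2)" "h (-(1/2)) < s" using that by (auto simp: d_def)
    then have "t \<noteq> 1/2" "t \<noteq> -(1/2)" using t(3) by blast+
    ultimately show ?thesis by (intro image_eqI[of _ _ t]) auto
  qed
  have hm: "h (m s) = s" and mI: "m s \<in> {-(1/2)<..<1/2}" if s: "s \<in> {-d<..<d}" for s
  proof -
    obtain t where t: "t \<in> {-(1/2)<..<1/2}" "h t = s" using img[OF s] by auto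
    then have "m s = t" unfolding m_def by (intro inv_into_f_eq[OF inj]) auto
    then show "h (m s) = s" "m s \<in> {-(1/2)<..<1/2}" using t by auto
  qed
  have mc: "continuous_on (h ` ?I) m"
    unfolding m_def using hc by (rule continuous_on_inv) (auto simp: inj)
  have md: "(m has_real_derivative Q (m s)) (at s)" if s: "s \<in> {-d<..<d}" for s
  proof -
    have "continuous_on {-d<..<d} m"
      by (rule continuous_on_subset[OF mc]) (use img in force)
    then have "isCont m s" using s continuous_on_eq_continuous_at[of "{-d<..<d}" m] by auto
    moreover have "(h has_real_derivative 1 / Q (m s)) (at (m s))" using hd mI[OF s] by auto
    moreover have "Q (m s) > 0" using Q mI[OF s] by auto
    ultimately have "(m has_real_derivative inverse (1 / Q (m s))) (at s)"
      using s hm by (intro DERIV_inverse_function[of h "1 / Q (m s)" m s "-d" d]) auto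
    then show ?thesis by (simp add: divide_inverse)
  qed
  \<comment> \<open>Bootstrapping: m' = Q(m) is as regular as \<open>m\<close>, so \<open>m\<close>
    gains one order at each step.\<close>
  have "Ck_on k {-d<..<d} m" for k
  proof (induction k)
    case 0
    show ?case by (auto intro!: continuous_at_imp_continuous_on DERIV_isCont[OF md])
  next
    case (Suc k)
    have "Ck_on k {-d<..<d} (\<lambda>s. Q (m s))"
      by (rule Ck_on_compose[of _ "{-1<..<1}"]) (use Suc Qsm mI in \<open>force simp: smooth_on_def\<close>)+
    then show ?case by (intro Ck_on_real[of _ m "\<lambda>s. Q (m s)"] md) auto
  qed
  then have sm: "smooth_on {-d<..<d} m" unfolding smooth_on_def by simp
  \<comment> \<open>In the derivative of the square root of P(m) the factor \<open>Q\<close>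
    cancels, and m'' = P'(m) / 2 is the equation sought.\<close>
  have "((\<lambda>s. Q (m s)) has_real_derivative exp (- 2 * m s) - c * exp (2 * m s)) (at s)" if s: "s \<in> {-d<..<d}" for s
  proof -
    have p: "P (m s) > 0" using P mI[OF s] by auto
    have "(P has_real_derivative 2 * exp (- 2 * m s) - 2 * c * exp (2 * m s)) (at (m s))"
      unfolding P_def by (auto intro!: derivative_eq_intros)
    then have Pm: "((\<lambda>s. P (m s)) has_real_derivative (2 * exp (- 2 * m s) - 2 * c * exp (2 * m s)) * Q (m s)) (at s)"
      by (rule DERIV_chain2[where f = P and g = m, OF _ md[OF s]])
    have "((\<lambda>s. sqrt (P (m s))) has_real_derivative
       ((2 * exp (- 2 * m s) - 2 * c * exp (2 * m s)) * Q (m s)) * (inverse (sqrt (P (m s))) / 2)) (at s)"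
      using DERIV_chain2[where f = sqrt and g = "\<lambda>s. P (m s)", OF DERIV_real_sqrt[OF p] Pm] by (simp add: mult.commute)
    moreover have "((2 * exp (- 2 * m s) - 2 * c * exp (2 * m s)) * Q (m s)) * (inverse (sqrt (P (m s))) / 2)
       = exp (- 2 * m s) - c * exp (2 * m s)"
      using p by (simp add: Q_def field_simps)
    ultimately show ?thesis unfolding Q_def by (simp only:)
  qed
  then show ?thesis using that[OF d sm md] by blast
qed

section \<open>Charts\<close>

context
  fixes S :: "'a::{t2_space,second_countable_topology} set" and A :: "('a, 'n::finite) chart set"
  assumes SM: "smooth_manifold S A"
begin

lemma manifold_open: "open S"
  using SM by (simp add: smooth_manifold_def)

lemma chart_homeomorphism:
  assumes "ch \<in> A"
  shows "open (fst ch)" "open (snd ch ` fst ch)"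
    "homeomorphism (fst ch) (snd ch ` fst ch) (snd ch) (inv_into (fst ch) (snd ch))"
  using SM assms unfolding smooth_manifold_def by (auto simp: split_beta)

lemma chart_inverse:
  assumes "ch \<in> A" "p \<in> fst ch"
  shows "inv_into (fst ch) (snd ch) (snd ch p) = p"
  using chart_homeomorphism(3)[OF assms(1)] assms(2) by (simp add: homeomorphism_def)

lemma loc_at: "ch \<in> A \<Longrightarrow> p \<in> fst ch \<Longrightarrow> loc ch F (snd ch p) = F p"
  unfolding loc_def by (simp add: chart_inverse)

lemma chart_continuous:
  assumes "ch \<in> A"
  shows "continuous_on (fst ch) (snd ch)" "continuous_on (snd ch ` fst ch) (inv_into (fst ch) (snd ch))"
  using chart_homeomorphism(3)[OF assms] by (simp_all add: homeomorphism_def)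

lemma open_chart_image:
  assumes ch: "ch \<in> A" and U: "open U"
  shows "open (snd ch ` (fst ch \<inter> U))"
proof -
  have "openin (top_of_set (fst ch)) (fst ch \<inter> U)" using U by auto
  then have "openin (top_of_set (snd ch ` fst ch)) (snd ch ` (fst ch \<inter> U))"
    using homeomorphism_imp_open_map[OF chart_homeomorphism(3)[OF ch]] by blast
  then show ?thesis using chart_homeomorphism(2)[OF ch] openin_open_eq by blast
qed

lemma transition_smooth:
  "ch \<in> A \<Longrightarrow> ch' \<in> A \<Longrightarrow> smooth_on (snd ch ` (fst ch \<inter> fst ch' \<inter> S)) (loc ch (snd ch'))"
  using SM by (simp add: smooth_manifold_def)

lemma loc_transition:
  assumes "ch \<in> A" "ch' \<in> A" "p \<in> fst ch" "p \<in> fst ch'"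
  shows "loc ch' F (loc ch (snd ch') (snd ch p)) = loc ch F (snd ch p)"
  using assms by (simp add: loc_at)

lemma transition_open: 
  assumes "ch \<in> A" "ch' \<in> A" "open U"
  shows "open (snd ch ` (fst ch \<inter> fst ch' \<inter> U))"
  using open_chart_image[OF assms(1), of "fst ch' \<inter> U"] chart_homeomorphism(1)[OF assms(2)] assms(3)
  by (simp add: open_Int Int_assoc)

lemma transition_differentiable:
  assumes "ch \<in> A" "ch' \<in> A" "p \<in> fst ch" "p \<in> fst ch'" "p \<in> S"
  shows "loc ch (snd ch') differentiable (at (snd ch p))"
  by (rule smooth_on_differentiable[OF transition_smooth[OF assms(1,2)]]) (use assms in auto)

lemma transition_jacobian_nth:
  "transition_jacobian ch ch' p $ k $ i = pd i (loc ch (snd ch')) (snd ch p) $ k"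
  by (simp add: transition_jacobian_def jacobian_def matrix_def pd_def)

text \<open>The chain rule through the coordinate change, for values in any normed space: it is
  applied to scalars and to the component fields of immersion and normal.\<close>

lemma pd_loc_transition:
  assumes ch: "ch \<in> A" "ch' \<in> A" "p \<in> fst ch" "p \<in> fst ch'" "p \<in> S"
    and d: "loc ch' F differentiable (at (snd ch' p))"
  shows "pd i (loc ch F) (snd ch p) =
    (\<Sum>k\<in>UNIV. transition_jacobian ch ch' p $ k $ i *\<^sub>R pd k (loc ch' F) (snd ch' p))"
proof -
  let ?T = "loc ch (snd ch')"
  have T: "?T (snd ch p) = snd ch' p" by (simp add: loc_at ch)
  have "pd i (loc ch F) (snd ch p) = pd i (\<lambda>v. loc ch' F (?T v)) (snd ch p)"
    by (rule pd_cong_open[OF transition_open[OF ch(1,2) manifold_open]])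
      (use ch in \<open>auto simp: loc_transition\<close>)
  also have "\<dots> = (\<Sum>k\<in>UNIV. pd i ?T (snd ch p) $ k *\<^sub>R pd k (loc ch' F) (?T (snd ch p)))"
    using d T by (intro pd_chain transition_differentiable ch) simp
  finally show ?thesis unfolding T transition_jacobian_nth .
qed

text \<open>Makes a function constructed in a single chart, such as the local primitive, smooth with
  respect to the whole atlas.\<close>

lemma smooth_loc_transition:
  assumes ch: "ch \<in> A" "ch' \<in> A" and U: "open U" "U \<subseteq> S" "U \<subseteq> fst ch'"
    and F: "smooth_on (snd ch' ` U) F"
  shows "smooth_on (snd ch ` (fst ch \<inter> U)) (loc ch (\<lambda>p. F (snd ch' p)))"
proof -
  have o: "open (snd ch ` (fst ch \<inter> U))" by (rule open_chart_image[OF ch(1) U(1)])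
  have o': "open (snd ch' ` U)"
    using open_chart_image[OF ch(2) U(1)] U(3) by (simp add: Int_absorb1)
  have T: "smooth_on (snd ch ` (fst ch \<inter> U)) (loc ch (snd ch'))"
    by (rule smooth_on_subset[OF transition_smooth[OF ch]]) (use U in auto)
  have "smooth_on (snd ch ` (fst ch \<inter> U)) (\<lambda>u. F (loc ch (snd ch') u))"
    by (rule smooth_on_compose[OF o o' T F]) (auto simp: loc_at[OF ch(1)])
  then show ?thesis by (simp add: loc_def[abs_def])
qed

lemma metric_on_chart:
  assumes "riemannian_metric S A g" "ch \<in> A"
  shows "metric_on (snd ch ` (fst ch \<inter> S)) (loc ch (g ch))"
  unfolding metric_on_def
proof (intro conjI ballI)
  show "open (snd ch ` (fst ch \<inter> S))" by (rule open_chart_image[OF assms(2) manifold_open])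
  show "smooth_on (snd ch ` (fst ch \<inter> S)) (loc ch (g ch))" using assms by (simp add: riemannian_metric_def)
  fix u assume "u \<in> snd ch ` (fst ch \<inter> S)"
  then obtain p where p: "u = snd ch p" "p \<in> fst ch" "p \<in> S" by blast
  have "transpose (g ch p) = g ch p" "\<forall>Z. Z \<noteq> 0 \<longrightarrow> ginner (g ch p) Z Z > 0"
    using assms p unfolding riemannian_metric_def by blast+
  then show "transpose (loc ch (g ch) u) = loc ch (g ch) u" "\<forall>Z. Z \<noteq> 0 \<longrightarrow> ginner (loc ch (g ch) u) Z Z > 0"
    unfolding p(1) loc_at[OF assms(2) p(2)] .
qed

lemma chart_at_in:
  assumes "p \<in> S"
  shows "chart_at A p \<in> A" "p \<in> fst (chart_at A p)"
proof -
  have "S \<subseteq> (\<Union>ch\<in>A. fst ch)" using SM by (simp add: smooth_manifold_def)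
  then have "\<exists>ch. ch \<in> A \<and> p \<in> fst ch" using assms by blast
  then have "chart_at A p \<in> A \<and> p \<in> fst (chart_at A p)" unfolding chart_at_def by (rule someI_ex)
  then show "chart_at A p \<in> A" "p \<in> fst (chart_at A p)" by auto
qed

end

section \<open>Linear algebra of chart changes\<close>

lemma pushv_transition:
  "pushv (loc e (snd e')) (snd e q) V = transition_jacobian e e' q *v V"
  by (simp add: pushv_def vec_eq_iff matrix_vector_mult_def transition_jacobian_def jacobian_def
      matrix_def pd_def mult.commute)

lemma ginner_congruence: "ginner (transpose J ** Q ** J) V W = ginner Q (J *v V) (J *v W)"
  unfolding ginner_def
  by (metis dot_lmul_matrix matrix_vector_mul_assoc transpose_matrix_vector inner_commute)

lemma inverse_congruence:
  fixes J Q :: "real^'n^'n"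
  assumes J: "invertible J" and Q: "invertible Q"
  shows "matrix_inv (transpose J ** Q ** J) = matrix_inv J ** matrix_inv Q ** transpose (matrix_inv J)"
proof (rule matrix_inv_unique)
  let ?J = "matrix_inv J" and ?Q = "matrix_inv Q"
  note j = matrix_inv_inverse[OF J] and q = matrix_inv_inverse[OF Q]
  have jt: "transpose J ** transpose ?J = mat 1" "transpose ?J ** transpose J = mat 1"
    using j by (metis matrix_transpose_mul transpose_mat)+
  have "transpose J ** Q ** J ** (?J ** ?Q ** transpose ?J) = transpose J ** (Q ** (J ** ?J) ** ?Q) ** transpose ?J"
    by (simp add: matrix_mul_assoc)
  then show "transpose J ** Q ** J ** (?J ** ?Q ** transpose ?J) = mat 1" using j q jt by simp
  have "?J ** ?Q ** transpose ?J ** (transpose J ** Q ** J) = ?J ** (?Q ** (transpose ?J ** transpose J) ** Q) ** J"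
    by (simp add: matrix_mul_assoc)
  then show "?J ** ?Q ** transpose ?J ** (transpose J ** Q ** J) = mat 1" using j q jt by simp
qed

text \<open>When both bilinear forms change by congruence, the endomorphism between them changes by
  similarity; this is why the mean curvature does not depend on the chart.\<close>

lemma trace_congruence:
  fixes J Q R :: "real^'n^'n"
  assumes J: "invertible J" and Q: "invertible Q"
  shows "trace (matrix_inv (transpose J ** Q ** J) ** (transpose J ** R ** J)) = trace (matrix_inv Q ** R)"
proof -
  let ?J = "matrix_inv J" and ?Q = "matrix_inv Q"
  note j = matrix_inv_inverse[OF J]
  have jt: "transpose ?J ** transpose J = mat 1" using j by (metis matrix_transpose_mul transpose_mat)
  have "matrix_inv (transpose J ** Q ** J) ** (transpose J ** R ** J)
    = ?J ** (?Q ** (transpose ?J ** transpose J) ** R ** J)"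
    unfolding inverse_congruence[OF J Q] by (simp add: matrix_mul_assoc)
  also have "\<dots> = ?J ** ((?Q ** R) ** J)" unfolding jt by (simp add: matrix_mul_assoc)
  also have "trace \<dots> = trace (((?Q ** R) ** J) ** ?J)" by (rule trace_mul_sym)
  also have "((?Q ** R) ** J) ** ?J = ?Q ** R" using j by (simp add: matrix_mul_assoc[symmetric])
  finally show ?thesis .
qed

lemma gam_sum: "gam H y (\<Sum>k\<in>I. a k *\<^sub>R V k) W = (\<Sum>k\<in>I. a k *\<^sub>R gam H y (V k) W)"
proof -
  have "linear (\<lambda>V. gam H y V W)" by (rule linearI) (simp_all add: gam_simps)
  from linear_sum[OF this, of "\<lambda>k. a k *\<^sub>R V k" I] show ?thesis by (simp add: gam_simps)
qed

lemma cov_cong_open: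
  assumes "open X" "u \<in> X" "\<And>v. v \<in> X \<Longrightarrow> F v = F' v" "\<And>v. v \<in> X \<Longrightarrow> V v = V' v"
  shows "cov H F V i u = cov H F' V' i u"
  unfolding cov_def using pd_cong_open[OF assms(1,2), of V V'] pd_cong_open[OF assms(1,2), of F F'] assms by simp


section \<open>Biconservative surfaces in space forms\<close>

locale biconservative_surface =
  fixes c :: real
    and M :: "'a::{t2_space,second_countable_topology} set"
    and A :: "('a, 2) chart set"
    and g :: "('a, 2) metric"
    and N :: "'b::{t2_space,second_countable_topology} set"
    and B :: "('b, 3) chart set"
    and h :: "('b, 3) metric"
    and \<phi> :: "'a \<Rightarrow> 'b"
    and \<eta> :: "('b, 3) chart \<Rightarrow> 'a \<Rightarrow> real^3"
  assumes space_form: "space_form3 N B h c"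
    and surf: "riemannian_surface M A g"
    and immersion: "isometric_immersion M A g N B h \<phi>"
    and normal: "unit_normal_field M A B h \<phi> \<eta>"
    and bicons: "biconservative M A B g h \<phi> \<eta>"
    and mc_pos: "\<And>p. p \<in> M \<Longrightarrow> mean_curvature A B g h \<phi> \<eta> p > 0"
    and mc_grad: "\<And>ch p. ch \<in> A \<Longrightarrow> p \<in> fst ch \<inter> M \<Longrightarrow> gradient g (mean_curvature A B g h \<phi> \<eta>) ch p \<noteq> 0"
begin

abbreviation "f \<equiv> mean_curvature A B g h \<phi> \<eta>"

lemma SM: "smooth_manifold M A" and SN: "smooth_manifold N B"
  and RM: "riemannian_metric M A g" and RN: "riemannian_metric N B h"
  and OM: "oriented_atlas M A"
  using surf space_form by (auto simp: riemannian_surface_def surface_def space_form3_def)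

definition dom where "dom e = M \<inter> \<phi> -` fst e"

lemma dom_iff: "p \<in> dom e \<longleftrightarrow> p \<in> M \<and> \<phi> p \<in> fst e" by (simp add: dom_def)

lemma phi_N: "p \<in> M \<Longrightarrow> \<phi> p \<in> N"
  using immersion by (auto simp: isometric_immersion_def smooth_map_def)

lemma dom_open: "e \<in> B \<Longrightarrow> open (dom e)"
  unfolding dom_def using immersion
  by (intro continuous_open_preimage manifold_open[OF SM] chart_homeomorphism(1)[OF SN])
    (auto simp: isometric_immersion_def smooth_map_def)

lemma dom_set: "{p \<in> fst ch \<inter> M. \<phi> p \<in> fst e} = fst ch \<inter> dom e" by (auto simp: dom_def)

lemma ambient_chart:
  assumes "p \<in> M" obtains e where "e \<in> B" "p \<in> dom e"
  using chart_at_in[OF SN phi_N[OF assms]] assms dom_iff by blast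

text \<open>The coordinates at which \<open>ch\<close> and \<open>e\<close> can be used together; it
  takes the place of \<open>X\<close> in the coordinate locale.\<close>

definition patch where "patch ch e = snd ch ` (fst ch \<inter> dom e)"

context
  fixes ch e assumes ch: "ch \<in> A" and e: "e \<in> B"
begin

lemma patch_open: "open (patch ch e)"
  unfolding patch_def by (rule open_chart_image[OF SM ch dom_open[OF e]])

lemma patch_sub: "patch ch e \<subseteq> snd ch ` (fst ch \<inter> M)"
  unfolding patch_def dom_def by auto

lemma phi_smooth: "smooth_on (patch ch e) (loc ch (snd e \<circ> \<phi>))"
  using immersion ch e unfolding isometric_immersion_def smooth_map_def patch_def dom_set by simp

lemma eta_smooth: "smooth_on (patch ch e) (loc ch (\<eta> e))"
  using normal ch e unfolding unit_normal_field_def patch_def dom_set by simp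

lemma patch_E: 
  assumes "u \<in> patch ch e" obtains p where "u = snd ch p" "p \<in> fst ch" "p \<in> dom e" "p \<in> M" "\<phi> p \<in> fst e" "\<phi> p \<in> N"
  using assms phi_N unfolding patch_def dom_def by auto

lemma cov_deriv_along_eq:
  assumes "p \<in> fst ch" "p \<in> dom e"
  shows "cov_deriv_along h \<phi> ch e \<eta> i p = cov (loc e (h e)) (loc ch (snd e \<circ> \<phi>)) (loc ch (\<eta> e)) i (snd ch p)"
  using assms by (simp add: cov_deriv_along_def cov_def gam_def push_def loc_at[OF SM ch])

end

text \<open>The second fundamental form in an explicit ambient chart, whereas
  \<open>shape_operator\<close> uses a chart chosen anew at each image point.\<close>

definition sff where
  "sff ch e p = (\<chi> j i. - ginner (h e (\<phi> p)) (cov_deriv_along h \<phi> ch e \<eta> i p) (push ch e \<phi> j p))"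

lemma h_loc: "e \<in> B \<Longrightarrow> p \<in> dom e \<Longrightarrow> h e (\<phi> p) = loc e (h e) (snd e (\<phi> p))"
  by (simp add: loc_at[OF SN] dom_iff)

text \<open>A change of ambient chart is an isometry of the coordinate metrics that carries one
  representation of immersion and normal to the other, so \<open>cov_transform\<close>
  applies.\<close>

lemma sff_target:
  assumes ch: "ch \<in> A" and e: "e \<in> B" and e': "e' \<in> B" and p: "p \<in> fst ch" "p \<in> dom e" "p \<in> dom e'"
  shows "sff ch e p = sff ch e' p"
proof -
  let ?H = "loc e (h e)" and ?H' = "loc e' (h e')" and ?T = "loc e (snd e')"
  let ?F = "loc ch (snd e \<circ> \<phi>)" and ?F' = "loc ch (snd e' \<circ> \<phi>)" and ?E = "loc ch (\<eta> e)" and ?E' = "loc ch (\<eta> e')"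
  let ?u = "snd ch p"
  define Y0 where "Y0 = snd e ` (fst e \<inter> fst e' \<inter> N)"
  define X0 where "X0 = snd ch ` (fst ch \<inter> (dom e \<inter> dom e'))"
  have X0: "open X0" "?u \<in> X0" unfolding X0_def
    using p by (auto intro!: open_chart_image[OF SM ch] dom_open e e')
  have u: "?u \<in> patch ch e" using p by (auto simp: patch_def)
  have Fu: "?F ?u = snd e (\<phi> p)" "?F' ?u = snd e' (\<phi> p)" by (simp_all add: loc_at[OF SM ch p(1)])
  have q: "\<phi> p \<in> fst e" "\<phi> p \<in> fst e'" "\<phi> p \<in> N" using p phi_N by (auto simp: dom_iff)
  have iso: "ginner (?H y) V W = ginner (?H' (?T y)) (pushv ?T y V) (pushv ?T y W)" if y: "y \<in> Y0" for y V W
  proof -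
    obtain r where r: "y = snd e r" "r \<in> fst e" "r \<in> fst e'" "r \<in> N" using y unfolding Y0_def by auto
    have "h e r = transpose (transition_jacobian e e' r) ** h e' r ** transition_jacobian e e' r"
      using RN e e' r unfolding riemannian_metric_def by blast
    then show ?thesis using r e e' by (simp add: pushv_transition ginner_congruence loc_at[OF SN])
  qed
  \<comment> \<open>Agreement is required on a neighbourhood, as both sides are about to be
    differentiated.\<close>
  have TF: "?T (?F v) = ?F' v" and TE: "pushv ?T (?F v) (?E v) = ?E' v" if v: "v \<in> X0" for v
  proof -
    obtain r where r: "v = snd ch r" "r \<in> fst ch" "r \<in> dom e" "r \<in> dom e'" using v unfolding X0_def by auto
    then show "?T (?F v) = ?F' v" using e by (simp add: loc_at[OF SM ch] loc_at[OF SN] dom_iff)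
    have "\<eta> e' r = transition_jacobian e e' (\<phi> r) *v \<eta> e r"
      using normal e e' r unfolding unit_normal_field_def dom_iff by blast
    then show "pushv ?T (?F v) (?E v) = ?E' v" using r by (simp add: pushv_transition loc_at[OF SM ch])
  qed
  have dF: "?F differentiable (at ?u)" "?E differentiable (at ?u)"
    using smooth_on_differentiable[OF phi_smooth[OF ch e] u] smooth_on_differentiable[OF eta_smooth[OF ch e] u] by auto
  have FY: "?F ?u \<in> Y0" unfolding Fu Y0_def using q by auto
  have Y0: "open Y0" unfolding Y0_def by (rule transition_open[OF SN e e' manifold_open[OF SN]])
  have cov: "ginner (?H (?F ?u)) (cov ?H ?F ?E i ?u) W =
    ginner (?H' (?T (?F ?u))) (cov ?H' (\<lambda>v. ?T (?F v)) (\<lambda>v. pushv ?T (?F v) (?E v)) i ?u) (pushv ?T (?F ?u) W)" for i W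
    by (rule cov_transform[OF metric_on_chart[OF SN RN e] metric_on_chart[OF SN RN e'] Y0 _ _ _ iso dF(1) FY dF(2)])
      (use transition_smooth[OF SN e e'] in \<open>auto simp: Y0_def loc_at[OF SN e]\<close>)
  have cov': "cov ?H' (\<lambda>v. ?T (?F v)) (\<lambda>v. pushv ?T (?F v) (?E v)) i ?u = cov ?H' ?F' ?E' i ?u" for i
    by (rule cov_cong_open[OF X0 TF TE])
  have push: "pushv ?T (?F ?u) (pd j ?F ?u) = pd j ?F' ?u" for j
  proof -
    have "pd j (\<lambda>v. ?T (?F v)) ?u = pushv ?T (?F ?u) (pd j ?F ?u)"
      by (rule pd_pushv_chain[OF dF(1)]) (rule smooth_on_differentiable[OF transition_smooth[OF SN e e']], use FY in \<open>simp add: Y0_def\<close>)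
    then show ?thesis using pd_cong_open[OF X0 TF] by simp
  qed
  have "ginner (h e (\<phi> p)) (cov_deriv_along h \<phi> ch e \<eta> i p) (push ch e \<phi> j p)
    = ginner (h e' (\<phi> p)) (cov_deriv_along h \<phi> ch e' \<eta> i p) (push ch e' \<phi> j p)" for i j
    unfolding cov_deriv_along_eq[OF ch e p(1,2)] cov_deriv_along_eq[OF ch e' p(1,3)] push_def
      h_loc[OF e p(2)] h_loc[OF e' p(3)]
    using cov[of i "pd j ?F ?u"] unfolding cov' push TF[OF X0(2)] unfolding Fu .
  then show ?thesis unfolding sff_def by simp
qed

section \<open>Independence of the charts and transfer to the coordinate locale\<close>

lemma jacobian_invertible:
  assumes "ch \<in> A" "ch' \<in> A" "p \<in> fst ch" "p \<in> fst ch'" "p \<in> M"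
  shows "invertible (transition_jacobian ch ch' p)"
proof -
  have "det (transition_jacobian ch ch' p) > 0" using OM assms unfolding oriented_atlas_def by blast
  then show ?thesis by (simp add: invertible_det_nz)
qed

lemma metric_transform:
  assumes "ch \<in> A" "ch' \<in> A" "p \<in> fst ch" "p \<in> fst ch'" "p \<in> M"
  shows "g ch p = transpose (transition_jacobian ch ch' p) ** g ch' p ** transition_jacobian ch ch' p"
  using RM assms unfolding riemannian_metric_def by blast

lemma g_invertible:
  assumes "ch \<in> A" "p \<in> fst ch" "p \<in> M"
  shows "invertible (g ch p)"
  using metric_invertible[OF metric_on_chart[OF SM RM assms(1)], of "snd ch p"] assms
  by (auto simp: loc_at[OF SM])

text \<open>Tangent vectors and covariant derivatives along coordinate directions are both linear in
  the direction, so each contributes one factor of the Jacobian.\<close>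

lemma sff_domain:
  assumes ch: "ch \<in> A" "ch' \<in> A" and e: "e \<in> B" and p: "p \<in> fst ch" "p \<in> fst ch'" "p \<in> dom e"
  defines "J \<equiv> transition_jacobian ch ch' p"
  shows "sff ch e p = transpose J ** sff ch' e p ** J"
proof -
  have pM: "p \<in> M" using p by (simp add: dom_iff)
  have u: "snd ch' p \<in> patch ch' e" using p by (auto simp: patch_def)
  have push: "push ch e \<phi> j p = (\<Sum>k\<in>UNIV. J $ k $ j *\<^sub>R push ch' e \<phi> k p)" for j
    unfolding push_def J_def
    by (rule pd_loc_transition[OF SM ch p(1,2) pM smooth_on_differentiable[OF phi_smooth[OF ch(2) e] u]])
  have eta: "pd i (loc ch (\<eta> e)) (snd ch p) = (\<Sum>k\<in>UNIV. J $ k $ i *\<^sub>R pd k (loc ch' (\<eta> e)) (snd ch' p))" for i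
    unfolding J_def
    by (rule pd_loc_transition[OF SM ch p(1,2) pM smooth_on_differentiable[OF eta_smooth[OF ch(2) e] u]])
  have cda: "cov_deriv_along h \<phi> ch e \<eta> i p = pd i (loc ch (\<eta> e)) (snd ch p)
      + gam (loc e (h e)) (snd e (\<phi> p)) (push ch e \<phi> i p) (\<eta> e p)" for ch i
    by (simp add: cov_deriv_along_def gam_def)
  have cov: "cov_deriv_along h \<phi> ch e \<eta> i p = (\<Sum>k\<in>UNIV. J $ k $ i *\<^sub>R cov_deriv_along h \<phi> ch' e \<eta> k p)" for i
    unfolding cda push eta gam_sum by (simp add: scaleR_add_right sum.distrib)
  have "sff ch e p $ j $ i = (transpose J ** sff ch' e p ** J) $ j $ i" for i j
  proof -
    let ?i = "ginner (h e (\<phi> p))"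
    have l: "?i (\<Sum>k\<in>UNIV. a k *\<^sub>R V k) W = (\<Sum>k\<in>UNIV. a k * ?i (V k) W)" for a :: "2 \<Rightarrow> real" and V W
      by (simp add: sum_2 ginner_simps)
    have r: "?i W (\<Sum>k\<in>UNIV. a k *\<^sub>R V k) = (\<Sum>k\<in>UNIV. a k * ?i W (V k))" for a :: "2 \<Rightarrow> real" and V W
      by (simp add: sum_2 ginner_simps)
    show ?thesis
      unfolding sff_def vec_lambda_beta cov push l r
      by (simp add: matrix_matrix_mult_def transpose_def sum_2 algebra_simps)
  qed
  then show ?thesis by (simp add: vec_eq_iff)
qed

text \<open>Replaces the chosen ambient chart, which may jump from point to point, by a fixed one;
  only then can the shape operator be differentiated.\<close>

lemma shape_operator_eq:
  assumes "ch \<in> A" "e \<in> B" "p \<in> fst ch" "p \<in> dom e"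
  shows "shape_operator B g h \<phi> \<eta> ch p = matrix_inv (g ch p) ** sff ch e p"
proof -
  have "p \<in> M" using assms by (simp add: dom_iff)
  then have e': "chart_at B (\<phi> p) \<in> B" "p \<in> dom (chart_at B (\<phi> p))"
    using chart_at_in[OF SN phi_N] by (auto simp: dom_iff)
  have "shape_operator B g h \<phi> \<eta> ch p = matrix_inv (g ch p) ** sff ch (chart_at B (\<phi> p)) p"
    by (simp add: shape_operator_def sff_def Let_def)
  then show ?thesis using sff_target[OF assms(1) e'(1) assms(2,3) e'(2) assms(4)] by simp
qed

text \<open>The same for the chosen chart of the surface, by invariance of the trace.\<close>

lemma mean_curvature_eq:
  assumes ch: "ch \<in> A" and e: "e \<in> B" and p: "p \<in> fst ch" "p \<in> dom e"
  shows "f p = trace (matrix_inv (g ch p) ** sff ch e p)"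
proof -
  have pM: "p \<in> M" using p by (simp add: dom_iff)
  define ch0 where "ch0 = chart_at A p"
  have ch0: "ch0 \<in> A" "p \<in> fst ch0" unfolding ch0_def by (rule chart_at_in[OF SM pM])+
  have "f p = trace (matrix_inv (g ch0 p) ** sff ch0 e p)"
    unfolding mean_curvature_def ch0_def[symmetric] shape_operator_eq[OF ch0(1) e ch0(2) p(2)] ..
  also have "\<dots> = trace (matrix_inv (g ch p) ** sff ch e p)"
    unfolding sff_domain[OF ch0(1) ch e ch0(2) p] metric_transform[OF ch0(1) ch ch0(2) p(1) pM]
    by (rule trace_congruence[OF jacobian_invertible[OF ch0(1) ch ch0(2) p(1) pM] g_invertible[OF ch p(1) pM]])
  finally show ?thesis .
qed

lemma patch_metric:
  assumes "ch \<in> A" "e \<in> B"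
  shows "metric_on (patch ch e) (loc ch (g ch))"
  using metric_on_chart[OF SM RM assms(1)] patch_open[OF assms] patch_sub[OF assms] smooth_on_subset
  unfolding metric_on_def by blast

text \<open>With both charts fixed, the trace is an expression in the inverse metric and in
  covariant derivatives of smooth fields.\<close>

lemma mean_curvature_smooth:
  assumes ch: "ch \<in> A" and e: "e \<in> B"
  shows "smooth_on (patch ch e) (loc ch f)"
proof -
  let ?H = "loc e (h e)" and ?F = "loc ch (snd e \<circ> \<phi>)" and ?E = "loc ch (\<eta> e)" and ?G = "loc ch (g ch)"
  note X = patch_open[OF ch e]
  have FX: "?F ` patch ch e \<subseteq> snd e ` (fst e \<inter> N)"
    by (auto elim!: patch_E[OF ch e] simp: loc_at[OF SM ch])
  note MH = metric_on_chart[OF SN RN e]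
  have "smooth_on (patch ch e) (\<lambda>u. ginner (?H (?F u)) (cov ?H ?F ?E i u) (pd j ?F u))" for i j
    by (intro ginner_smooth X metric_along_smooth[OF MH X phi_smooth[OF ch e] FX]
      cov_smooth[OF MH X phi_smooth[OF ch e] FX] eta_smooth[OF ch e] smooth_on_pd phi_smooth[OF ch e])
  then have "smooth_on (patch ch e) (\<lambda>u. \<Sum>i\<in>UNIV. \<Sum>k\<in>UNIV. matrix_inv (?G u) $ i $ k *
      - ginner (?H (?F u)) (cov ?H ?F ?E i u) (pd k ?F u))"
    by (intro smooth_on_sum smooth_on_mult smooth_on_minus smooth_on_vec_nth
      metric_inv_smooth[OF patch_metric[OF ch e]] X)
  then show ?thesis
  proof (rule smooth_on_cong[OF X, rotated])
    fix u assume "u \<in> patch ch e"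
    then obtain p where p: "u = snd ch p" "p \<in> fst ch" "p \<in> dom e" by (rule patch_E[OF ch e])
    show "(\<Sum>i\<in>UNIV. \<Sum>k\<in>UNIV. matrix_inv (?G u) $ i $ k *
      - ginner (?H (?F u)) (cov ?H ?F ?E i u) (pd k ?F u)) = loc ch f u"
      unfolding p(1) loc_at[OF SM ch p(2)] mean_curvature_eq[OF ch e p(2,3)] trace_def matrix_matrix_mult_def sff_def
        cov_deriv_along_eq[OF ch e p(2,3)] h_loc[OF e p(3)]
      by (simp add: push_def)
  qed
qed

lemma biconservative_patch:
  assumes ch: "ch \<in> A" and e: "e \<in> B"
  shows "biconservative_patch (snd e ` (fst e \<inter> N)) (loc e (h e)) (patch ch e) (loc ch (snd e \<circ> \<phi>))
    (loc ch (g ch)) (loc ch (\<eta> e)) (loc ch f) c"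
proof
  let ?H = "loc e (h e)" and ?F = "loc ch (snd e \<circ> \<phi>)" and ?E = "loc ch (\<eta> e)" and ?G = "loc ch (g ch)"
  show "metric_on (snd e ` (fst e \<inter> N)) ?H" by (rule metric_on_chart[OF SN RN e])
  show "sectional ?H y V W = c" if "y \<in> snd e ` (fst e \<inter> N)" "V \<noteq> W" "independent {V, W}" for y V W
    using space_form e that unfolding space_form3_def constant_sectional_curvature_def by blast
  show "smooth_on (patch ch e) ?F" by (rule phi_smooth[OF ch e])
  show "?F ` patch ch e \<subseteq> snd e ` (fst e \<inter> N)"
    by (auto elim!: patch_E[OF ch e] simp: loc_at[OF SM ch])
  show "metric_on (patch ch e) ?G" by (rule patch_metric[OF ch e])
  show "smooth_on (patch ch e) ?E" by (rule eta_smooth[OF ch e])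
  show "smooth_on (patch ch e) (loc ch f)" by (rule mean_curvature_smooth[OF ch e])
  fix u assume "u \<in> patch ch e"
  then obtain p where p: "u = snd ch p" "p \<in> fst ch" "p \<in> dom e" "p \<in> M" "\<phi> p \<in> fst e" by (rule patch_E[OF ch e])
  have H: "?H (?F u) = h e (\<phi> p)" using p h_loc[OF e p(3)] by (simp add: loc_at[OF SM ch])
  have Gu: "?G u = g ch p" and Eu: "?E u = \<eta> e p" and fu: "loc ch f u = f p"
    using p by (simp_all add: loc_at[OF SM ch])
  have F: "pd i ?F u = push ch e \<phi> i p" for i by (simp add: push_def p)
  show "?G u $ i $ j = ginner (?H (?F u)) (pd i ?F u) (pd j ?F u)" for i j
    unfolding H Gu F using immersion ch e p unfolding isometric_immersion_def by blast
  show "ginner (?H (?F u)) (?E u) (?E u) = 1"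
    unfolding H Eu using normal e p unfolding unit_normal_field_def by blast
  show "ginner (?H (?F u)) (?E u) (pd i ?F u) = 0" for i
    unfolding H Eu F using normal ch e p unfolding unit_normal_field_def by blast
  show "loc ch f u > 0" unfolding fu by (rule mc_pos[OF p(4)])
  have S: "(\<chi> j i. - ginner (?H (?F u)) (cov ?H ?F ?E i u) (pd j ?F u)) = sff ch e p"
    by (simp add: sff_def H F cov_deriv_along_eq[OF ch e p(2,3)] p(1)[symmetric])
  have gr: "matrix_inv (?G u) *v (\<chi> j. pd j (loc ch f) u) = gradient g f ch p"
    unfolding Gu by (simp add: gradient_def p)
  show "trace (matrix_inv (?G u) ** (\<chi> j i. - ginner (?H (?F u)) (cov ?H ?F ?E i u) (pd j ?F u))) = loc ch f u"
    unfolding S fu Gu mean_curvature_eq[OF ch e p(2,3)] ..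
  show "matrix_inv (?G u) *v (\<chi> j. pd j (loc ch f) u) \<noteq> 0"
    unfolding gr using mc_grad ch p by blast
  show "matrix_inv (?G u) ** (\<chi> j i. - ginner (?H (?F u)) (cov ?H ?F ?E i u) (pd j ?F u)) *v
      (matrix_inv (?G u) *v (\<chi> j. pd j (loc ch f) u)) =
    - (loc ch f u / 2) *\<^sub>R (matrix_inv (?G u) *v (\<chi> j. pd j (loc ch f) u))"
    unfolding gr unfolding S fu Gu shape_operator_eq[OF ch e p(2,3), symmetric]
    using bicons ch p unfolding biconservative_def Let_def by blast
qed

lemma gauss_curvature_eq:
  assumes p: "p \<in> M"
  shows "gauss_curvature A g p = c - 3 * (f p)\<^sup>2 / 4"
proof -
  define ch where "ch = chart_at A p"
  have ch: "ch \<in> A" "p \<in> fst ch" unfolding ch_def by (rule chart_at_in[OF SM p])+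
  obtain e where e: "e \<in> B" "p \<in> dom e" using ambient_chart[OF p] .
  interpret P: biconservative_patch "snd e ` (fst e \<inter> N)" "loc e (h e)" "patch ch e" "loc ch (snd e \<circ> \<phi>)"
    "loc ch (g ch)" "loc ch (\<eta> e)" "loc ch f" c
    by (rule biconservative_patch[OF ch(1) e(1)])
  have "snd ch p \<in> patch ch e" using ch e by (auto simp: patch_def)
  then show ?thesis
    using P.curvature_eq by (simp add: loc_at[OF SM ch] gauss_curvature_def ch_def[symmetric] Let_def)
qed

end

section \<open>The conformal Ricci metrics\<close>

context biconservative_patch
begin

context
  fixes Z d m m' x
  assumes Z: "open Z" "Z \<subseteq> X"
    and m: "smooth_on {- d<..<d} m"
      "\<And>s. s \<in> {- d<..<d} \<Longrightarrow> (m has_real_derivative m' s) (at s)"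
      "\<And>s. s \<in> {- d<..<d} \<Longrightarrow> (m' has_real_derivative exp (- 2 * m s) - c * exp (2 * m s)) (at s)"
    and x: "smooth_on Z x" "x ` Z \<subseteq> {- d<..<d}" "\<And>i v. v \<in> Z \<Longrightarrow> pd i x v = \<omega> i v"
begin

lemma mx_smooth: "smooth_on Z (\<lambda>v. m (x v))"
  by (rule smooth_on_compose[OF Z(1) _ x(1) m(1) x(2)]) simp

lemma GZ: "metric_on Z G"
  using G Z smooth_on_subset unfolding metric_on_def by blast

text \<open>\<open>x\<close> is harmonic, so the chain rule leaves only the second derivative of
  \<open>m\<close> times the squared length f^(3/2) of dx.\<close>

lemma lap_mx:
  assumes u: "u \<in> Z"
  shows "lap G (\<lambda>v. m (x v)) u = (exp (- 2 * m (x u)) - c * exp (2 * m (x u))) * f u powr (3/2)"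
  using lap_real_chain[OF Z(1) u x(1,2) m(2,3)] lap_eq_0[OF u Z x(1,3)] gprod_eq_\<omega>[of u x] u Z x(3)
  by auto

lemma ln_f_Z: "smooth_on Z (\<lambda>v. ln (f v))"
  using ln_f_smooth smooth_on_subset Z by blast

lemma lap_exponent:
  assumes u: "u \<in> Z"
  shows "lap G (\<lambda>v. m (x v) + 3/4 * ln (f v)) u =
    (exp (- 2 * m (x u)) - c * exp (2 * m (x u))) * f u powr (3/2) + (c - 3 * (f u)\<^sup>2 / 4)"
proof -
  have "smooth_on Z (\<lambda>v. 3/4 * ln (f v))" by (intro smooth_on_mult smooth_on_const ln_f_Z Z)
  moreover have "u \<in> X" using u Z by auto
  ultimately show ?thesis
    unfolding lap_add[OF Z(1) u mx_smooth \<open>smooth_on Z (\<lambda>v. 3/4 * ln (f v))\<close>] lap_cmult[OF Z(1) u ln_f_Z]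
      lap_mx[OF u] lap_ln_f[OF \<open>u \<in> X\<close>]
    by simp
qed

text \<open>The curvature of \<open>G\<close> cancels against the Laplacian of (3/4) ln f. What is
  left is minus the Laplacian of m(x) over the conformal factor, and the differential equation for
  \<open>m\<close> makes this a function of \<open>m\<close> alone.\<close>

lemma curvature_exponent:
  assumes u: "u \<in> Z"
  shows "sectional (\<lambda>v. (exp (2 * m (x v)) * f v powr (3/2)) *\<^sub>R G v) u (axis 1 1) (axis 2 1) = c - exp (- 4 * m (x u))"
proof -
  let ?s = "\<lambda>v. exp (2 * m (x v)) * f v powr (3/2)"
  have uX: "u \<in> X" using u Z by auto
  have fp: "f v > 0" if "v \<in> Z" for v using f_pos that Z by auto
  have ssm: "smooth_on Z ?s"
    by (intro smooth_on_mult smooth_on_exp smooth_on_const mx_smooth Z smooth_on_subset[OF f_powr_smooth])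
  have "lap G (\<lambda>v. ln (?s v)) u = lap G (\<lambda>v. 2 * (m (x v) + 3/4 * ln (f v))) u"
    by (rule lap_cong_open[OF Z(1) u]) (use fp in \<open>force simp: ln_mult ln_powr\<close>)
  also have "\<dots> = 2 * lap G (\<lambda>v. m (x v) + 3/4 * ln (f v)) u"
    by (intro lap_cmult[OF Z(1) u] smooth_on_add smooth_on_mult smooth_on_const mx_smooth ln_f_Z Z)
  finally have lap_s: "lap G (\<lambda>v. ln (?s v)) u =
    2 * ((exp (- 2 * m (x u)) - c * exp (2 * m (x u))) * f u powr (3/2) + (c - 3 * (f u)\<^sup>2 / 4))"
    unfolding lap_exponent[OF u] .
  have cancel: "(k - 2 * (e + k) / 2) / s = - e / s" for k e s :: real
  proof -
    have "k - 2 * (e + k) / 2 = - e" by (simp add: field_simps)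
    then show ?thesis by simp
  qed
  have spos: "?s v > 0" if "v \<in> Z" for v using fp[OF that] by simp
  have "sectional (\<lambda>v. ?s v *\<^sub>R G v) u (axis 1 1) (axis 2 1) =
      - ((exp (- 2 * m (x u)) - c * exp (2 * m (x u))) * f u powr (3/2)) / ?s u"
    using curvature_conformal[OF GZ ssm spos u] unfolding lap_s curvature_eq[OF uX] cancel .
  also have "\<dots> = c - exp (- 2 * m (x u)) / exp (2 * m (x u))"
    using fp[OF u] by (simp add: field_simps)
  also have "\<dots> = c - exp (- 4 * m (x u))" by (simp add: exp_diff[symmetric])
  finally show ?thesis .
qed

text \<open>The right-hand side is the conformal formula for the factor (c - K)^r with the Laplacian
  of r ln(c - K) expanded by the product rule. By \<open>rL\<close> the same Laplacian equals twice
  that of \<open>lap_exponent\<close>, and comparing the two gives the claim.\<close>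

lemma curvature_formula:
  assumes u: "u \<in> Z" and r: "smooth_on Z r"
    and k: "\<And>v. v \<in> Z \<Longrightarrow> k v = c - 3 * (f v)\<^sup>2 / 4"
    and rL: "\<And>v. v \<in> Z \<Longrightarrow> r v * ln (c - k v) = 2 * (m (x v) + 3/4 * ln (f v))"
  shows "c - exp (- 4 * m (x u)) = (c - k u) powr (- r u) * ((3 - 4 * r u) / 3 * k u
    + 1/2 * ln (c - k u) * - lap G r u + inverse (c - k u) * gprod G r k u)"
proof -
  have uX: "u \<in> X" using u Z by auto
  have fp: "f v > 0" if "v \<in> Z" for v using f_pos that Z by auto
  have ck: "c - k v > 0" if "v \<in> Z" for v using fp[OF that] by (simp add: k[OF that])
  have fsm: "smooth_on Z f" using f smooth_on_subset Z by blast
  have ksm: "smooth_on Z k"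
  proof (rule smooth_on_cong[OF Z(1)])
    show "smooth_on Z (\<lambda>v. c - 3 * (f v * f v) / 4)"
      by (intro smooth_on_diff smooth_on_divide smooth_on_mult smooth_on_const fsm Z) simp
  qed (simp add: k power2_eq_square)
  define L where "L v = ln (c - k v)" for v
  have Lsm: "smooth_on Z L" unfolding L_def by (intro smooth_on_ln smooth_on_diff smooth_on_const ksm Z ck)
  \<comment> \<open>ln(c - K) = 2 ln f + ln(3/4) and 2 (4c/3 - f^2) = (8/3) K; this produces the
    coefficient 3 - 4r.\<close>
  have lapL: "lap G L u = 8/3 * k u"
  proof -
    define h where "h v = 2 * ln (f v)" for v
    have hs: "smooth_on Z h" unfolding h_def by (intro smooth_on_mult smooth_on_const ln_f_Z Z)
    have "lap G L u = lap G (\<lambda>v. h v + ln (3/4)) u"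
    proof (rule lap_cong_open[OF Z(1) u])
      fix v assume v: "v \<in> Z"
      have "L v = ln ((f v)\<^sup>2 * (3/4))" by (simp add: L_def k[OF v] mult.commute)
      also have "\<dots> = ln ((f v)\<^sup>2) + ln (3/4)" using fp[OF v] by (intro ln_mult_pos) auto
      also have "ln ((f v)\<^sup>2) = h v" using fp[OF v] by (simp add: h_def ln_realpow)
      finally show "L v = h v + ln (3/4)" .
    qed
    also have "\<dots> = lap G h u + lap G (\<lambda>v. ln (3/4)) u" by (rule lap_add[OF Z(1) u hs smooth_on_const])
    also have "lap G (\<lambda>v. ln (3/4)) u = 0"
    proof -
      have "pd j (\<lambda>v. ln (3/4) :: real) = (\<lambda>v. 0)" for j :: 2 by (rule ext) simp
      then show ?thesis by (simp add: lap_def)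
    qed
    also have "lap G h u = 2 * (4/3 * c - (f u)\<^sup>2)"
      unfolding h_def lap_cmult[OF Z(1) u ln_f_Z] lap_ln_f[OF uX] ..
    finally show ?thesis by (simp add: k[OF u])
  qed
  have pdL: "pd i L u = - inverse (c - k u) * pd i k u" for i
    unfolding L_def using smooth_on_differentiable[OF ksm u] ck[OF u]
    by (intro pd_real_chain[of k u "\<lambda>y. ln (c - y)"]) (auto intro!: derivative_eq_intros simp: divide_inverse)
  have gp: "gprod G r L u = - inverse (c - k u) * gprod G r k u"
    unfolding gprod_def pdL by (simp add: sum_distrib_left mult.assoc mult.left_commute)
  have "lap G (\<lambda>v. r v * L v) u = r u * lap G L u + L u * lap G r u + 2 * gprod G r L u"
    by (rule lap_mult[where L = r and M = L and G = G, OF Z(1) u r Lsm metric_inv_sym[OF uX]])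
  moreover have "lap G (\<lambda>v. r v * L v) u = lap G (\<lambda>v. 2 * (m (x v) + 3/4 * ln (f v))) u"
    by (rule lap_cong_open[OF Z(1) u]) (simp add: L_def rL)
  moreover have "lap G (\<lambda>v. 2 * (m (x v) + 3/4 * ln (f v))) u = 2 * lap G (\<lambda>v. m (x v) + 3/4 * ln (f v)) u"
    by (intro lap_cmult[OF Z(1) u] smooth_on_add smooth_on_mult smooth_on_const mx_smooth ln_f_Z Z)
  ultimately have e: "(3 - 4 * r u) / 3 * k u + 1/2 * L u * - lap G r u + inverse (c - k u) * gprod G r k u
     = - ((exp (- 2 * m (x u)) - c * exp (2 * m (x u))) * f u powr (3/2))"
    unfolding lap_exponent[OF u] lapL gp k[OF u, symmetric] by (simp add: field_simps)
  have "(c - k u) powr (- r u) = exp (- (2 * (m (x u) + 3/4 * ln (f u))))"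
    using ck[OF u] rL[OF u] by (simp add: powr_def)
  also have "\<dots> = exp (- 2 * m (x u)) * f u powr (- (3/2))"
    using fp[OF u] by (simp add: powr_def exp_add[symmetric])
  finally have p: "(c - k u) powr (- r u) = exp (- 2 * m (x u)) * f u powr (- (3/2))" .
  have q: "f u powr (- (3/2)) * f u powr (3/2) = 1" using fp[OF u] by (simp add: powr_add[symmetric])
  have "exp (- 2 * m (x u)) * f u powr (- (3/2)) * - ((exp (- 2 * m (x u)) - c * exp (2 * m (x u))) * f u powr (3/2))
    = (f u powr (- (3/2)) * f u powr (3/2)) * (c * (exp (- 2 * m (x u)) * exp (2 * m (x u))) - exp (- 2 * m (x u)) * exp (- 2 * m (x u)))"
    by (simp add: algebra_simps)
  also have "\<dots> = c - exp (- 4 * m (x u))" unfolding q by (simp add: exp_add[symmetric])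
  finally show ?thesis unfolding p L_def[symmetric] e by simp
qed

end

end

section \<open>Scaled metrics on open subsets\<close>

lemma riemannian_metric_scale:
  fixes g :: "('a::{t2_space,second_countable_topology}, 'n::finite) metric"
  assumes SM: "smooth_manifold S A" and g: "riemannian_metric S A g" and U: "open U" "U \<subseteq> S"
    and pos: "\<And>p. p \<in> U \<Longrightarrow> \<rho> p > 0"
    and \<rho>: "smooth_fun U A \<rho>"
  shows "riemannian_metric U A (scale_metric \<rho> g)"
  unfolding riemannian_metric_def
proof (intro conjI ballI)
  fix ch assume ch: "ch \<in> A"
  have "smooth_on (snd ch ` (fst ch \<inter> U)) (loc ch (g ch))"
  proof (rule smooth_on_subset)
    show "smooth_on (snd ch ` (fst ch \<inter> S)) (loc ch (g ch))" using g ch unfolding riemannian_metric_def by blast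
  qed (use U in auto)
  then have "smooth_on (snd ch ` (fst ch \<inter> U)) (\<lambda>v. loc ch \<rho> v *\<^sub>R loc ch (g ch) v)"
    using \<rho> ch open_chart_image[OF SM ch U(1)] by (intro smooth_on_scaleR) (auto simp: smooth_fun_def)
  then show "smooth_on (snd ch ` (fst ch \<inter> U)) (loc ch (scale_metric \<rho> g ch))"
    by (simp add: loc_def[abs_def] scale_metric_def)
next
  fix ch p assume ch: "ch \<in> A" and p: "p \<in> fst ch \<inter> U"
  then have "transpose (g ch p) = g ch p" "\<forall>Z. Z \<noteq> 0 \<longrightarrow> ginner (g ch p) Z Z > 0"
    using g U unfolding riemannian_metric_def by blast+
  moreover have "ginner (a *\<^sub>R Q) Z Z = a * ginner Q Z Z" for a Z and Q :: "real^'n^'n"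
    by (simp add: ginner_def scaleR_matrix_vector_assoc[symmetric])
  moreover have "transpose (a *\<^sub>R Q) = a *\<^sub>R transpose Q" for a and Q :: "real^'n^'n"
    by (simp add: transpose_def vec_eq_iff)
  ultimately show "transpose (scale_metric \<rho> g ch p) = scale_metric \<rho> g ch p"
    "\<forall>Z. Z \<noteq> 0 \<longrightarrow> ginner (scale_metric \<rho> g ch p) Z Z > 0"
    using pos p by (simp_all add: scale_metric_def)
next
  fix ch ch' p assume "ch \<in> A" "ch' \<in> A" "p \<in> fst ch \<inter> fst ch' \<inter> U"
  then have "g ch p = transpose (transition_jacobian ch ch' p) ** g ch' p ** transition_jacobian ch ch' p"
    using g U unfolding riemannian_metric_def by blast
  moreover have "R ** (a *\<^sub>R Q) ** T = a *\<^sub>R (R ** Q ** T)" for a and R Q T :: "real^'n^'n"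
    by (simp add: matrix_matrix_mult_def vec_eq_iff sum_distrib_left sum_distrib_right mult.assoc mult.left_commute)
  ultimately show "scale_metric \<rho> g ch p =
      transpose (transition_jacobian ch ch' p) ** scale_metric \<rho> g ch' p ** transition_jacobian ch ch' p"
    by (simp add: scale_metric_def)
qed

lemma riemannian_surface_scale:
  assumes g: "riemannian_surface S A g" and U: "open U" "U \<subseteq> S" "connected U" "U \<noteq> {}"
    and pos: "\<And>p. p \<in> U \<Longrightarrow> \<rho> p > 0" and \<rho>: "smooth_fun U A \<rho>"
  shows "riemannian_surface U A (scale_metric \<rho> g)"
proof -
  have SM: "smooth_manifold S A" and OA: "oriented_atlas S A" and g': "riemannian_metric S A g"
    using g by (auto simp: riemannian_surface_def surface_def)
  have "smooth_on (snd ch ` (fst ch \<inter> fst ch' \<inter> U)) (loc ch (snd ch'))" if "ch \<in> A" "ch' \<in> A" for ch ch'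
    by (rule smooth_on_subset[OF transition_smooth[OF SM that]]) (use U in auto)
  then have "smooth_manifold U A"
    using SM U unfolding smooth_manifold_def by blast
  moreover have "oriented_atlas U A" using OA U unfolding oriented_atlas_def by blast
  ultimately show ?thesis
    using riemannian_metric_scale[OF SM g' U(1,2) pos \<rho>] U by (simp add: riemannian_surface_def surface_def)
qed

section \<open>The regular set, local primitives and the assembly on the surface\<close>

context biconservative_surface
begin

abbreviation "K \<equiv> gauss_curvature A g"

text \<open>The form f^(3/4) df / |df| in a chart of the surface. No ambient chart enters, so that
  it can be compared between charts of the surface.\<close>

definition "coform ch p i = f p powr (3/4) * (pd i (loc ch f) (snd ch p) /
   sqrt (gprod (loc ch (g ch)) (loc ch f) (loc ch f) (snd ch p)))"

lemma f_differentiable: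
  assumes "ch \<in> A" "p \<in> fst ch" "p \<in> M"
  shows "loc ch f differentiable (at (snd ch p))"
proof -
  obtain e where e: "e \<in> B" "p \<in> dom e" using ambient_chart[OF assms(3)] .
  then show ?thesis
    using smooth_on_differentiable[OF mean_curvature_smooth[OF assms(1) e(1)]] assms by (auto simp: patch_def)
qed

lemma smooth_f: "smooth_fun M A f"
  unfolding smooth_fun_def
proof (intro ballI smooth_on_locally)
  fix ch u assume ch: "ch \<in> A" and "u \<in> snd ch ` (fst ch \<inter> M)"
  then obtain p where p: "u = snd ch p" "p \<in> fst ch" "p \<in> M" by auto
  obtain e where e: "e \<in> B" "p \<in> dom e" using ambient_chart[OF p(3)] .
  show "\<exists>Y. open Y \<and> u \<in> Y \<and> smooth_on Y (loc ch f)"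
    using patch_open[OF ch e(1)] mean_curvature_smooth[OF ch e(1)] p e by (auto simp: patch_def)
qed

lemma pd_f_transition:
  assumes ch: "ch \<in> A" "ch' \<in> A" "p \<in> fst ch" "p \<in> fst ch'" "p \<in> M"
  shows "pd i (loc ch f) (snd ch p) = (\<Sum>k\<in>UNIV. transition_jacobian ch ch' p $ k $ i * pd k (loc ch' f) (snd ch' p))"
  using pd_loc_transition[OF SM ch f_differentiable[OF ch(2,4,5)]] by simp

text \<open>The differentials change by the transposed Jacobian and the inverse metric by the
  inverse congruence, so the Jacobians cancel.\<close>

lemma gprod_transition:
  assumes ch: "ch \<in> A" "ch' \<in> A" "p \<in> fst ch" "p \<in> fst ch'" "p \<in> M"
  shows "gprod (loc ch (g ch)) (loc ch f) (loc ch f) (snd ch p) =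
    gprod (loc ch' (g ch')) (loc ch' f) (loc ch' f) (snd ch' p)"
proof -
  define J where "J = transition_jacobian ch ch' p"
  define d :: "2 \<Rightarrow> real" where "d i = pd i (loc ch f) (snd ch p)" for i
  define d' :: "real^2" where "d' = (\<chi> i. pd i (loc ch' f) (snd ch' p))"
  have gp: "gprod G L L u = (\<chi> i. pd i L u) \<bullet> (matrix_inv (G u) *v (\<chi> i. pd i L u))" for G :: "real^2 \<Rightarrow> real^2^2" and L u
    by (simp add: gprod_def inner_vec_def matrix_vector_mult_def sum_distrib_left mult.assoc mult.left_commute)
  have d: "(\<chi> i. pd i (loc ch f) (snd ch p)) = transpose J *v d'"
    unfolding vec_eq_iff pd_f_transition[OF ch] by (simp add: matrix_vector_mult_def transpose_def J_def d'_def)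
  note jinv = jacobian_invertible[OF ch, folded J_def]
  note j = matrix_inv_inverse[OF jinv]
  have jt: "transpose (matrix_inv J) ** transpose J = mat 1" using j by (metis matrix_transpose_mul transpose_mat)
  have g: "loc ch (g ch) (snd ch p) = transpose J ** g ch' p ** J"
    using metric_transform[OF ch] ch by (simp add: loc_at[OF SM] J_def)
  have dot: "(transpose J *v a) \<bullet> b = a \<bullet> (J *v b)" for a b
    by (metis dot_lmul_matrix transpose_matrix_vector)
  have "J ** (matrix_inv J ** matrix_inv (g ch' p) ** transpose (matrix_inv J)) ** transpose J
    = (J ** matrix_inv J) ** matrix_inv (g ch' p) ** (transpose (matrix_inv J) ** transpose J)"
    by (simp add: matrix_mul_assoc)
  then have q: "J ** (matrix_inv J ** matrix_inv (g ch' p) ** transpose (matrix_inv J)) ** transpose J = matrix_inv (g ch' p)"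
    by (simp add: j jt)
  show ?thesis
    unfolding gp d g inverse_congruence[OF jinv g_invertible[OF ch(2,4,5)]] dot matrix_vector_mul_assoc
    using q ch by (simp add: d'_def loc_at[OF SM] matrix_mul_assoc)
qed

lemma coform_transition:
  assumes ch: "ch \<in> A" "ch' \<in> A" "p \<in> fst ch" "p \<in> fst ch'" "p \<in> M"
  shows "coform ch p i = (\<Sum>k\<in>UNIV. transition_jacobian ch ch' p $ k $ i * coform ch' p k)"
  unfolding coform_def gprod_transition[OF ch] pd_f_transition[OF ch]
  by (simp add: sum_distrib_left sum_divide_distrib mult.left_commute)

lemma patch_coform:
  assumes ch: "ch \<in> A" and p: "p \<in> fst ch" and e: "e \<in> B"
  shows "biconservative_patch.\<omega> (loc ch (g ch)) (loc ch f) i (snd ch p) = coform ch p i"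
proof -
  interpret P: biconservative_patch "snd e ` (fst e \<inter> N)" "loc e (h e)" "patch ch e" "loc ch (snd e \<circ> \<phi>)"
    "loc ch (g ch)" "loc ch (\<eta> e)" "loc ch f" c
    by (rule biconservative_patch[OF ch e])
  show ?thesis unfolding P.\<omega>_def P.n_def P.nf_def coform_def by (simp add: loc_at[OF SM ch p])
qed

text \<open>By \<open>gauss_curvature_eq\<close> the condition means c - K \<noteq> 1: there the
  logarithm of the base is non-zero, and the exponent can be solved for.\<close>

definition "regular_set = {p \<in> M. 3 / 4 * (f p)\<^sup>2 \<noteq> 1}"

lemma regular_nbhd:
  assumes ch: "ch \<in> A" and e: "e \<in> B"
  shows "open {u \<in> patch ch e. 3 / 4 * (loc ch f u)\<^sup>2 \<noteq> 1}"
proof -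
  have "continuous_on (patch ch e) (\<lambda>u. 3 / 4 * (loc ch f u)\<^sup>2)"
    by (intro continuous_intros smooth_on_continuous mean_curvature_smooth[OF ch e])
  then have "open (patch ch e \<inter> (\<lambda>u. 3 / 4 * (loc ch f u)\<^sup>2) -` (- {1}))"
    by (rule continuous_open_preimage[OF _ patch_open[OF ch e]]) auto
  moreover have "{u \<in> patch ch e. 3 / 4 * (loc ch f u)\<^sup>2 \<noteq> 1} = patch ch e \<inter> (\<lambda>u. 3 / 4 * (loc ch f u)\<^sup>2) -` (- {1})"
    by auto
  ultimately show ?thesis by simp
qed

lemma chart_preimage:
  assumes ch: "ch \<in> A" and e: "e \<in> B" and V: "open V" "V \<subseteq> patch ch e"
  defines "U \<equiv> {p \<in> fst ch. snd ch p \<in> V}"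
  shows "open U" "U \<subseteq> fst ch \<inter> dom e" "snd ch ` U = V" "U = inv_into (fst ch) (snd ch) ` V"
proof -
  have "open (fst ch \<inter> snd ch -` V)"
    by (rule continuous_open_preimage[OF chart_continuous(1)[OF SM ch] chart_homeomorphism(1)[OF SM ch] V(1)])
  moreover have "U = fst ch \<inter> snd ch -` V" by (auto simp: U_def)
  ultimately show "open U" by simp
  have inv: "\<exists>p. p \<in> fst ch \<and> p \<in> dom e \<and> v = snd ch p" if "v \<in> V" for v
    using V that by (auto simp: patch_def)
  show "U \<subseteq> fst ch \<inter> dom e"
  proof
    fix p assume p: "p \<in> U"
    then obtain q where q: "q \<in> fst ch" "q \<in> dom e" "snd ch p = snd ch q" using inv[of "snd ch p"] by (auto simp: U_def)
    have "p = q" using chart_inverse[OF SM ch, of p] chart_inverse[OF SM ch, of q] p q by (simp add: U_def)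
    then show "p \<in> fst ch \<inter> dom e" using q by simp
  qed
  show V: "snd ch ` U = V" unfolding U_def using inv by auto
  have "(\<lambda>p. inv_into (fst ch) (snd ch) (snd ch p)) ` U = (\<lambda>p. p) ` U"
    by (rule image_cong) (simp_all add: U_def chart_inverse[OF SM ch])
  then show "U = inv_into (fst ch) (snd ch) ` V" unfolding V[symmetric] by (simp add: image_image)
qed

lemma regular_open: "open regular_set"
proof (subst open_subopen, intro ballI)
  fix p assume "p \<in> regular_set"
  then have p: "p \<in> M" "3 / 4 * (f p)\<^sup>2 \<noteq> 1" by (auto simp: regular_set_def)
  obtain ch where ch: "ch \<in> A" "p \<in> fst ch" using chart_at_in[OF SM p(1)] by blast
  obtain e where e: "e \<in> B" "p \<in> dom e" using ambient_chart[OF p(1)] .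
  let ?V = "{u \<in> patch ch e. 3 / 4 * (loc ch f u)\<^sup>2 \<noteq> 1}"
  let ?U = "{p \<in> fst ch. snd ch p \<in> ?V}"
  note U = chart_preimage[OF ch(1) e(1) regular_nbhd[OF ch(1) e(1)], OF Collect_restrict]
  have "?U \<subseteq> regular_set" using U(2) by (auto simp: regular_set_def dom_iff loc_at[OF SM ch(1)])
  moreover have "p \<in> ?U" using p ch e by (auto simp: patch_def loc_at[OF SM ch(1)])
  ultimately show "\<exists>T. open T \<and> p \<in> T \<and> T \<subseteq> regular_set" using U(1) by blast
qed

text \<open>On an open set missing the regular set \<open>f\<close> would be the constant sqrt(4/3),
  contrary to the non-vanishing gradient.\<close>

lemma regular_dense: "M \<subseteq> closure regular_set"
proof
  fix p assume p: "p \<in> M"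
  show "p \<in> closure regular_set"
  proof (rule ccontr)
    assume np: "p \<notin> closure regular_set"
    define U where "U = M \<inter> - closure regular_set"
    have U: "open U" "p \<in> U" unfolding U_def using p np manifold_open[OF SM] by auto
    have const: "f q = sqrt (4 / 3)" if "q \<in> U" for q
    proof -
      have "q \<in> M" "q \<notin> regular_set" using that closure_subset by (auto simp: U_def)
      then have "(f q)\<^sup>2 = 4 / 3" "f q > 0" using mc_pos by (auto simp: regular_set_def)
      then show ?thesis by (metis less_imp_le real_sqrt_unique)
    qed
    obtain ch where ch: "ch \<in> A" "p \<in> fst ch" using chart_at_in[OF SM p] by blast
    have "pd j (loc ch f) (snd ch p) = pd j (\<lambda>u. sqrt (4 / 3)) (snd ch p)" for j
      by (rule pd_cong_open[OF open_chart_image[OF SM ch(1) U(1)]])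
        (use ch U const in \<open>auto simp: loc_at[OF SM ch(1)]\<close>)
    then have "(\<chi> j. pd j (loc ch f) (snd ch p)) = 0" by (simp add: vec_eq_iff)
    then have "gradient g f ch p = 0" by (simp add: gradient_def)
    then show False using mc_grad[OF ch(1)] ch p by blast
  qed
qed

text \<open>The form is integrated on a coordinate ball around \<open>p\<close>. Its primitive
  vanishes at the centre, so a smaller ball keeps the values in the interval where the differential
  equation is solved; the ball also provides connectedness.\<close>

lemma local_primitive:
  assumes p: "p \<in> regular_set" and d: "d > 0"
  obtains U \<xi> where "open U" "connected U" "p \<in> U" "U \<subseteq> regular_set" "smooth_fun U A \<xi>" "\<xi> ` U \<subseteq> {- d<..<d}"
    "\<And>ch q i. ch \<in> A \<Longrightarrow> q \<in> fst ch \<Longrightarrow> q \<in> U \<Longrightarrow> pd i (loc ch \<xi>) (snd ch q) = coform ch q i"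
proof -
  have pM: "p \<in> M" "3 / 4 * (f p)\<^sup>2 \<noteq> 1" using p by (auto simp: regular_set_def)
  obtain ch0 where ch0: "ch0 \<in> A" "p \<in> fst ch0" using chart_at_in[OF SM pM(1)] by blast
  obtain e where e: "e \<in> B" "p \<in> dom e" using ambient_chart[OF pM(1)] .
  interpret P: biconservative_patch "snd e ` (fst e \<inter> N)" "loc e (h e)" "patch ch0 e" "loc ch0 (snd e \<circ> \<phi>)"
    "loc ch0 (g ch0)" "loc ch0 (\<eta> e)" "loc ch0 f" c
    by (rule biconservative_patch[OF ch0(1) e(1)])
  let ?V = "{u \<in> patch ch0 e. 3 / 4 * (loc ch0 f u)\<^sup>2 \<noteq> 1}"
  have pV: "snd ch0 p \<in> ?V" using ch0 e pM by (auto simp: patch_def loc_at[OF SM ch0(1)])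
  obtain \<epsilon> where \<epsilon>: "\<epsilon> > 0" "ball (snd ch0 p) \<epsilon> \<subseteq> ?V"
    by (rule openE[OF regular_nbhd[OF ch0(1) e(1)] pV])
  have sub: "ball (snd ch0 p) \<epsilon> \<subseteq> patch ch0 e" using \<epsilon> by auto
  have "pd i (P.\<omega> j) u = pd j (P.\<omega> i) u" if "u \<in> ball (snd ch0 p) \<epsilon>" for i j :: 2 and u
  proof -
    have "pd 1 (P.\<omega> 2) u = pd 2 (P.\<omega> 1) u" using P.\<omega>_closed sub that by blast
    then show ?thesis using exhaust_2[of i] exhaust_2[of j] by auto
  qed
  then have "\<exists>x. smooth_on (ball (snd ch0 p) \<epsilon>) x \<and> x (snd ch0 p) = 0 \<and> (\<forall>u\<in>ball (snd ch0 p) \<epsilon>. \<forall>i. pd i x u = P.\<omega> i u)"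
    by (intro closed_form_exact smooth_on_subset[OF P.\<omega>_smooth sub] \<epsilon>(1))
  then obtain x where x: "smooth_on (ball (snd ch0 p) \<epsilon>) x" "x (snd ch0 p) = 0"
    "\<And>u i. u \<in> ball (snd ch0 p) \<epsilon> \<Longrightarrow> pd i x u = P.\<omega> i u" by blast
  have oV: "open (ball (snd ch0 p) \<epsilon> \<inter> x -` {- d<..<d})"
    by (rule continuous_open_preimage[OF smooth_on_continuous[OF x(1)]]) auto
  have pV: "snd ch0 p \<in> ball (snd ch0 p) \<epsilon> \<inter> x -` {- d<..<d}" using \<epsilon> d x(2) by simp
  obtain \<delta> where \<delta>: "\<delta> > 0" "ball (snd ch0 p) \<delta> \<subseteq> ball (snd ch0 p) \<epsilon> \<inter> x -` {- d<..<d}"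
    by (rule openE[OF oV pV])
  let ?b = "ball (snd ch0 p) \<delta>"
  define U where "U = {q \<in> fst ch0. snd ch0 q \<in> ?b}"
  define \<xi> where "\<xi> q = x (snd ch0 q)" for q
  have bsub: "?b \<subseteq> ball (snd ch0 p) \<epsilon>" "?b \<subseteq> patch ch0 e" using \<delta> sub by auto
  note U = chart_preimage[OF ch0(1) e(1) open_ball bsub(2), folded U_def]
  have UM: "U \<subseteq> M" "U \<subseteq> fst ch0" using U(2) by (auto simp: dom_iff)
  have xb: "smooth_on (snd ch0 ` U) x" unfolding U(3) by (rule smooth_on_subset[OF x(1) bsub(1)])
  \<comment> \<open>\<open>\<xi>\<close> was built in \<open>ch0\<close>; differentials and
    \<open>coform\<close> transform alike, so the relation passes to every chart.\<close>
  have pdx: "pd i (loc ch \<xi>) (snd ch q) = coform ch q i" if ch: "ch \<in> A" "q \<in> fst ch" "q \<in> U" for ch q i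
  proof -
    have q: "q \<in> fst ch0" "q \<in> M" "snd ch0 q \<in> ?b" using ch UM by (auto simp: U_def)
    have lx: "loc ch0 \<xi> v = x v" if "v \<in> ?b" for v
      using U(3) that loc_at[OF SM ch0(1), of _ \<xi>] UM by (force simp: \<xi>_def)
    have d0: "loc ch0 \<xi> differentiable (at (snd ch0 q))"
      by (rule differentiable_cong_open[OF open_ball q(3), of x])
        (use lx smooth_on_differentiable[OF x(1)] bsub q in auto)
    have p0: "pd k (loc ch0 \<xi>) (snd ch0 q) = coform ch0 q k" for k
      using pd_cong_open[OF open_ball q(3) lx, where i = k] x(3)[of "snd ch0 q" k] bsub q(3)
        patch_coform[OF ch0(1) q(1) e(1)] by auto
    show ?thesis
      using pd_loc_transition[OF SM ch(1) ch0(1) ch(2) q(1,2) d0, of i] coform_transition[OF ch(1) ch0(1) ch(2) q(1,2), of i]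
      by (simp add: p0)
  qed
  show thesis
  proof (rule that[of U \<xi>])
    show "open U" by (rule U(1))
    have "?b \<subseteq> snd ch0 ` fst ch0" using U(3) UM(2) by blast
    then show "connected U" unfolding U(4)
      by (rule connected_continuous_image[OF continuous_on_subset[OF chart_continuous(2)[OF SM ch0(1)]] connected_ball])
    show "p \<in> U" using ch0 \<delta> by (simp add: U_def)
    show "U \<subseteq> regular_set"
      using UM \<epsilon>(2) bsub(1) by (force simp: regular_set_def U_def loc_at[OF SM ch0(1)])
    show "smooth_fun U A \<xi>" unfolding smooth_fun_def \<xi>_def
      using smooth_loc_transition[OF SM _ ch0(1) U(1) UM xb] by blast
    show "\<xi> ` U \<subseteq> {- d<..<d}" using \<delta>(2) by (auto simp: \<xi>_def U_def)
    show "pd i (loc ch \<xi>) (snd ch q) = coform ch q i" if "ch \<in> A" "q \<in> fst ch" "q \<in> U" for ch q i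
      by (rule pdx[OF that])
  qed
qed

lemma ricci_at:
  assumes p: "p \<in> regular_set"
  shows "\<exists>U r. open U \<and> p \<in> U \<and> U \<subseteq> regular_set \<and> smooth_fun U A r \<and>
      (let g\<^sub>r = scale_metric (\<lambda>q. (c - K q) powr r q) g; K\<^sub>r = gauss_curvature A g\<^sub>r in
        ricci_surface c U A g\<^sub>r \<and>
        (\<forall>q\<in>U. K q + laplacian A g (\<lambda>q. 1/4 * ln (c - K\<^sub>r q) + r q / 2 * ln (c - K q)) q = 0) \<and>
        (\<forall>q\<in>U. K\<^sub>r q = (c - K q) powr (- r q) *
           ((3 - 4 * r q) / 3 * K q + 1/2 * ln (c - K q) * laplacian A g r q
            + inverse (c - K q) * inner_field A g (gradient g r) (gradient g K) q)))"
proof -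
  obtain d m m' where d: "d > 0" and m: "smooth_on {- d<..<d} m"
    "\<And>s. s \<in> {- d<..<d} \<Longrightarrow> (m has_real_derivative m' s) (at s)"
    "\<And>s. s \<in> {- d<..<d} \<Longrightarrow> (m' has_real_derivative exp (- 2 * m s) - c * exp (2 * m s)) (at s)"
    using ricci_ode[of c] by blast
  obtain U \<xi> where U: "open U" "connected U" "p \<in> U" "U \<subseteq> regular_set" and \<xi>: "smooth_fun U A \<xi>" "\<xi> ` U \<subseteq> {- d<..<d}"
    "\<And>ch q i. ch \<in> A \<Longrightarrow> q \<in> fst ch \<Longrightarrow> q \<in> U \<Longrightarrow> pd i (loc ch \<xi>) (snd ch q) = coform ch q i"
    using local_primitive[OF p d] by blast
  have UM: "U \<subseteq> M" using U by (auto simp: regular_set_def)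
  \<comment> \<open>Solves (c - K)^r = e^(2m(\<xi>)) f^(3/2) for the exponent, with c - K = (3/4)
    f^2.\<close>
  define r where "r q = 2 * (m (\<xi> q) + 3/4 * ln (f q)) / ln (3/4 * (f q)\<^sup>2)" for q
  define g\<^sub>r where "g\<^sub>r = scale_metric (\<lambda>q. (c - K q) powr r q) g"
  define K\<^sub>r where "K\<^sub>r = gauss_curvature A g\<^sub>r"
  have fp: "f q > 0" if "q \<in> M" for q by (rule mc_pos[OF that])
  have Kq: "K q = c - 3 * (f q)\<^sup>2 / 4" if "q \<in> M" for q by (rule gauss_curvature_eq[OF that])
  have rL: "r q * ln (c - K q) = 2 * (m (\<xi> q) + 3/4 * ln (f q))" if q: "q \<in> U" for q
  proof -
    have "q \<in> M" "3/4 * (f q)\<^sup>2 \<noteq> 1" using q U by (auto simp: regular_set_def)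
    moreover have "3/4 * (f q)\<^sup>2 > 0" using fp[OF \<open>q \<in> M\<close>] by simp
    ultimately have nz: "ln (3/4 * (f q)\<^sup>2) \<noteq> 0" using ln_eq_zero_iff by blast
    have ck: "c - K q = 3/4 * (f q)\<^sup>2" using Kq \<open>q \<in> M\<close> by simp
    show ?thesis unfolding r_def ck by (rule nonzero_eq_divide_eq[THEN iffD1, OF nz refl])
  qed
  have scale: "(c - K q) powr r q = exp (2 * m (\<xi> q)) * f q powr (3/2)" if q: "q \<in> U" for q
  proof -
    have "q \<in> M" using q UM by auto
    then have "c - K q \<noteq> 0" using Kq fp by force
    then have "(c - K q) powr r q = exp (2 * (m (\<xi> q) + 3/4 * ln (f q)))" using rL[OF q] by (simp add: powr_def)
    then show ?thesis using fp[OF \<open>q \<in> M\<close>] by (simp add: powr_def exp_add[symmetric])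
  qed
  have chart: "open (snd ch ` (fst ch \<inter> U))" if "ch \<in> A" for ch by (rule open_chart_image[OF SM that U(1)])
  have fsm: "smooth_on (snd ch ` (fst ch \<inter> U)) (loc ch f)" if "ch \<in> A" for ch
    by (rule smooth_on_subset[of "snd ch ` (fst ch \<inter> M)"]) (use smooth_f that UM in \<open>auto simp: smooth_fun_def\<close>)
  have \<xi>sm: "smooth_on (snd ch ` (fst ch \<inter> U)) (loc ch \<xi>)" if "ch \<in> A" for ch
    using \<xi>(1) that by (simp add: smooth_fun_def)
  have msm: "smooth_on (snd ch ` (fst ch \<inter> U)) (\<lambda>v. m (loc ch \<xi> v))" if "ch \<in> A" for ch
    by (rule smooth_on_compose[OF chart[OF that] _ \<xi>sm[OF that] m(1)]) (use \<xi>(2) in \<open>auto simp: loc_at[OF SM that]\<close>)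
  have fpos: "loc ch f v > 0" if "ch \<in> A" "v \<in> snd ch ` (fst ch \<inter> U)" for ch v
    using that fp UM by (auto simp: loc_at[OF SM that(1)])
  have rsm: "smooth_fun U A r"
    unfolding smooth_fun_def
  proof
    fix ch assume ch: "ch \<in> A"
    have "ln (3/4 * (loc ch f v * loc ch f v)) \<noteq> 0" "3/4 * (loc ch f v * loc ch f v) > 0" if v: "v \<in> snd ch ` (fst ch \<inter> U)" for v
    proof -
      obtain q where q: "v = snd ch q" "q \<in> fst ch" "q \<in> U" using v by auto
      then have "3/4 * (f q * f q) \<noteq> 1" "f q > 0" using U fp by (auto simp: regular_set_def power2_eq_square)
      moreover from this have p: "3/4 * (f q * f q) > 0" by simp
      ultimately show "ln (3/4 * (loc ch f v * loc ch f v)) \<noteq> 0" "3/4 * (loc ch f v * loc ch f v) > 0"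
        unfolding q(1) loc_at[OF SM ch q(2)] using ln_eq_zero_iff[OF p] by auto
    qed
    then have "smooth_on (snd ch ` (fst ch \<inter> U))
      (\<lambda>v. 2 * (m (loc ch \<xi> v) + 3/4 * ln (loc ch f v)) / ln (3/4 * (loc ch f v * loc ch f v)))"
      using fpos[OF ch]
      by (intro smooth_on_divide smooth_on_mult smooth_on_add smooth_on_ln smooth_on_const msm fsm chart ch) auto
    then show "smooth_on (snd ch ` (fst ch \<inter> U)) (loc ch r)"
      by (simp add: loc_def[abs_def] r_def power2_eq_square)
  qed
  have ssm: "smooth_fun U A (\<lambda>q. (c - K q) powr r q)"
    unfolding smooth_fun_def
  proof
    fix ch assume ch: "ch \<in> A"
    have "smooth_on (snd ch ` (fst ch \<inter> U)) (\<lambda>v. exp (2 * m (loc ch \<xi> v)) * loc ch f v powr (3/2))"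
      using fpos[OF ch] by (intro smooth_on_mult smooth_on_exp smooth_on_const smooth_on_powr msm fsm chart ch) auto
    then show "smooth_on (snd ch ` (fst ch \<inter> U)) (loc ch (\<lambda>q. (c - K q) powr r q))"
      by (rule smooth_on_cong[OF chart[OF ch], rotated]) (auto simp: loc_at[OF SM ch] scale)
  qed
  have surf_r: "riemannian_surface U A g\<^sub>r"
    unfolding g\<^sub>r_def
  proof (rule riemannian_surface_scale[OF surf U(1) UM U(2) _ _ ssm])
    show "U \<noteq> {}" using U(3) by auto
    show "0 < (c - K q) powr r q" if "q \<in> U" for q using scale[OF that] fp[OF subsetD[OF UM that]] by simp
  qed
  \<comment> \<open>The pointwise identities are proved together because they share the chart picked
    by \<open>chart_at\<close> and one interpretation of the coordinate locale.\<close>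
  have at: "K\<^sub>r q = c - exp (- 4 * m (\<xi> q)) \<and>
      gauss_curvature A (scale_metric (\<lambda>q. f q powr (3/2)) g) q = 0 \<and>
      laplacian A g (\<lambda>q. 3/4 * ln (f q)) q = - K q \<and>
      K\<^sub>r q = (c - K q) powr (- r q) * ((3 - 4 * r q) / 3 * K q + 1/2 * ln (c - K q) * laplacian A g r q
            + inverse (c - K q) * inner_field A g (gradient g r) (gradient g K) q)"
    if q: "q \<in> U" for q
  proof -
    have qM: "q \<in> M" using q UM by auto
    define ch where "ch = chart_at A q"
    have ch: "ch \<in> A" "q \<in> fst ch" unfolding ch_def by (rule chart_at_in[OF SM qM])+
    obtain e where e: "e \<in> B" "q \<in> dom e" using ambient_chart[OF qM] .
    interpret P: biconservative_patch "snd e ` (fst e \<inter> N)" "loc e (h e)" "patch ch e" "loc ch (snd e \<circ> \<phi>)"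
      "loc ch (g ch)" "loc ch (\<eta> e)" "loc ch f" c
      by (rule biconservative_patch[OF ch(1) e(1)])
    define Z where "Z = snd ch ` (fst ch \<inter> (U \<inter> dom e))"
    have Z: "open Z" unfolding Z_def by (rule open_chart_image[OF SM ch(1) open_Int[OF U(1) dom_open[OF e(1)]]])
    have ZP: "Z \<subseteq> patch ch e" and ZU: "Z \<subseteq> snd ch ` (fst ch \<inter> U)" unfolding Z_def patch_def by auto
    have qZ: "snd ch q \<in> Z" unfolding Z_def using ch e q by auto
    have ZE: "\<exists>s. v = snd ch s \<and> s \<in> fst ch \<and> s \<in> U" if "v \<in> Z" for v using that unfolding Z_def by auto
    have x: "smooth_on Z (loc ch \<xi>)" "loc ch \<xi> ` Z \<subseteq> {- d<..<d}" "\<And>i v. v \<in> Z \<Longrightarrow> pd i (loc ch \<xi>) v = P.\<omega> i v"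
    proof -
      show "smooth_on Z (loc ch \<xi>)" by (rule smooth_on_subset[OF \<xi>sm[OF ch(1)] ZU])
      show "loc ch \<xi> ` Z \<subseteq> {- d<..<d}" using \<xi>(2) ZE by (fastforce simp: loc_at[OF SM ch(1)])
      fix i v assume "v \<in> Z"
      then obtain s where s: "v = snd ch s" "s \<in> fst ch" "s \<in> U" using ZE by blast
      then show "pd i (loc ch \<xi>) v = P.\<omega> i v" using \<xi>(3)[OF ch(1) s(2,3)] patch_coform[OF ch(1) s(2) e(1)] by simp
    qed
    note l = loc_at[OF SM ch]
    \<comment> \<open>Curvature depends only on the metric near the point, so any coordinate
      expression agreeing with the scaled metric over \<open>U\<close> may be used.\<close>
    have curv: "gauss_curvature A (scale_metric \<rho> g) q = sectional G (snd ch q) (axis 1 1) (axis 2 1)"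
      if "\<And>s. s \<in> fst ch \<Longrightarrow> s \<in> U \<Longrightarrow> \<rho> s *\<^sub>R g ch s = G (snd ch s)" for \<rho> G
      unfolding gauss_curvature_def ch_def[symmetric] Let_def
      by (rule sectional_cong_open[OF Z qZ]) (use ZE that in \<open>force simp: loc_at[OF SM ch(1)] scale_metric_def\<close>)
    have 1: "K\<^sub>r q = c - exp (- 4 * m (\<xi> q))"
      using P.curvature_exponent[OF Z ZP m x qZ]
        curv[of "\<lambda>q. (c - K q) powr r q" "\<lambda>v. (exp (2 * m (loc ch \<xi> v)) * loc ch f v powr (3/2)) *\<^sub>R loc ch (g ch) v"]
      unfolding K\<^sub>r_def g\<^sub>r_def by (simp add: scale loc_at[OF SM ch(1)] l)
    have 2: "gauss_curvature A (scale_metric (\<lambda>q. f q powr (3/2)) g) q = 0"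
      using P.flat_conformal[of "snd ch q"] qZ ZP
        curv[of "\<lambda>q. f q powr (3/2)" "\<lambda>v. loc ch f v powr (3/2) *\<^sub>R loc ch (g ch) v"]
      by (auto simp: loc_at[OF SM ch(1)])
    have lapq: "laplacian A g F q = - lap (loc ch (g ch)) (loc ch F) (snd ch q)" for F
      unfolding laplacian_def ch_def[symmetric] Let_def lap_def ..
    have 3: "laplacian A g (\<lambda>q. 3/4 * ln (f q)) q = - K q"
    proof -
      have ln: "loc ch (\<lambda>q. 3/4 * ln (f q)) = (\<lambda>v. 3/4 * ln (loc ch f v))" by (simp add: loc_def[abs_def])
      have uP: "snd ch q \<in> patch ch e" using qZ ZP by auto
      show ?thesis
        unfolding lapq ln lap_cmult[OF P.X uP P.ln_f_smooth] P.lap_ln_f[OF uP] l Kq[OF qM] by (simp add: field_simps)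
    qed
    have inner: "inner_field A g (gradient g r) (gradient g K) q = gprod (loc ch (g ch)) (loc ch r) (loc ch K) (snd ch q)"
      unfolding inner_field_def ch_def[symmetric] Let_def gradient_def
      using P.gprod_grad[of "snd ch q"] qZ ZP by (auto simp: l)
    have 4: "c - exp (- 4 * m (loc ch \<xi> (snd ch q))) = (c - loc ch K (snd ch q)) powr (- loc ch r (snd ch q)) *
      ((3 - 4 * loc ch r (snd ch q)) / 3 * loc ch K (snd ch q)
      + 1/2 * ln (c - loc ch K (snd ch q)) * - lap (loc ch (g ch)) (loc ch r) (snd ch q)
      + inverse (c - loc ch K (snd ch q)) * gprod (loc ch (g ch)) (loc ch r) (loc ch K) (snd ch q))"
    proof (rule P.curvature_formula[OF Z ZP m x qZ])
      show "smooth_on Z (loc ch r)" by (rule smooth_on_subset[OF _ ZU]) (use rsm ch in \<open>auto simp: smooth_fun_def\<close>)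
      fix v assume "v \<in> Z"
      then obtain s where s: "v = snd ch s" "s \<in> fst ch" "s \<in> U" using ZE by blast
      then have "s \<in> M" using UM by auto
      then show "loc ch K v = c - 3 * (loc ch f v)\<^sup>2 / 4" using Kq by (simp add: s loc_at[OF SM ch(1)])
      show "loc ch r v * ln (c - loc ch K v) = 2 * (m (loc ch \<xi> v) + 3/4 * ln (loc ch f v))"
        using rL[OF s(3)] by (simp add: s loc_at[OF SM ch(1)])
    qed
    show ?thesis
      using 1 2 3 4 unfolding lapq[of r] inner l by simp
  qed
  have flat: "flat_surface U A (scale_metric (\<lambda>q. (c - gauss_curvature A g\<^sub>r q) powr (1/2)) g\<^sub>r)"
    unfolding flat_surface_def
  proof
    fix q assume q: "q \<in> U"
    have qM: "q \<in> M" using q UM by auto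
    define ch where "ch = chart_at A q"
    have ch: "ch \<in> A" "q \<in> fst ch" unfolding ch_def by (rule chart_at_in[OF SM qM])+
    have "(c - gauss_curvature A g\<^sub>r s) powr (1/2) *\<^sub>R ((c - K s) powr r s *\<^sub>R g ch s) = f s powr (3/2) *\<^sub>R g ch s" if s: "s \<in> U" for s
    proof -
      have "c - gauss_curvature A g\<^sub>r s = exp (- 4 * m (\<xi> s))" using at[OF s] unfolding K\<^sub>r_def by simp
      then have "(c - gauss_curvature A g\<^sub>r s) powr (1/2) = exp (- 2 * m (\<xi> s))" by (simp add: powr_def)
      then show ?thesis using scale[OF s] by (simp add: exp_add[symmetric] mult.assoc[symmetric])
    qed
    then have "gauss_curvature A (scale_metric (\<lambda>q. (c - gauss_curvature A g\<^sub>r q) powr (1/2)) g\<^sub>r) q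
      = gauss_curvature A (scale_metric (\<lambda>q. f q powr (3/2)) g) q"
      unfolding gauss_curvature_def[of A "scale_metric _ _"] ch_def[symmetric] Let_def
      by (intro sectional_cong_open[OF chart[OF ch(1)]]) (use ch q in \<open>auto simp: loc_at[OF SM ch(1)] scale_metric_def g\<^sub>r_def\<close>)
    then show "gauss_curvature A (scale_metric (\<lambda>q. (c - gauss_curvature A g\<^sub>r q) powr (1/2)) g\<^sub>r) q = 0"
      using at[OF q] by simp
  qed
  have ricci: "ricci_surface c U A g\<^sub>r"
    unfolding ricci_surface_def using surf_r flat at unfolding K\<^sub>r_def by simp
  have eq: "K q + laplacian A g (\<lambda>q. 1/4 * ln (c - K\<^sub>r q) + r q / 2 * ln (c - K q)) q = 0" if q: "q \<in> U" for q
  proof -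
    have qM: "q \<in> M" using q UM by auto
    define ch where "ch = chart_at A q"
    have ch: "ch \<in> A" "q \<in> fst ch" unfolding ch_def by (rule chart_at_in[OF SM qM])+
    \<comment> \<open>ln(c - K_r) = - 4m and r ln(c - K) = 2m + (3/2) ln f, so \<open>m\<close>
      drops out.\<close>
    have e: "1/4 * ln (c - K\<^sub>r s) + r s / 2 * ln (c - K s) = 3/4 * ln (f s)" if s: "s \<in> U" for s
    proof -
      have "ln (c - K\<^sub>r s) = - 4 * m (\<xi> s)" using at[OF s] by simp
      then show ?thesis using rL[OF s] by (simp add: field_simps)
    qed
    have "lap (loc ch (g ch)) (loc ch (\<lambda>q. 1/4 * ln (c - K\<^sub>r q) + r q / 2 * ln (c - K q))) (snd ch q)
      = lap (loc ch (g ch)) (loc ch (\<lambda>q. 3/4 * ln (f q))) (snd ch q)"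
      by (rule lap_cong_open[OF chart[OF ch(1)]]) (use ch q e in \<open>auto simp: loc_at[OF SM ch(1)]\<close>)
    then have "laplacian A g (\<lambda>q. 1/4 * ln (c - K\<^sub>r q) + r q / 2 * ln (c - K q)) q = laplacian A g (\<lambda>q. 3/4 * ln (f q)) q"
      unfolding laplacian_def ch_def[symmetric] Let_def lap_def by simp
    then show ?thesis using at[OF q] by simp
  qed
  show ?thesis
    unfolding Let_def
    using U(1,3,4) rsm ricci eq at unfolding K\<^sub>r_def g\<^sub>r_def by (intro exI[of _ U] exI[of _ r]) blast
qed

end

theorem theorem3p7:
  fixes c :: real
    and M :: "'a::{t2_space,second_countable_topology} set"
    and A :: "('a, 2) chart set"
    and g :: "('a, 2) metric"
    and N :: "'b::{t2_space,second_countable_topology} set"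
    and B :: "('b, 3) chart set"
    and h :: "('b, 3) metric"
    and \<phi> :: "'a \<Rightarrow> 'b"
    and \<eta> :: "('b, 3) chart \<Rightarrow> 'a \<Rightarrow> real^3"
    and K f :: "'a \<Rightarrow> real"
  defines "K \<equiv> gauss_curvature A g"
    and "f \<equiv> mean_curvature A B g h \<phi> \<eta>"
  assumes "space_form3 N B h c"
    and "riemannian_surface M A g"
    and "isometric_immersion M A g N B h \<phi>"
    and "unit_normal_field M A B h \<phi> \<eta>"
    and "biconservative M A B g h \<phi> \<eta>"
    and "\<forall>p\<in>M. f p > 0"
    and "\<forall>ch\<in>A. \<forall>p\<in>fst ch \<inter> M. gradient g f ch p \<noteq> 0"
  shows "\<exists>W. open W \<and> W \<subseteq> M \<and> M \<subseteq> closure W \<and>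
    (\<forall>p\<in>W. \<exists>U r. open U \<and> p \<in> U \<and> U \<subseteq> W \<and> smooth_fun U A r \<and>
      (let g\<^sub>r = scale_metric (\<lambda>q. (c - K q) powr r q) g; K\<^sub>r = gauss_curvature A g\<^sub>r in
        ricci_surface c U A g\<^sub>r \<and>
        (\<forall>q\<in>U. K q + laplacian A g (\<lambda>q. 1/4 * ln (c - K\<^sub>r q) + r q / 2 * ln (c - K q)) q = 0) \<and>
        (\<forall>q\<in>U. K\<^sub>r q = (c - K q) powr (- r q) *
           ((3 - 4 * r q) / 3 * K q + 1/2 * ln (c - K q) * laplacian A g r q
            + inverse (c - K q) * inner_field A g (gradient g r) (gradient g K) q))))"
proof -
  interpret biconservative_surface c M A g N B h \<phi> \<eta>
    using assms(3-9) unfolding f_def by unfold_locales auto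
  show ?thesis
    unfolding K_def
  proof (rule exI[of _ regular_set], intro conjI ballI)
    show "regular_set \<subseteq> M" by (auto simp: regular_set_def)
  qed (rule regular_open regular_dense ricci_at | assumption)+
qed

end
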